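(* Let $F$ be a fullerene with master polyhedron $M$, and let each master edge of $F$ be described by its Coxeter coordinates $(a,b)$ (non-negative integers). If there is an integer $k>1$ dividing both Coxeter coordinates of every master edge of $F$, then $F$ is a Goldberg–Coxeter fullerene. Namely, $F$ is obtained from some fullerene by the $k$-inflation, the Goldberg–Coxeter transformation $(k,0)$.
   Context: A fullerene is a 3-regular plane graph all of whose faces are pentagons or hexagons; there are exactly 12 pentagons. Its dual is a plane triangulation, which can be unfolded locally onto the Eisenstein plane. This is the complex plane with the triangular lattice $\{a+b\omega : a,b\in\mathbb{Z}\}$, where $\omega=e^{i\pi/3}$, so that $\omega^2=\omega-1$ and $\omega^3=-1$. The master polyhedron of the fullerene is the triangulated polyhedron whose vertices are the 12 pentagons. Its edges, the master edges, are straight segments in the unfolded lattice joining pentagon centers. Its faces are called facets. A master edge is the lattice vector $a+b\omega$, and its Coxeter coordinates are $(a,b)$ with $a,b\ge 0$. The Goldberg–Coxeter transformation $(k,l)$, with integers $k\ge 1$ and $l\ge 0$, replaces each triangular face of the dual of the fullerene with the triangular graphene patch spanned by $k+l\omega$. Equivalently, every master edge vector $a+b\omega$ is multiplied by the Eisenstein integer $k+l\omega$, so that $(a,b)\mapsto (ka-lb,\; la+(k+l)b)$. The transformation $(k,0)$ is called the $k$-inflation; it sends $(a,b)\mapsto(ka,kb)$. A Goldberg–Coxeter fullerene is a fullerene obtained from some fullerene by a Goldberg–Coxeter transformation $(k,l)\neq(1,0)$. *)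

theory Defs
  imports "HOL-Analysis.Analysis" "HOL-Combinatorics.Orbits"
begin

section \<open>Plane graphs as rotation systems\<close>

text \<open>
  A graph embedded in an oriented surface is given by its darts (directed edges): \<open>opp\<close> reverses
  a dart and \<open>nxt\<close> sends it to the counterclockwise next dart with the same origin.  The vertices,
  edges and faces are the orbits of \<open>nxt\<close>, \<open>opp\<close> and \<open>face_next\<close>; a face is identified with the set
  of darts having it on their left, so its cardinality is the length of its boundary walk.
\<close>

record 'a cmap =
  darts :: "'a set"
  nxt :: "'a \<Rightarrow> 'a"
  opp :: "'a \<Rightarrow> 'a"

definition face_next :: "'a cmap \<Rightarrow> 'a \<Rightarrow> 'a" where
  "face_next X d = inv (nxt X) (opp X d)"

definition verts :: "'a cmap \<Rightarrow> 'a set set" where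
  "verts X = orbit (nxt X) ` darts X"

definition edges :: "'a cmap \<Rightarrow> 'a set set" where
  "edges X = orbit (opp X) ` darts X"

definition faces :: "'a cmap \<Rightarrow> 'a set set" where
  "faces X = orbit (face_next X) ` darts X"

text \<open>Finite connected maps on the sphere; loops and parallel edges are allowed here.\<close>

definition plane_map :: "'a cmap \<Rightarrow> bool" where
  "plane_map X \<longleftrightarrow>
     finite (darts X) \<and> darts X \<noteq> {} \<and>
     nxt X permutes darts X \<and> opp X permutes darts X \<and>
     (\<forall>d\<in>darts X. opp X d \<noteq> d \<and> opp X (opp X d) = d) \<and>
     (\<forall>d\<in>darts X. \<forall>e\<in>darts X. (d, e) \<in> ({(x, nxt X x) |x. True} \<union> {(x, opp X x) |x. True})\<^sup>*) \<and>
     int (card (verts X)) - int (card (edges X)) + int (card (faces X)) = 2"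

definition simple_map :: "'a cmap \<Rightarrow> bool" where
  "simple_map X \<longleftrightarrow>
     (\<forall>d\<in>darts X. opp X d \<notin> orbit (nxt X) d) \<and>
     (\<forall>d\<in>darts X. \<forall>e\<in>darts X.
        e \<in> orbit (nxt X) d \<and> opp X e \<in> orbit (nxt X) (opp X d) \<longrightarrow> e = d)"

definition fullerene :: "'a cmap \<Rightarrow> bool" where
  "fullerene F \<longleftrightarrow> plane_map F \<and> simple_map F \<and>
     (\<forall>v\<in>verts F. card v = 3) \<and> (\<forall>f\<in>faces F. card f = 5 \<or> card f = 6)"

definition pentagons :: "'a cmap \<Rightarrow> 'a set set" where
  "pentagons F = {f \<in> faces F. card f = 5}"

text \<open>
  In the dual, the dart \<open>d\<close> stands for the dual edge crossing \<open>d\<close> from its left face to its right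
  face.  Hence \<open>verts (dual F) = faces F\<close>, and the orientation of the surface is kept.
\<close>

definition dual :: "'a cmap \<Rightarrow> 'a cmap" where
  "dual F = \<lparr>darts = darts F, nxt = face_next F, opp = opp F\<rparr>"


section \<open>The Eisenstein plane\<close>

definition omega :: complex where
  "omega = cis (pi / 3)"

definition eisenstein :: "complex set" where
  "eisenstein = {of_int a + of_int b * omega |a b. True}"

text \<open>
  A dart \<open>(p, u)\<close> of the triangular lattice goes from \<open>p\<close> to \<open>p + u\<close>, the sixth root of unity \<open>u\<close>
  being its direction.
\<close>

type_synonym ldart = "complex \<times> complex"

definition lattice_darts :: "ldart set" where
  "lattice_darts = eisenstein \<times> {u. u ^ 6 = 1}"

definition lopp :: "ldart \<Rightarrow> ldart" where
  "lopp = (\<lambda>(p, u). (p + u, - u))"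

definition lface_next :: "ldart \<Rightarrow> ldart" where
  "lface_next = (\<lambda>(p, u). (p + u, omega ^ 2 * u))"

text \<open>The motion of the plane taking the dart \<open>(0, 1)\<close> to \<open>(p, u)\<close>, on points and on darts.\<close>

definition place :: "ldart \<Rightarrow> complex \<Rightarrow> complex" where
  "place = (\<lambda>(p, u) w. p + u * w)"

definition move :: "ldart \<Rightarrow> ldart \<Rightarrow> ldart" where
  "move g = (\<lambda>(p, u). (place g p, snd g * u))"

definition unit_cell :: "complex set" where
  "unit_cell = interior (convex hull {0, 1, omega})"

text \<open>The open lattice triangle to the left of a lattice dart, and the open segment it spans.\<close>

definition cell :: "ldart \<Rightarrow> complex set" where
  "cell x = place x ` unit_cell"

definition side :: "ldart \<Rightarrow> complex set" where
  "side x = open_segment (fst x) (fst x + snd x)"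

definition coxeter_vec :: "nat \<times> nat \<Rightarrow> complex" where
  "coxeter_vec c = of_nat (fst c) + of_nat (snd c) * omega"


section \<open>Straight triangulations of an unfolded triangulation\<close>

text \<open>
  Let \<open>T\<close> be a plane triangulation, viewed as a surface glued from unit equilateral triangles, and
  let \<open>M\<close> be another one.  The locale describes a drawing of \<open>M\<close> on that surface in which every
  edge is a straight segment of the unfolded lattice and every facet is a flat lattice triangle.

  A dart \<open>m\<close> of \<open>M\<close> comes with its Coxeter coordinates \<open>cox m = (a, b)\<close> and with an unfolding of
  the facet on its left in which \<open>m\<close> runs from \<open>0\<close> to \<open>a + b\<omega>\<close> and the third corner
  is \<open>apex m\<close>.  The unfolding is recorded by \<open>dev m\<close>, sending a lattice dart whose left triangle meets
  the open facet to the dart of \<open>T\<close> it lies over; other values of \<open>dev m\<close> are irrelevant.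

  The vector of a segment is only determined up to the six lattice rotations.  Requiring
  \<open>a > 0\<close> besides \<open>b \<ge> 0\<close> selects exactly one of them (it writes the axis direction as \<open>(a, 0)\<close>
  and not as \<open>(0, a)\<close>).  Reversing a segment and rotating by \<open>\<pi>\<close> gives the same coordinates.
\<close>

locale straight_triangulation =
  fixes T :: "'a cmap" and M :: "'b cmap"
    and cox :: "'b \<Rightarrow> nat \<times> nat" and apex :: "'b \<Rightarrow> complex"
    and dev :: "'b \<Rightarrow> ldart \<Rightarrow> 'a"
  fixes tip :: "'b \<Rightarrow> complex" and facet :: "'b \<Rightarrow> complex set"
  defines "tip m \<equiv> coxeter_vec (cox m)"
    and "facet m \<equiv> interior (convex hull {0, tip m, apex m})"
  assumes plane: "plane_map M"
    and triangular: "\<And>f. f \<in> faces M \<Longrightarrow> card f = 3"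
    and cox_pos: "\<And>m. m \<in> darts M \<Longrightarrow> fst (cox m) > 0"
    and cox_opp: "\<And>m. m \<in> darts M \<Longrightarrow> cox (opp M m) = cox m"
    and apex_left: "\<And>m. m \<in> darts M \<Longrightarrow> Im (cnj (tip m) * apex m) > 0"
    \<comment> \<open>the facet is unfolded onto the lattice\<close>
    and dev_darts: "\<And>m x. m \<in> darts M \<Longrightarrow> x \<in> lattice_darts \<Longrightarrow> cell x \<inter> facet m \<noteq> {} \<Longrightarrow>
      dev m x \<in> darts T"
    and dev_face: "\<And>m x. m \<in> darts M \<Longrightarrow> x \<in> lattice_darts \<Longrightarrow> cell x \<inter> facet m \<noteq> {} \<Longrightarrow>
      dev m (lface_next x) = face_next T (dev m x)"
    and dev_opp: "\<And>m x. m \<in> darts M \<Longrightarrow> x \<in> lattice_darts \<Longrightarrow> side x \<inter> facet m \<noteq> {} \<Longrightarrow>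
      dev m (lopp x) = opp T (dev m x)"
    \<comment> \<open>the three darts of a facet see the same triangle, up to a motion \<open>(tip m, u)\<close> of the lattice\<close>
    and facet_turn: "\<And>m. m \<in> darts M \<Longrightarrow>
      \<exists>u. u ^ 6 = 1 \<and>
          place (tip m, u) (tip (face_next M m)) = apex m \<and>
          place (tip m, u) (apex (face_next M m)) = 0 \<and>
          (\<forall>x\<in>lattice_darts. cell x \<inter> facet (face_next M m) \<noteq> {} \<longrightarrow>
             dev m (move (tip m, u) x) = dev (face_next M m) x)"
    \<comment> \<open>the facets on both sides of an edge fit together: first the lattice triangles crossed by the
        edge, then the lattice edges lying along it\<close>
    and glue_cross: "\<And>m x. m \<in> darts M \<Longrightarrow> x \<in> lattice_darts \<Longrightarrow>
      cell x \<inter> open_segment 0 (tip m) \<noteq> {} \<Longrightarrow>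
      dev (opp M m) (move (tip m, - 1) x) = dev m x"
    and glue_along: "\<And>m x. m \<in> darts M \<Longrightarrow> x \<in> lattice_darts \<Longrightarrow>
      side x \<subseteq> open_segment 0 (tip m) \<Longrightarrow> cell x \<inter> facet m \<noteq> {} \<Longrightarrow>
      dev (opp M m) (move (tip m, - 1) (lopp x)) = opp T (dev m x)"
    \<comment> \<open>the closed facets cover the surface and the open facets do not overlap; a point of the surface
        is given by a dart \<open>d\<close> and a point \<open>w\<close> of the triangle to the left of \<open>d\<close>\<close>
    and covering: "\<And>d w. d \<in> darts T \<Longrightarrow> w \<in> unit_cell \<Longrightarrow>
      \<exists>m\<in>darts M. \<exists>x\<in>lattice_darts.
        dev m x = d \<and> place x w \<in> convex hull {0, tip m, apex m}"
    and no_overlap: "\<And>m m' x x' w. m \<in> darts M \<Longrightarrow> m' \<in> darts M \<Longrightarrow>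
      x \<in> lattice_darts \<Longrightarrow> x' \<in> lattice_darts \<Longrightarrow> w \<in> unit_cell \<Longrightarrow>
      place x w \<in> facet m \<Longrightarrow> place x' w \<in> facet m' \<Longrightarrow> dev m x = dev m' x' \<Longrightarrow>
      m' \<in> orbit (face_next M) m \<and> (m' = m \<longrightarrow> x' = x)"

text \<open>
  The vertices of a master polyhedron are the pentagons; \<open>dev m (0, 1)\<close> is a dart of the dual at the
  origin of \<open>m\<close>.  A fullerene may have several such polyhedra (already the diagonals of a flat
  quadrilateral can be chosen freely), so this is a relation; convexity in space plays no role.
\<close>

definition master_polyhedron :: "'a cmap \<Rightarrow> 'b cmap \<Rightarrow> ('b \<Rightarrow> nat \<times> nat) \<Rightarrow> bool" where
  "master_polyhedron F M cox \<longleftrightarrow>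
     (\<exists>apex dev. straight_triangulation (dual F) M cox apex dev \<and>
        (\<exists>g. bij_betw g (verts M) (pentagons F) \<and>
             (\<forall>m\<in>darts M. g (orbit (nxt M) m) = orbit (nxt (dual F)) (dev m (0, 1)))))"

text \<open>
  \<open>F\<close> arises from \<open>G\<close> by the transformation \<open>(k, l)\<close>, up to isomorphism: the dual of \<open>F\<close> is cut into
  equilateral patches spanned by \<open>k + l\<omega>\<close>, arranged like the triangles of the dual of \<open>G\<close>.
\<close>

definition goldberg_coxeter :: "nat \<Rightarrow> nat \<Rightarrow> 'b cmap \<Rightarrow> 'a cmap \<Rightarrow> bool" where
  "goldberg_coxeter k l G F \<longleftrightarrow>
     (\<exists>dev. straight_triangulation (dual F) (dual G)
        (\<lambda>_. (k, l)) (\<lambda>_. omega * coxeter_vec (k, l)) dev)"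

abbreviation inflation :: "nat \<Rightarrow> 'b cmap \<Rightarrow> 'a cmap \<Rightarrow> bool" where
  "inflation k \<equiv> goldberg_coxeter k 0"

text \<open>
  The transformation never lowers the number of darts, so nothing is lost by taking the darts of the
  original fullerene from the same type.
\<close>

definition goldberg_coxeter_fullerene :: "'a cmap \<Rightarrow> bool" where
  "goldberg_coxeter_fullerene F \<longleftrightarrow> fullerene F \<and>
     (\<exists>(G :: 'a cmap) k l. fullerene G \<and> k \<ge> 1 \<and> (k, l) \<noteq> (1, 0) \<and> goldberg_coxeter k l G F)"

end

theory Submission
  imports Defs
begin

text \<open>
  Write the origin of a lattice dart \<open>(p, u)\<close> in the frame of the dart, as \<open>p / u\<close>, and reduce it
  modulo \<open>k\<close> times the Eisenstein integers.  Since every vector of a master edge vanishes modulo \<open>k\<close>,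
  this residue does not depend on the facet in which a dart of the dual triangulation is unfolded,
  and it is \<open>0\<close> at the pentagons.  So the darts of residue \<open>0\<close> are those at a set of coarse vertices
  that contains every pentagon.  All other vertices have degree \<open>6\<close>, so walking \<open>k\<close> steps straight
  ahead leads from a coarse dart to another coarse vertex, and these walks bound equilateral
  triangles of side \<open>k\<close> that tile the surface.  The resulting triangulation has the same twelve vertices of
  degree \<open>5\<close>, which yields its Euler characteristic; its dual is the required fullerene.
\<close>

section \<open>Orbits of permutations\<close>

text \<open>Dividing by \<open>u\<close> makes the residue survive a change of unfolding: the motion
  \<open>(q, v)\<close> changes \<open>p / u\<close> by \<open>q / (v * u)\<close>, and every motion
  between the frames of one facet or of two neighbouring facets has as \<open>q\<close> the vector
  of a master edge, which lies in the ideal generated by \<open>k\<close>. The obstacle is that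
  facets cut lattice triangles. One triangle of the dual may be seen in several pieces, even from
  facets that share no edge, so the residues of the pieces have to be compared. This is done locally
  around each point of the open triangle, which contains no lattice point and hence no corner of a
  facet; connectedness then spreads the agreement. Edges of the dual need a separate limit argument,
  as the covering assumption concerns open triangles. After that the geometry is dropped until the
  end: the coarse triangulation is built from permutations of darts and two integer functions, where
  a nonzero residue certifies degree 6. The smaller map must also be shown to be free of loops and
  double edges, which is derived from its face lengths.\<close>

lemma card_orbit_funpow_dist1:
  assumes "x \<in> orbit f x"
  shows "card (orbit f x) = funpow_dist1 f x x"
  using card_image[OF inj_on_funpow_dist1[OF assms]] orbit_conv_funpow_dist1[OF assms] by simp

lemma funpow_card_orbit:
  assumes "x \<in> orbit f x"
  shows "(f ^^ card (orbit f x)) x = x"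
  using funpow_dist1_prop[OF assms] by (simp add: card_orbit_funpow_dist1[OF assms] del: funpow.simps)

lemma funpow_neq_self:
  assumes "x \<in> orbit f x" "0 < i" "i < card (orbit f x)"
  shows "(f ^^ i) x \<noteq> x"
  using assms funpow_dist1_least[of i f x x] by (simp add: card_orbit_funpow_dist1 del: funpow.simps)

lemma card_orbit_2:
  assumes "f (f x) = x" "f x \<noteq> x"
  shows "card (orbit f x) = 2"
proof -
  have "orbit f x = {(f ^^ m) x |m. m < 2}"
    by (rule orbit_altdef_bounded) (use assms in \<open>simp_all add: numeral_2_eq_2\<close>)
  also have "\<dots> = {x, f x}"
    by (auto simp: less_2_cases_iff intro: exI[where x = 0] exI[where x = 1])
  finally show ?thesis using assms(2) by auto
qed

lemma orbit_3:
  assumes "f (f (f x)) = x"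
  shows "orbit f x = {x, f x, f (f x)}"
proof -
  have "orbit f x = {(f ^^ m) x |m. m < 3}"
    by (rule orbit_altdef_bounded) (use assms in \<open>simp_all add: numeral_3_eq_3\<close>)
  also have "\<dots> = (\<lambda>m. (f ^^ m) x) ` {..<3}" by auto
  also have "{..<3::nat} = {0, 1, 2}" by auto
  finally show ?thesis by (simp add: numeral_2_eq_2)
qed

lemma card_orbit_3:
  assumes "f (f (f x)) = x" "f x \<noteq> x"
  shows "card (orbit f x) = 3"
proof -
  have "f (f x) \<noteq> x" "f (f x) \<noteq> f x" using assms by metis+
  then show ?thesis using assms by (simp add: orbit_3 eq_commute)
qed

lemma permutes_in_orbit:
  assumes "finite S" "f permutes S"
  shows "x \<in> orbit f x"
proof (rule permutation_self_in_orbit)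
  show "permutation f" using assms unfolding permutation_permutes by blast
qed

lemma orbit_eq_iff:
  assumes "finite S" "f permutes S"
  shows "orbit f x = orbit f y \<longleftrightarrow> x \<in> orbit f y"
proof
  show "x \<in> orbit f y" if "orbit f x = orbit f y"
    using permutes_in_orbit[OF assms, of x] that by simp
  show "orbit f x = orbit f y" if "x \<in> orbit f y"
    using cyclic_on_orbit[OF assms(2,1)] that by (rule orbit_cyclic_eq3)
qed

lemma sum_card_orbits:
  assumes "finite S" "f permutes S"
  shows "(\<Sum>P\<in>orbit f ` S. card P) = card S"
proof -
  have "card (\<Union> (orbit f ` S)) = (\<Sum>P\<in>orbit f ` S. card P)"
  proof (rule card_Union_disjoint)
    show "pairwise disjnt (orbit f ` S)"
    proof (clarsimp simp: pairwise_def disjnt_iff)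
      fix x y z assume "z \<in> orbit f x" "z \<in> orbit f y" "orbit f x \<noteq> orbit f y"
      then have "orbit f z = orbit f x" "orbit f z = orbit f y"
        by (simp_all only: orbit_eq_iff[OF assms])
      with \<open>orbit f x \<noteq> orbit f y\<close> show False by simp
    qed
  qed (auto intro: finite_orbit permutes_in_orbit[OF assms])
  moreover have "\<Union> (orbit f ` S) = S"
    using permutes_orbit_subset[OF assms(2)] permutes_in_orbit[OF assms] by auto
  ultimately show ?thesis by simp
qed

lemma card_orbits_uniform:
  assumes "finite S" "f permutes S" "\<And>x. x \<in> S \<Longrightarrow> card (orbit f x) = c"
  shows "c * card (orbit f ` S) = card S"
proof -
  have "(\<Sum>P\<in>orbit f ` S. card P) = (\<Sum>P\<in>orbit f ` S. c)"
    by (rule sum.cong) (use assms(3) in auto)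
  then show ?thesis using sum_card_orbits[OF assms(1,2)] by simp
qed

lemma orbit_conjugate:
  assumes "finite S" "f permutes S" "\<And>x. g (h x) = h (f x)"
  shows "h ` orbit f x = orbit g (h x)"
  by (rule orbit_inverse) (use permutes_in_orbit[OF assms(1,2)] assms(3) in auto)

lemma permutesI_closed_inj:
  assumes "finite S" "\<And>x. x \<in> S \<Longrightarrow> f x \<in> S" "inj_on f S" "\<And>x. x \<notin> S \<Longrightarrow> f x = x"
  shows "f permutes S"
proof -
  have "f ` S = S" using assms by (simp add: endo_inj_surj image_subset_iff)
  then have "bij_betw f S S" using assms(3) by (simp add: bij_betw_def)
  then show ?thesis using assms(4) by (rule bij_imp_permutes)
qed

text \<open>Meant for \<open>h\<close> the reversal of darts, which matches the faces of a dual map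
  with the vertices of the original one.\<close>

lemma orbit_flip_conj:
  assumes "finite S" "f permutes S" "h permutes S"
  shows "orbit (h \<circ> f \<circ> inv h) ` S = (\<lambda>P. h ` P) ` orbit f ` S"
proof -
  have "orbit (h \<circ> f \<circ> inv h) (h x) = h ` orbit f x" for x
    by (rule orbit_conjugate[symmetric, OF assms(1,2)]) (simp add: permutes_inverses[OF assms(3)])
  then have "orbit (h \<circ> f \<circ> inv h) ` h ` S = (\<lambda>P. h ` P) ` orbit f ` S"
    by (simp add: image_image)
  then show ?thesis by (simp add: permutes_image[OF assms(3)])
qed

section \<open>The coarse triangulation\<close>

text \<open>The intended reading: \<open>d\<close> unfolds to a lattice dart \<open>(p, u)\<close>
  with \<open>p / u\<close> congruent to \<open>\<alpha> d + \<beta> d * omega\<close> modulo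
  \<open>k\<close>. Rotation replaces \<open>u\<close> by \<open>omega * u\<close>, so it multiplies
  the residue by \<open>1 / omega = 1 - omega\<close>; reversal sends a residue \<open>r\<close> to
  \<open>- r - 1\<close>. The four equations are these two maps in coordinates.\<close>

locale coarse_triangulation =
  fixes D :: "'a set" and rot flip :: "'a \<Rightarrow> 'a" and k :: nat and \<alpha> \<beta> :: "'a \<Rightarrow> int"
  assumes finite_D: "finite D"
    and rot_permutes: "rot permutes D" and flip_permutes: "flip permutes D"
    and flip_neq: "\<And>d. d \<in> D \<Longrightarrow> flip d \<noteq> d"
    and flip_flip_D: "\<And>d. d \<in> D \<Longrightarrow> flip (flip d) = d"
    and triangle_D: "\<And>d. d \<in> D \<Longrightarrow> (inv rot \<circ> flip \<circ> inv rot \<circ> flip \<circ> inv rot \<circ> flip) d = d"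
    and triangle_neq: "\<And>d. d \<in> D \<Longrightarrow> inv rot (flip d) \<noteq> d"
    and k_pos: "k > 0"
    and \<alpha>_bounds: "\<And>d. d \<in> D \<Longrightarrow> \<alpha> d \<in> {0..<int k}"
    and \<beta>_bounds: "\<And>d. d \<in> D \<Longrightarrow> \<beta> d \<in> {0..<int k}"
    and \<alpha>_rot: "\<And>d. d \<in> D \<Longrightarrow> \<alpha> (rot d) = (\<alpha> d + \<beta> d) mod int k"
    and \<beta>_rot: "\<And>d. d \<in> D \<Longrightarrow> \<beta> (rot d) = - \<alpha> d mod int k"
    and \<alpha>_flip: "\<And>d. d \<in> D \<Longrightarrow> \<alpha> (flip d) = (- \<alpha> d - 1) mod int k"
    and \<beta>_flip: "\<And>d. d \<in> D \<Longrightarrow> \<beta> (flip d) = - \<beta> d mod int k"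
    and flat: "\<And>d. d \<in> D \<Longrightarrow> \<alpha> d \<noteq> 0 \<or> \<beta> d \<noteq> 0 \<Longrightarrow> card (orbit rot d) = 6"
begin

definition coarse :: "'a set" where
  "coarse = {d \<in> D. \<alpha> d = 0 \<and> \<beta> d = 0}"

abbreviation rot' :: "'a \<Rightarrow> 'a" where "rot' \<equiv> inv rot"

definition turn :: "'a \<Rightarrow> 'a" where "turn d = rot' (flip d)"

text \<open>At a vertex of degree 6, three rotations of the incoming dart reversed lead straight on,
  so \<open>ahead\<close> is the translation of a dart by its own vector.\<close>

definition ahead :: "'a \<Rightarrow> 'a" where "ahead d = rot (rot (rot (flip d)))"

text \<open>The translation of a dart by \<open>omega\<close> times its vector, through the third
  corner of the triangle on its left.\<close>

definition up :: "'a \<Rightarrow> 'a" where "up d = rot (rot (flip (rot d)))"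

text \<open>If \<open>m\<close> unfolds to \<open>(0, 1)\<close>, this is the dart over
  \<open>(a + b * omega, 1)\<close>, as long as the region in between is flat.\<close>

definition grid :: "'a \<Rightarrow> nat \<Rightarrow> nat \<Rightarrow> 'a" where
  "grid m a b = (ahead ^^ a) ((up ^^ b) m)"

text \<open>Only \<open>k - 1\<close> steps: they lead to the last small dart of the coarse edge,
  whose reverse starts at the far end.\<close>

definition cflip :: "'a \<Rightarrow> 'a" where
  "cflip d = flip ((ahead ^^ (k - 1)) d)"

definition cturn :: "'a \<Rightarrow> 'a" where
  "cturn d = rot' (cflip d)"

section \<open>Identities for rotation, reversal and translation\<close>

lemma rot_D [simp]: "rot d \<in> D \<longleftrightarrow> d \<in> D" and flip_D [simp]: "flip d \<in> D \<longleftrightarrow> d \<in> D"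
  and rot'_D [simp]: "rot' d \<in> D \<longleftrightarrow> d \<in> D"
  using rot_permutes flip_permutes permutes_inv[OF rot_permutes]
  by (simp_all add: permutes_in_image)

lemma rot_rot' [simp]: "rot (rot' d) = d" and rot'_rot [simp]: "rot' (rot d) = d"
  using permutes_inverses[OF rot_permutes] by simp_all

lemma flip_flip [simp]: "flip (flip d) = d"
  using flip_flip_D permutes_not_in[OF flip_permutes] by (cases "d \<in> D") simp_all

lemma triangle: "rot' (flip (rot' (flip (rot' (flip d))))) = d"
proof (cases "d \<in> D")
  case False
  then show ?thesis
    using permutes_not_in[OF flip_permutes] permutes_not_in[OF permutes_inv[OF rot_permutes]] by simp
qed (use triangle_D in simp)

text \<open>The order three of \<open>turn\<close>, solved so that a rotation enclosed by two flips
  is traded for a word with a single flip.\<close>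

lemma flip_rot'_flip: "flip (rot' (flip d)) = rot (flip (rot d))"
proof -
  have "rot' (flip (rot' (flip (rot' (flip (flip (rot d))))))) = flip (rot d)"
    by (rule triangle)
  then have "rot' (flip (rot' (flip d))) = flip (rot d)" by simp
  then show ?thesis by (metis rot_rot')
qed

lemma flip_rot_flip: "flip (rot (flip d)) = rot' (flip (rot' d))"
  by (metis flip_rot'_flip flip_flip rot'_rot rot_rot')

lemma inj_rot: "inj rot" and inj_flip: "inj flip" and inj_rot': "inj rot'"
  using rot_permutes flip_permutes permutes_inv[OF rot_permutes] permutes_inj by blast+

lemma rot_eq [simp]: "rot x = rot y \<longleftrightarrow> x = y" and flip_eq [simp]: "flip x = flip y \<longleftrightarrow> x = y"
  and rot'_eq [simp]: "rot' x = rot' y \<longleftrightarrow> x = y"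
  using inj_rot inj_flip inj_rot' by (simp_all add: inj_eq)

lemma turn_D [simp]: "turn d \<in> D \<longleftrightarrow> d \<in> D" and ahead_D [simp]: "ahead d \<in> D \<longleftrightarrow> d \<in> D"
  and up_D [simp]: "up d \<in> D \<longleftrightarrow> d \<in> D"
  by (simp_all add: turn_def ahead_def up_def)

lemma turn_eq [simp]: "turn x = turn y \<longleftrightarrow> x = y" and ahead_eq [simp]: "ahead x = ahead y \<longleftrightarrow> x = y"
  and up_eq [simp]: "up x = up y \<longleftrightarrow> x = y"
  by (simp_all add: turn_def ahead_def up_def)

lemma turn_turn: "turn (turn d) = flip (rot d)" and turn_turn_turn: "turn (turn (turn d)) = d"
proof -
  show "turn (turn (turn d)) = d" unfolding turn_def by (rule triangle)
  show "turn (turn d) = flip (rot d)" unfolding turn_def by (simp add: flip_rot'_flip)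
qed

lemma ahead_funpow_D [simp]: "(ahead ^^ i) d \<in> D \<longleftrightarrow> d \<in> D"
  by (induction i) simp_all

lemma up_funpow_D [simp]: "(up ^^ i) d \<in> D \<longleftrightarrow> d \<in> D"
  by (induction i) simp_all

lemma grid_D [simp]: "grid m a b \<in> D \<longleftrightarrow> m \<in> D"
  by (simp add: grid_def)

lemma grid_0 [simp]: "grid m 0 0 = m"
  by (simp add: grid_def)

lemma grid_Suc: "grid m (Suc a) b = ahead (grid m a b)"
  by (simp add: grid_def)

lemma grid_0_Suc: "grid m 0 (Suc b) = up (grid m 0 b)"
  by (simp add: grid_def)

lemma grid_eq [simp]: "grid m a b = grid m' a b \<longleftrightarrow> m = m'"
proof -
  have "inj (ahead ^^ a)" "inj (up ^^ b)"
    by (rule inj_fn, simp add: inj_def)+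
  then show ?thesis unfolding grid_def by (simp add: inj_eq)
qed

section \<open>Residues of the translated darts\<close>

lemma coarse_D: "d \<in> coarse \<Longrightarrow> d \<in> D"
  by (simp add: coarse_def)

lemma \<alpha>_mod: "d \<in> D \<Longrightarrow> \<alpha> d mod int k = \<alpha> d" and \<beta>_mod: "d \<in> D \<Longrightarrow> \<beta> d mod int k = \<beta> d"
  using \<alpha>_bounds \<beta>_bounds by simp_all

lemma \<alpha>_rot': "d \<in> D \<Longrightarrow> \<alpha> (rot' d) = - \<beta> d mod int k"
  using \<beta>_rot[of "rot' d"] \<alpha>_mod[of "rot' d"] by (simp add: mod_simps)

lemma \<beta>_rot': "d \<in> D \<Longrightarrow> \<beta> (rot' d) = (\<alpha> d + \<beta> d) mod int k"
  using \<alpha>_rot[of "rot' d"] \<alpha>_rot'[of d] \<beta>_mod[of "rot' d"] by (simp add: mod_simps)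

lemmas residue_simps = \<alpha>_rot \<beta>_rot \<alpha>_flip \<beta>_flip \<alpha>_rot' \<beta>_rot'

lemma residue_ahead:
  assumes "d \<in> D"
  shows "\<alpha> (ahead d) = (\<alpha> d + 1) mod int k" "\<beta> (ahead d) = \<beta> d"
  using assms \<beta>_mod[OF assms] by (simp_all add: ahead_def residue_simps mod_simps)

lemma residue_up:
  assumes "d \<in> D"
  shows "\<alpha> (up d) = \<alpha> d" "\<beta> (up d) = (\<beta> d + 1) mod int k"
proof -
  have "(- ((\<alpha> d + \<beta> d) mod int k) - 1) mod int k = (- (\<alpha> d + \<beta> d) - 1) mod int k"
    by (metis mod_diff_left_eq mod_minus_eq)
  then have "\<alpha> (flip (rot d)) = (- \<alpha> d - \<beta> d - 1) mod int k" "\<beta> (flip (rot d)) = \<alpha> d"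
    using assms \<alpha>_mod[OF assms] by (simp_all add: residue_simps mod_simps)
  then have "\<alpha> (rot (flip (rot d))) = (- \<beta> d - 1) mod int k"
    "\<beta> (rot (flip (rot d))) = (\<alpha> d + \<beta> d + 1) mod int k"
    using assms by (simp_all add: \<alpha>_rot \<beta>_rot mod_simps) (simp_all add: algebra_simps)
  then show "\<alpha> (up d) = \<alpha> d" "\<beta> (up d) = (\<beta> d + 1) mod int k"
    using assms \<alpha>_mod[OF assms] by (simp_all add: up_def \<alpha>_rot \<beta>_rot mod_simps) (simp_all add: algebra_simps)
qed

lemma residue_up_funpow:
  assumes "d \<in> D"
  shows "\<alpha> ((up ^^ b) d) = \<alpha> d \<and> \<beta> ((up ^^ b) d) = (\<beta> d + int b) mod int k"
  by (induction b) (use assms \<beta>_mod[OF assms] in \<open>simp_all add: residue_up mod_simps algebra_simps\<close>)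

text \<open>The rules for \<open>rot\<close> and \<open>flip\<close> hold at every vertex, flat or
  not. So the residues of the grid are known first, and the flatness of the vertices it passes is
  deduced from them.\<close>

lemma residue_grid:
  assumes "d \<in> D"
  shows "\<alpha> (grid d a b) = (\<alpha> d + int a) mod int k" "\<beta> (grid d a b) = (\<beta> d + int b) mod int k"
proof -
  have "\<alpha> (grid d a b) = (\<alpha> d + int a) mod int k \<and> \<beta> (grid d a b) = (\<beta> d + int b) mod int k"
  proof (induction a)
    case 0
    then show ?case using residue_up_funpow[OF assms] \<alpha>_mod[OF assms] by (simp add: grid_def)
  next
    case (Suc a)
    then show ?case using assms by (simp add: grid_Suc residue_ahead mod_simps algebra_simps)
  qed
  then show "\<alpha> (grid d a b) = (\<alpha> d + int a) mod int k" "\<beta> (grid d a b) = (\<beta> d + int b) mod int k"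
    by simp_all
qed

lemma residue_grid_coarse:
  assumes "m \<in> coarse" "a < k" "b < k"
  shows "\<alpha> (grid m a b) = int a" "\<beta> (grid m a b) = int b"
  using residue_grid[of m a b] assms by (simp_all add: coarse_def)

lemma rot_6:
  assumes "d \<in> D" "\<alpha> d \<noteq> 0 \<or> \<beta> d \<noteq> 0"
  shows "rot (rot (rot (rot (rot (rot d))))) = d"
  using funpow_card_orbit[OF permutes_in_orbit[OF finite_D rot_permutes], of d] flat[OF assms]
  by (simp add: numeral_eq_Suc)

lemma rot_period_neq:
  assumes "d \<in> D" "\<alpha> d \<noteq> 0 \<or> \<beta> d \<noteq> 0"
  shows "rot (rot d) \<noteq> d" "rot (rot (rot d)) \<noteq> d"
  using funpow_neq_self[OF permutes_in_orbit[OF finite_D rot_permutes], of 2 d]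
    funpow_neq_self[OF permutes_in_orbit[OF finite_D rot_permutes], of 3 d] flat[OF assms]
  by (simp_all add: numeral_2_eq_2 numeral_3_eq_3)

text \<open>The dart \<open>ahead d\<close> starts at the vertex where \<open>d\<close> ends.\<close>

definition flat_end :: "'a \<Rightarrow> bool" where
  "flat_end d \<longleftrightarrow> d \<in> D \<and> (\<alpha> (ahead d) \<noteq> 0 \<or> \<beta> (ahead d) \<noteq> 0)"

lemma flat_end_rot:
  assumes "flat_end d"
  shows "rot (rot (rot (rot (rot (rot (flip d)))))) = flip d"
    "rot (rot (flip d)) \<noteq> flip d" "rot (rot (rot (flip d))) \<noteq> flip d"
proof -
  have "\<alpha> (flip d) \<noteq> 0 \<or> \<beta> (flip d) \<noteq> 0"
  proof (rule ccontr)
    assume "\<not> ?thesis"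
    then have "\<alpha> (ahead d) = 0" "\<beta> (ahead d) = 0"
      using assms by (simp_all add: ahead_def flat_end_def \<alpha>_rot \<beta>_rot)
    then show False using assms by (simp add: flat_end_def)
  qed
  moreover have "flip d \<in> D" using assms by (simp add: flat_end_def)
  ultimately show "rot (rot (rot (rot (rot (rot (flip d)))))) = flip d"
    "rot (rot (flip d)) \<noteq> flip d" "rot (rot (rot (flip d))) \<noteq> flip d"
    using rot_6 rot_period_neq by blast+
qed

lemma flat_end_rot':
  assumes "flat_end d"
  shows "rot (rot (rot (rot (flip d)))) = rot' (rot' (flip d))"
    "rot (rot (rot (rot (rot (flip d))))) = rot' (flip d)"
  using flat_end_rot(1)[OF assms] by (metis rot'_rot)+

section \<open>Walking straight over flat vertices\<close>

lemma up_alt: "up d = rot (flip (rot' (flip d)))"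
  by (simp add: up_def flip_rot'_flip)

text \<open>The small parallelogram closes up because at the end vertex of \<open>d\<close> four
  rotations forward equal two backward.\<close>

lemma up_ahead:
  assumes "flat_end d"
  shows "up (ahead d) = ahead (up d)"
proof -
  have "up (ahead d) = rot (rot (flip (rot' (rot' (flip d)))))"
    unfolding up_def ahead_def by (simp add: flat_end_rot'[OF assms])
  moreover have "ahead (up d) = rot (rot (rot (flip (rot (flip (rot' (flip d)))))))"
    by (simp add: ahead_def up_alt)
  ultimately show ?thesis by (simp add: flip_rot_flip)
qed

text \<open>Along a row \<open>\<alpha>\<close> counts the columns, so it lies strictly between
  \<open>0\<close> and \<open>k\<close> at the end of every dart but the last. Only the last dart
  can end at a pentagon.\<close>

lemma flat_end_grid:
  assumes "m \<in> coarse" "Suc a < k"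
  shows "flat_end (grid m a b)"
proof -
  have "\<alpha> (ahead (grid m a b)) = int (Suc a)"
    using residue_grid(1)[of m "Suc a" b] assms by (simp add: coarse_def grid_Suc)
  then show ?thesis using assms(1) by (simp add: flat_end_def coarse_def)
qed

lemma grid_Suc_right:
  assumes "m \<in> coarse" "a < k"
  shows "grid m a (Suc b) = up (grid m a b)"
  using assms(2)
proof (induction a)
  case (Suc a)
  then have "grid m (Suc a) (Suc b) = ahead (up (grid m a b))"
    by (simp add: grid_Suc)
  also have "\<dots> = up (ahead (grid m a b))"
    using up_ahead[OF flat_end_grid[OF assms(1)]] Suc.prems by simp
  finally show ?case by (simp add: grid_Suc)
qed (simp add: grid_0_Suc)

lemma ahead_flip_ahead:
  assumes "flat_end z"
  shows "ahead (flip (ahead z)) = flip z"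
  unfolding ahead_def using flat_end_rot(1)[OF assms] by simp

text \<open>Going straight is reversible at a flat vertex, so a coarse edge can be read from its far
  end. The case \<open>i = 0\<close> makes \<open>cflip\<close> an involution; the middle of the
  edge excludes a fixed point.\<close>

lemma grid_cflip:
  assumes "d \<in> coarse" "i + j = k - 1"
  shows "grid (cflip d) j 0 = flip (grid d i 0)"
  using assms(2)
proof (induction j arbitrary: i)
  case 0
  then show ?case by (simp add: cflip_def grid_def)
next
  case (Suc j)
  have "grid (cflip d) (Suc j) 0 = ahead (grid (cflip d) j 0)"
    by (rule grid_Suc)
  also have "grid (cflip d) j 0 = flip (grid d (Suc i) 0)"
    by (rule Suc.IH) (use Suc.prems in simp)
  also have "ahead (flip (grid d (Suc i) 0)) = flip (grid d i 0)"
    unfolding grid_Suc by (rule ahead_flip_ahead[OF flat_end_grid[OF assms(1)]]) (use Suc.prems in simp)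
  finally show ?case .
qed

lemma cflip_coarse: assumes "d \<in> coarse" shows "cflip d \<in> coarse"
proof -
  have "cflip d = flip (grid d (k - 1) 0)" by (simp add: cflip_def grid_def)
  moreover have "grid d (k - 1) 0 \<in> D" using assms by (simp add: coarse_def)
  ultimately show ?thesis
    using residue_grid_coarse[OF assms, of "k - 1" 0] assms k_pos
    by (simp add: coarse_def residue_simps of_nat_diff)
qed

lemma cflip_cflip: "d \<in> coarse \<Longrightarrow> cflip (cflip d) = d"
  using grid_cflip[of d 0 "k - 1"] by (simp add: cflip_def[of "cflip d"] grid_def)

lemma ahead_neq_flip:
  assumes "flat_end z" shows "flip (ahead z) \<noteq> z"
proof
  assume "flip (ahead z) = z"
  then have "rot (rot (rot (flip z))) = flip z" unfolding ahead_def by (metis flip_flip)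
  then show False using flat_end_rot(3)[OF assms] by simp
qed

text \<open>An edge of the coarse triangulation that is equal to its own reverse would be reversed
  about its midpoint.\<close>

lemma cflip_neq:
  assumes "d \<in> coarse" shows "cflip d \<noteq> d"
proof
  assume *: "cflip d = d"
  show False
  proof (cases "even k")
    case False
    then obtain j where "k = 2 * j + 1" by (elim oddE)
    then have "grid d j 0 = flip (grid d j 0)" using grid_cflip[OF assms, of j j] * by simp
    then show False using flip_neq[of "grid d j 0"] assms by (simp add: coarse_def)
  next
    case True
    then obtain j where j: "k = 2 * j" by (elim evenE)
    with k_pos obtain i where i: "j = Suc i" by (cases j) auto
    \<comment> \<open>For even \<open>k\<close> the midpoint is a vertex, and the half-turn about it
      would fix a dart after three rotations.\<close>
    have "grid d i 0 = flip (grid d (Suc i) 0)" using grid_cflip[OF assms, of j i] * i j by simp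
    moreover have "flat_end (grid d i 0)" by (rule flat_end_grid[OF assms]) (use i j in simp)
    ultimately show False using ahead_neq_flip by (metis grid_Suc)
  qed
qed

section \<open>The three corners of a coarse triangle\<close>

lemma cturn_eq: "cturn d = turn (grid d (k - 1) 0)"
  by (simp add: cturn_def cflip_def turn_def grid_def)

lemma coarse_rot [simp]: "rot d \<in> coarse \<longleftrightarrow> d \<in> coarse"
proof -
  have "\<alpha> d = 0" "\<beta> d = 0" if "d \<in> D" "\<alpha> (rot d) = 0" "\<beta> (rot d) = 0"
  proof -
    have "\<alpha> d = - \<beta> (rot d) mod int k" "\<beta> d = (\<alpha> (rot d) + \<beta> (rot d)) mod int k"
      using \<alpha>_rot'[of "rot d"] \<beta>_rot'[of "rot d"] that(1) by simp_all
    with that show "\<alpha> d = 0" "\<beta> d = 0" by simp_all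
  qed
  moreover have "rot d \<in> coarse" if "d \<in> coarse"
    using that by (simp add: coarse_def residue_simps)
  ultimately show ?thesis unfolding coarse_def by simp blast
qed

lemma coarse_rot' [simp]: "rot' d \<in> coarse \<longleftrightarrow> d \<in> coarse"
  using coarse_rot[of "rot' d"] by simp

lemma cturn_coarse: "d \<in> coarse \<Longrightarrow> cturn d \<in> coarse"
  by (simp add: cturn_def cflip_coarse)

lemma up_turn_ahead:
  assumes "flat_end z" shows "up (turn (ahead z)) = turn z"
  unfolding up_def turn_def ahead_def using flat_end_rot'(2)[OF assms] by simp

text \<open>The inner step for the grid of a turned triangle. It goes around the end of
  \<open>z\<close> and then around the end of \<open>up z\<close>, so both must be flat.\<close>

lemma ahead_turn_ahead:
  assumes "flat_end z" "flat_end (up z)"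
  shows "ahead (turn (ahead z)) = turn (up z)"
proof -
  have *: "flip (up z) = rot' (flip (rot' (rot' (flip z))))"
    by (simp add: up_alt flip_rot_flip)
  have "ahead (turn (ahead z)) = rot (rot (rot (flip (rot' (flip (rot (rot (rot (flip z)))))))))"
    by (simp add: ahead_def turn_def)
  also have "\<dots> = rot (rot (rot (rot (flip (rot (rot (rot (rot (flip z)))))))))"
    by (simp add: flip_rot'_flip)
  also have "\<dots> = rot (rot (rot (rot (flip (rot' (rot' (flip z)))))))"
    by (simp add: flat_end_rot'[OF assms(1)])
  also have "\<dots> = rot (rot (rot (rot (rot (flip (up z))))))"
    by (simp add: *)
  also have "\<dots> = turn (up z)"
    by (simp add: flat_end_rot'[OF assms(2)] turn_def)
  finally show ?thesis .
qed

text \<open>The triple \<open>(c, a, b)\<close> acts as barycentric coordinates of a small upward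
  triangle, and changing the base corner of the coarse triangle permutes it cyclically. Three
  applications at the corners give the order three of \<open>cturn\<close>.\<close>

lemma grid_cturn:
  assumes "d \<in> coarse" "a + b + c = k - 1"
  shows "grid (cturn d) a b = turn (grid d c a)"
  using assms(2)
proof (induction a arbitrary: c)
  case 0
  then show ?case
  proof (induction b arbitrary: c)
    case 0
    then show ?case by (simp add: cturn_eq)
  next
    case (Suc b)
    then have "grid (cturn d) 0 (Suc b) = up (turn (grid d (Suc c) 0))"
      by (simp add: grid_0_Suc)
    also have "\<dots> = turn (grid d c 0)"
      unfolding grid_Suc by (rule up_turn_ahead[OF flat_end_grid[OF assms(1)]]) (use Suc.prems in simp)
    finally show ?case .
  qed
next
  case (Suc a)
  have c: "Suc c < k" using Suc.prems by simp
  have up: "up (grid d c a) = grid d c (Suc a)"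
    using grid_Suc_right[OF assms(1)] c by simp
  have "grid (cturn d) (Suc a) b = ahead (grid (cturn d) a b)"
    by (rule grid_Suc)
  also have "grid (cturn d) a b = turn (grid d (Suc c) a)"
    by (rule Suc.IH) (use Suc.prems in simp)
  also have "ahead (turn (grid d (Suc c) a)) = turn (up (grid d c a))"
    unfolding grid_Suc
    by (rule ahead_turn_ahead) (use flat_end_grid[OF assms(1) c] up in simp_all)
  finally show ?case by (simp add: up)
qed

lemma cturn_cturn_cturn:
  assumes "d \<in> coarse" shows "cturn (cturn (cturn d)) = d"
proof -
  let ?e = "cturn d" let ?f = "cturn ?e"
  have "?e \<in> coarse" "?f \<in> coarse" using assms cturn_coarse by simp_all
  then have "cturn ?f = turn (grid ?f (k - 1) 0)"
    using grid_cturn[of ?f 0 0 "k - 1"] by simp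
  also have "grid ?f (k - 1) 0 = turn (grid ?e 0 (k - 1))"
    using grid_cturn[of ?e "k - 1" 0 0] \<open>?e \<in> coarse\<close> by simp
  also have "grid ?e 0 (k - 1) = turn d"
    using grid_cturn[of d 0 "k - 1" 0] assms by simp
  finally show ?thesis by (simp add: turn_turn_turn)
qed

text \<open>A coarse triangle that is equal to a rotated copy of itself would be rotated about its
  centre, which is the centre of a triangle or a vertex.\<close>

lemma cturn_neq:
  assumes "d \<in> coarse" shows "cturn d \<noteq> d"
proof
  assume *: "cturn d = d"
  \<comment> \<open>The centre has both lattice coordinates equal to \<open>k / 3\<close>. It is the
    centre of an upward triangle, the centre of a downward triangle, or a vertex, in this order of
    cases.\<close>
  consider t where "k = 3 * t + 1" | t where "k = 3 * t + 2" | t where "k = 3 * t + 3"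
  proof -
    define q r where "q = (k - 1) div 3" and "r = (k - 1) mod 3"
    have k: "k = 3 * q + r + 1" using k_pos by (simp add: q_def r_def)
    have "r < 3" by (simp add: r_def)
    then consider "r = 0" | "r = 1" | "r = 2" by linarith
    then show ?thesis
      using that[of q] k by cases simp_all
  qed
  then show False
  proof cases
    case 1
    then have "grid d t t = turn (grid d t t)" using grid_cturn[OF assms, of t t t] * by simp
    then show False using triangle_neq[of "grid d t t"] assms by (simp add: coarse_def turn_def)
  next
    case 2
    then have "grid d t (Suc t) = turn (grid d t t)"
      using grid_cturn[OF assms, of t "Suc t" t] * by simp
    moreover have "grid d t (Suc t) = up (grid d t t)"
      by (rule grid_Suc_right[OF assms]) (use 2 in simp)
    ultimately have "rot (flip (rot' (flip (grid d t t)))) = rot' (flip (grid d t t))"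
      by (simp add: up_alt turn_def)
    then have triangle_fixed: "rot w = flip w" if "w = flip (rot' (flip (grid d t t)))" for w
      using that by simp
    define w where "w = flip (rot' (flip (grid d t t)))"
    have "rot' (flip w) = w" using triangle_fixed[OF w_def] by (metis rot'_rot)
    moreover have "w \<in> D" using assms by (simp add: w_def coarse_def)
    ultimately show False using triangle_neq by blast
  next
    case 3
    have "grid d t (Suc t) = turn (grid d (Suc t) t)"
      using grid_cturn[OF assms, of t "Suc t" "Suc t"] 3 * by simp
    moreover have up: "grid d t (Suc t) = up (grid d t t)"
      by (rule grid_Suc_right[OF assms]) (use 3 in simp)
    ultimately have eq: "turn (ahead (grid d t t)) = up (grid d t t)"
      by (simp add: grid_Suc)
    have "flat_end (grid d t t)" and fl: "flat_end (grid d t (Suc t))"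
      by (rule flat_end_grid[OF assms], use 3 in simp)+
    then have "ahead (up (grid d t t)) = turn (up (grid d t t))"
      using ahead_turn_ahead[of "grid d t t"] up eq by simp
    then have "rot (ahead (up (grid d t t))) = flip (up (grid d t t))"
      by (simp add: turn_def)
    then have "rot (rot (rot (rot (rot (rot (flip (up (grid d t t)))))))) = rot (rot (flip (up (grid d t t))))"
      by (simp add: ahead_def)
    then show False using flat_end_rot[OF fl] up by simp
  qed
qed

end

section \<open>Plane maps and cubic maps with faces of length five and six\<close>

lemma face_next_comp: "face_next X = inv (nxt X) \<circ> opp X"
  by (simp add: face_next_def fun_eq_iff)

lemma
  assumes "plane_map X"
  shows plane_map_finite: "finite (darts X)" and plane_map_nxt: "nxt X permutes darts X"
    and plane_map_opp: "opp X permutes darts X"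
    and plane_map_opp_opp: "opp X (opp X d) = d" and plane_map_opp_neq: "d \<in> darts X \<Longrightarrow> opp X d \<noteq> d"
    and plane_map_inv_opp: "inv (opp X) = opp X"
    and plane_map_face_next: "face_next X permutes darts X"
    and plane_map_inv_face_next: "inv (face_next X) d = opp X (nxt X d)"
proof -
  show *: "finite (darts X)" "nxt X permutes darts X" "opp X permutes darts X"
    "d \<in> darts X \<Longrightarrow> opp X d \<noteq> d"
    using assms by (auto simp: plane_map_def)
  show oo: "opp X (opp X d) = d" for d
    using assms permutes_not_in[OF *(3)] by (cases "d \<in> darts X") (auto simp: plane_map_def)
  show io: "inv (opp X) = opp X"
    by (rule inv_unique_comp) (use oo in auto)
  show "face_next X permutes darts X"
    unfolding face_next_comp by (rule permutes_compose[OF *(3) permutes_inv[OF *(2)]])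
  have "inv (face_next X) = opp X \<circ> nxt X"
    by (rule inv_unique_comp)
      (use oo permutes_inverses[OF *(2)] in \<open>auto simp: face_next_comp\<close>)
  then show "inv (face_next X) d = opp X (nxt X d)" by simp
qed

lemma card_edges:
  assumes "plane_map X"
  shows "2 * card (edges X) = card (darts X)"
  unfolding edges_def
  using plane_map_finite[OF assms] plane_map_opp[OF assms]
  by (rule card_orbits_uniform)
    (use plane_map_opp_opp[OF assms] plane_map_opp_neq[OF assms] in \<open>auto intro: card_orbit_2\<close>)

lemma plane_map_induct:
  assumes "plane_map X" "Y \<subseteq> darts X" "Y \<noteq> {}"
    and "\<And>d. d \<in> Y \<Longrightarrow> nxt X d \<in> Y" "\<And>d. d \<in> Y \<Longrightarrow> opp X d \<in> Y"
  shows "Y = darts X"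
proof
  obtain d where d: "d \<in> Y" using assms(3) by blast
  show "darts X \<subseteq> Y"
  proof
    fix e assume "e \<in> darts X"
    then have "(d, e) \<in> ({(x, nxt X x) |x. True} \<union> {(x, opp X x) |x. True})\<^sup>*"
      using assms(1,2) d unfolding plane_map_def by blast
    then show "e \<in> Y"
      by (induction) (use d assms(4,5) in auto)
  qed
qed (rule assms(2))

lemma dual_simps [simp]: "darts (dual X) = darts X" "nxt (dual X) = face_next X" "opp (dual X) = opp X"
  by (simp_all add: dual_def)

lemma face_next_dual: "plane_map X \<Longrightarrow> face_next (dual X) d = opp X (nxt X (opp X d))"
  by (simp add: face_next_def[of "dual X"] plane_map_inv_face_next)

lemma plane_map_dual:
  assumes "plane_map X"
  shows "plane_map (dual X)"
proof -
  note X = plane_map_finite[OF assms] plane_map_nxt[OF assms] plane_map_opp[OF assms]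
    plane_map_opp_opp[OF assms] plane_map_face_next[OF assms]
  have "verts (dual X) = faces X" by (simp add: verts_def faces_def)
  moreover have "edges (dual X) = edges X" by (simp add: edges_def)
  moreover have "card (faces (dual X)) = card (verts X)"
  proof -
    have "face_next (dual X) = opp X \<circ> nxt X \<circ> inv (opp X)"
      by (simp add: fun_eq_iff face_next_dual[OF assms] plane_map_inv_opp[OF assms])
    then have "faces (dual X) = (\<lambda>P. opp X ` P) ` verts X"
      using orbit_flip_conj[OF X(1-3)] by (simp add: faces_def verts_def)
    moreover have "inj (\<lambda>P. opp X ` P)"
      using permutes_inj[OF X(3)] by (auto intro: injI simp: inj_image_eq_iff)
    ultimately show ?thesis by (simp add: card_image inj_on_subset)
  qed
  moreover have "(d, e) \<in> ({(x, face_next X x) |x. True} \<union> {(x, opp X x) |x. True})\<^sup>*" (is "_ \<in> ?R\<^sup>*")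
    if "d \<in> darts X" "e \<in> darts X" for d e
  proof -
    have step: "(x, opp X x) \<in> ?R\<^sup>*" for x by auto
    let ?Y = "{e \<in> darts X. (d, e) \<in> ?R\<^sup>*}"
    have fn: "face_next X x \<in> ?Y" if "x \<in> ?Y" for x
      using that permutes_in_image[OF X(5)] by (auto intro: rtrancl_into_rtrancl)
    have op: "opp X x \<in> ?Y" if "x \<in> ?Y" for x
      using that permutes_in_image[OF X(3)] by (auto intro: rtrancl_into_rtrancl)
    \<comment> \<open>An injection of a finite set into itself is onto. So closure under
      \<open>face_next\<close> gives closure under its inverse, and \<open>nxt\<close> is that
      inverse followed by \<open>opp\<close>.\<close>
    have "face_next X ` ?Y = ?Y"
    proof (rule endo_inj_surj)
      show "face_next X ` ?Y \<subseteq> ?Y" using fn by (rule image_subsetI)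
      show "inj_on (face_next X) ?Y" by (rule permutes_inj_on[OF X(5)])
    qed (use X(1) in simp)
    have "nxt X x \<in> ?Y" if "x \<in> ?Y" for x
    proof -
      have "x \<in> face_next X ` ?Y" using that by (simp only: \<open>face_next X ` ?Y = ?Y\<close>)
      then obtain y where "x = face_next X y" "y \<in> ?Y" by (rule imageE)
      then have "nxt X x = opp X y"
        using permutes_inverses[OF X(2)] by (simp add: face_next_def)
      then show ?thesis using op[OF \<open>y \<in> ?Y\<close>] by simp
    qed
    moreover have "d \<in> ?Y" using that by simp
    ultimately have "?Y = darts X"
      using op by (intro plane_map_induct[OF assms]) blast+
    with that(2) show ?thesis by blast
  qed
  ultimately show ?thesis
    using assms X(5) unfolding plane_map_def by simp
qed

text \<open>The length of an orbit plus one for a pentagon is always six; summing over all orbits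
  counts the darts once.\<close>

lemma card_orbits_5_6:
  assumes "finite S" "f permutes S" "\<And>x. x \<in> S \<Longrightarrow> card (orbit f x) = 5 \<or> card (orbit f x) = 6"
  shows "6 * card (orbit f ` S) = card S + card {P \<in> orbit f ` S. card P = 5}"
proof -
  have "card P + (if card P = 5 then 1 else 0) = 6" if "P \<in> orbit f ` S" for P
    using assms(3) that by auto
  then have "(\<Sum>P\<in>orbit f ` S. card P + (if card P = 5 then 1 else 0)) = (\<Sum>P\<in>orbit f ` S. 6)"
    by (rule sum.cong[OF refl])
  then have "card S + (\<Sum>P\<in>orbit f ` S. if card P = 5 then 1 else 0) = 6 * card (orbit f ` S)"
    using sum_card_orbits[OF assms(1,2)] by (simp add: sum.distrib)
  moreover have "(\<Sum>P\<in>orbit f ` S. if card P = 5 then 1 else 0) = card {P \<in> orbit f ` S. card P = 5}"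
    using assms(1) by (simp add: sum.inter_filter[symmetric])
  ultimately show ?thesis by simp
qed

section \<open>Absence of loops and double edges\<close>

locale cubic_plane_map =
  fixes X :: "'a cmap"
  assumes plane: "plane_map X"
    and cubic: "\<And>v. v \<in> verts X \<Longrightarrow> card v = 3"
    and face_length: "\<And>f. f \<in> faces X \<Longrightarrow> card f = 5 \<or> card f = 6"
    and pentagon: "pentagons X \<noteq> {}"
begin

lemmas basic = plane_map_finite[OF plane] plane_map_nxt[OF plane] plane_map_opp[OF plane]
  plane_map_face_next[OF plane]

lemma opp_opp [simp]: "opp X (opp X d) = d"
  by (rule plane_map_opp_opp[OF plane])

lemma D [simp]: "nxt X d \<in> darts X \<longleftrightarrow> d \<in> darts X" "opp X d \<in> darts X \<longleftrightarrow> d \<in> darts X"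
  "face_next X d \<in> darts X \<longleftrightarrow> d \<in> darts X"
  using basic by (simp_all add: permutes_in_image)

lemma nxt_3: "d \<in> darts X \<Longrightarrow> nxt X (nxt X (nxt X d)) = d"
  using funpow_card_orbit[OF permutes_in_orbit[OF basic(1,2)], of d] cubic[of "orbit (nxt X) d"]
  by (simp add: verts_def numeral_3_eq_3)

lemma face_next_eq: "face_next X d = e \<longleftrightarrow> opp X d = nxt X e"
  unfolding face_next_def using permutes_inverses[OF basic(2)] by metis

lemma face_period:
  assumes "d \<in> darts X"
  shows "face_next X d \<noteq> d" "face_next X (face_next X d) \<noteq> d"
    "(face_next X ^^ 5) d = d \<or> (face_next X ^^ 6) d = d"
proof -
  let ?n = "card (orbit (face_next X) d)"
  have n: "?n = 5 \<or> ?n = 6" using face_length assms by (simp add: faces_def)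
  note self = permutes_in_orbit[OF basic(1,4), of d]
  show "face_next X d \<noteq> d" "face_next X (face_next X d) \<noteq> d"
    using funpow_neq_self[OF self, of 1] funpow_neq_self[OF self, of 2] n
    by (auto simp: numeral_2_eq_2)
  show "(face_next X ^^ 5) d = d \<or> (face_next X ^^ 6) d = d"
    using n funpow_card_orbit[OF self] by auto
qed

text \<open>The dart \<open>f\<close> is a neck if the other two darts at its origin lead to the same vertex
  without bounding a digon.\<close>

definition neck :: "'a \<Rightarrow> bool" where
  "neck f \<longleftrightarrow> f \<in> darts X \<and> opp X (nxt X (nxt X f)) = nxt X (opp X (nxt X f))"

text \<open>The face to the left of \<open>opp f\<close> runs through \<open>opp f\<close>,
  \<open>?e\<close>, \<open>opp X ?d\<close> and \<open>f\<close>, so it lies on both sides of the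
  neck. Length five would make the next dart a loop around a face of length one. So the length is
  six, and the two remaining darts form a double edge at the other end of \<open>f\<close>.\<close>

lemma neck_face:
  assumes "neck f"
  shows "neck (opp X f)" "card (orbit (face_next X) f) = 6" "f \<in> orbit (face_next X) (opp X f)"
    "orbit (face_next X) (nxt X (nxt X f)) = orbit (face_next X) (opp X f)"
    "opp X (nxt X f) \<in> orbit (face_next X) (opp X f)"
proof -
  let ?\<phi> = "face_next X" let ?d = "nxt X f" let ?e = "nxt X (nxt X f)"
  have f: "f \<in> darts X" "opp X ?e = nxt X (opp X ?d)" using assms by (auto simp: neck_def)
  have s1: "?\<phi> (opp X f) = ?e" using nxt_3[OF f(1)] by (simp add: face_next_eq)
  have s2: "?\<phi> ?e = opp X ?d" using f by (simp add: face_next_eq)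
  have s3: "?\<phi> (opp X ?d) = f" by (simp add: face_next_eq)
  define y where "y = ?\<phi> f"
  define z where "z = ?\<phi> y"
  have yD: "y \<in> darts X" using f by (simp add: y_def)
  have y: "opp X f = nxt X y" using face_next_eq[of f y] y_def by simp
  have z: "opp X y = nxt X z" using face_next_eq[of y z] z_def by simp
  have per: "(?\<phi> ^^ 5) (opp X f) = ?\<phi> y" "(?\<phi> ^^ 6) (opp X f) = ?\<phi> z"
    by (simp_all add: numeral_eq_Suc s1 s2 s3 flip: y_def z_def)
  have "?\<phi> y \<noteq> opp X f"
  proof
    assume "?\<phi> y = opp X f"
    then have "opp X y = nxt X (nxt X y)" using y face_next_eq by metis
    then have "?\<phi> (opp X y) = opp X y"
      using nxt_3[OF yD] by (metis face_next_eq opp_opp)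
    then show False using face_period(1)[of "opp X y"] yD by simp
  qed
  then have zf: "?\<phi> z = opp X f" using face_period(3)[of "opp X f"] f per by auto
  then have "opp X z = nxt X (opp X f)" by (simp add: face_next_eq)
  moreover have "nxt X (nxt X (opp X f)) = y" using y nxt_3[OF yD] by simp
  ultimately show "neck (opp X f)"
    using f z by (simp add: neck_def) (metis opp_opp)
  have self: "x \<in> orbit ?\<phi> x" for x by (rule permutes_in_orbit[OF basic(1,4)])
  have o1: "orbit ?\<phi> (?\<phi> x) = orbit ?\<phi> x" for x
    by (rule self_in_orbit_step[OF self])
  have orb: "orbit ?\<phi> ?e = orbit ?\<phi> (opp X f)" "orbit ?\<phi> (opp X ?d) = orbit ?\<phi> (opp X f)"
    "orbit ?\<phi> f = orbit ?\<phi> (opp X f)"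
    using o1[of "opp X f"] o1[of ?e] o1[of "opp X ?d"] s1 s2 s3 by simp_all
  then show "f \<in> orbit ?\<phi> (opp X f)" "orbit ?\<phi> ?e = orbit ?\<phi> (opp X f)"
    "opp X ?d \<in> orbit ?\<phi> (opp X f)"
    using self by metis+
  have "card (orbit ?\<phi> (opp X f)) \<noteq> 5"
    using funpow_card_orbit[OF self, of "opp X f"] per \<open>?\<phi> y \<noteq> opp X f\<close> by auto
  then show "card (orbit ?\<phi> f) = 6"
    using face_length[of "orbit ?\<phi> (opp X f)"] f orb by (simp add: faces_def)
qed

text \<open>The necks and the double edges between them form a closed necklace, all of whose faces
  are hexagons.\<close>

lemma not_neck: "\<not> neck f"
proof
  assume f: "neck f"
  define Y where "Y = (\<Union>f\<in>{f. neck f}. {f, nxt X f, nxt X (nxt X f)})"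
  have far: "neck (nxt X (opp X (nxt X (nxt X f))))" if "neck f" for f
    using that by (simp add: neck_def) (metis D nxt_3 opp_opp)
  have far': "nxt X (nxt X (opp X (nxt X (nxt X f)))) = opp X (nxt X f)" if "neck f" for f
    using that by (simp add: neck_def) (metis D nxt_3 opp_opp)
  have "Y = darts X"
  proof (rule plane_map_induct[OF plane])
    show "Y \<subseteq> darts X" by (auto simp: Y_def neck_def)
    show "Y \<noteq> {}" using f by (auto simp: Y_def)
    show "nxt X d \<in> Y" if "d \<in> Y" for d
      using that nxt_3 by (auto simp: Y_def neck_def)
    show "opp X d \<in> Y" if d: "d \<in> Y" for d
    proof -
      obtain f where f: "neck f" "d = f \<or> d = nxt X f \<or> d = nxt X (nxt X f)"
        using d by (auto simp: Y_def)
      define g where "g = nxt X (opp X (nxt X (nxt X f)))"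
      have g: "neck g" "nxt X g = opp X (nxt X f)"
        using far[OF f(1)] far'[OF f(1)] by (simp_all add: g_def)
      have "nxt X (nxt X g) = opp X (nxt X (nxt X f))"
        using g f(1) by (simp add: neck_def)
      with f(2) g neck_face(1)[OF f(1)] f(1) show ?thesis
        unfolding Y_def by (metis (no_types, lifting) UN_iff insertCI mem_Collect_eq)
    qed
  qed
  have "card (orbit (face_next X) d) = 6" if "d \<in> darts X" for d
  proof -
    have "d \<in> Y" using that \<open>Y = darts X\<close> by simp
    then obtain f where f: "neck f" "d = f \<or> d = nxt X f \<or> d = nxt X (nxt X f)"
      by (auto simp: Y_def)
    define g where "g = nxt X (opp X (nxt X (nxt X f)))"
    have g: "neck g" "nxt X g = opp X (nxt X f)"
      using far[OF f(1)] far'[OF f(1)] by (simp_all add: g_def)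
    have op: "card (orbit (face_next X) (opp X h)) = 6" if "neck h" for h
      using neck_face(1,2) that by blast
    have "card (orbit (face_next X) (nxt X f)) = 6"
    proof -
      have "nxt X f \<in> orbit (face_next X) (opp X g)"
        using neck_face(5)[OF g(1)] g(2) by simp
      then have "orbit (face_next X) (nxt X f) = orbit (face_next X) (opp X g)"
        by (simp add: orbit_eq_iff[OF basic(1,4)])
      then show ?thesis using op[OF g(1)] by simp
    qed
    then show ?thesis using f neck_face(2,4)[OF f(1)] op[OF f(1)] by auto
  qed
  then have "pentagons X = {}" by (auto simp: pentagons_def faces_def)
  then show False using pentagon by simp
qed

text \<open>A loop at a cubic vertex bounds a face of length one on one of its sides. A double edge
  bounds a digon if the cyclic orders of its darts at the two ends are opposite, and leaves a neck
  if they agree.\<close>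

lemma simple: "simple_map X"
proof -
  have orb: "orbit (nxt X) d = {d, nxt X d, nxt X (nxt X d)}" if "d \<in> darts X" for d
    by (rule orbit_3[where f = "nxt X", OF nxt_3[OF that]])
  have "opp X d \<notin> orbit (nxt X) d" if d: "d \<in> darts X" for d
  proof
    assume "opp X d \<in> orbit (nxt X) d"
    then consider "opp X d = nxt X d" | "opp X d = nxt X (nxt X d)"
      using orb[OF d] plane_map_opp_neq[OF plane d] by auto
    then show False
    proof cases
      case 1
      then have "face_next X d = d" by (simp add: face_next_eq)
      then show False using face_period(1) d by simp
    next
      case 2
      then have "face_next X (opp X d) = opp X d" using nxt_3[OF d] by (metis face_next_eq opp_opp)
      then show False using face_period(1)[of "opp X d"] d by simp
    qed
  qed
  moreover have "e = d"
    if d: "d \<in> darts X" "e \<in> orbit (nxt X) d" "opp X e \<in> orbit (nxt X) (opp X d)" for d e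
  proof (rule ccontr)
    assume "e \<noteq> d"
    then have "opp X e \<noteq> opp X d" by (metis opp_opp)
    with d orb[of d] orb[of "opp X d"] \<open>e \<noteq> d\<close>
    have e: "e = nxt X d \<or> e = nxt X (nxt X d)"
      and oe: "opp X e = nxt X (opp X d) \<or> opp X e = nxt X (nxt X (opp X d))"
      by auto
    have od: "opp X d \<in> darts X" using d by simp
    consider "e = nxt X d" "opp X e = nxt X (opp X d)"
      | "e = nxt X d" "opp X d = nxt X (opp X e)"
      | "d = nxt X e" "opp X e = nxt X (opp X d)" | "d = nxt X e" "opp X d = nxt X (opp X e)"
      using e oe nxt_3[OF d(1)] nxt_3[OF od] by metis
    then show False
    proof cases
      case 1
      have "neck (nxt X e)" using 1 d nxt_3[OF d(1)] by (simp add: neck_def)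
      then show False using not_neck by blast
    next
      case 2
      have "face_next X d = opp X e" "face_next X (opp X e) = d"
        using 2 by (simp_all add: face_next_eq)
      then show False using face_period(2)[OF d(1)] by simp
    next
      case 3
      then have "face_next X e = opp X d" "face_next X (opp X d) = e" by (simp_all add: face_next_eq)
      then show False using face_period(2)[of e] d e by auto
    next
      case 4
      have "neck (nxt X d)" using 4 e d nxt_3 by (auto simp: neck_def)
      then show False using not_neck by blast
    qed
  qed
  ultimately show ?thesis unfolding simple_map_def by blast
qed

end

section \<open>The deflated fullerene\<close>

lemma (in coarse_triangulation) flip_turn_grid:
  assumes "m \<in> coarse" "a + b < k"
  shows "turn (flip (grid m a (Suc b))) = flip (turn (grid m a b))"
proof -
  have "turn (flip (up (grid m a b))) = flip (turn (grid m a b))"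
    by (simp add: turn_def up_def flip_rot'_flip)
  then show ?thesis using grid_Suc_right[OF assms(1)] assms(2) by simp
qed

text \<open>A small step stays inside a coarse triangle, seen from another of its corners by
  \<open>cturn\<close>, or leaves it through a coarse edge by \<open>cflip\<close>. The reversed
  darts are included to account for the downward triangles.\<close>

lemma (in coarse_triangulation) cells_induct:
  assumes K: "K \<subseteq> coarse" "\<And>m. m \<in> K \<Longrightarrow> cturn m \<in> K" "\<And>m. m \<in> K \<Longrightarrow> cflip m \<in> K"
    and d: "d \<in> {grid m a b |m a b. m \<in> K \<and> a + b < k} \<union> {flip (grid m a b) |m a b. m \<in> K \<and> a + b < k}"
      (is "d \<in> ?Y")
  shows "turn d \<in> ?Y" "flip d \<in> ?Y"
proof -
  have 1: "turn (grid m a b) \<in> ?Y" if "m \<in> K" "a + b < k" for m a b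
  proof -
    have "turn (grid m a b) = grid (cturn m) b (k - 1 - a - b)"
      using grid_cturn[of m b "k - 1 - a - b" a] that K(1) by auto
    moreover have "b + (k - 1 - a - b) < k" using that by simp
    ultimately show ?thesis using that K by blast
  qed
  have 2: "turn (flip (grid m a b)) \<in> ?Y" if m: "m \<in> K" "a + b < k" for m a b
  proof (cases b)
    case 0
    have "flip (grid m a 0) = grid (cflip m) (k - 1 - a) 0"
      using grid_cflip[of m a "k - 1 - a"] m K(1) by auto
    then show ?thesis using 1[of "cflip m" "k - 1 - a" 0] m 0 K by simp
  next
    case (Suc c)
    have "turn (flip (grid m a b)) = flip (turn (grid m a c))"
      using flip_turn_grid[of m a c] m K(1) Suc by auto
    moreover have "turn (grid m a c) = grid (cturn m) c (k - 1 - a - c)"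
      using grid_cturn[of m c "k - 1 - a - c" a] m K(1) Suc by auto
    moreover have "flip (grid (cturn m) c (k - 1 - a - c)) \<in> ?Y"
    proof -
      have "c + (k - 1 - a - c) < k" using m Suc by simp
      then show ?thesis using m(1) K(2) by blast
    qed
    ultimately show ?thesis by simp
  qed
  show "turn d \<in> ?Y" using d 1 2 by blast
  show "flip d \<in> ?Y" using d by auto
qed

section \<open>The coarse map as a fullerene\<close>

locale coarse_fullerene = coarse_triangulation "darts F" "face_next F" "opp F" k \<alpha> \<beta>
  for F :: "'a cmap" and k \<alpha> \<beta> +
  assumes fullerene: "fullerene F"
begin

lemma plane_F: "plane_map F"
  using fullerene by (simp add: fullerene_def)

lemma turn_F: "turn d = opp F (nxt F (opp F d))"
  by (simp add: turn_def plane_map_inv_face_next[OF plane_F])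

lemma card_orbit_face_next: "d \<in> darts F \<Longrightarrow> card (orbit (face_next F) d) = 5 \<or> card (orbit (face_next F) d) = 6"
  using fullerene by (simp add: fullerene_def faces_def)

text \<open>In Euler's formula for a cubic map the number of darts cancels and each pentagon
  contributes one sixth. The same count, read backwards, later gives the Euler characteristic of the
  deflation.\<close>

lemma card_pentagons: "card (pentagons F) = 12"
proof -
  have "3 * card (verts F) = card (darts F)"
    unfolding verts_def
    by (rule card_orbits_uniform[OF finite_D plane_map_nxt[OF plane_F]])
      (use fullerene in \<open>simp add: fullerene_def verts_def\<close>)
  moreover have "6 * card (faces F) = card (darts F) + card (pentagons F)"
    unfolding faces_def pentagons_def
    by (rule card_orbits_5_6[OF finite_D rot_permutes card_orbit_face_next])
  moreover have "int (card (verts F)) - int (card (edges F)) + int (card (faces F)) = 2"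
    using plane_F by (simp add: plane_map_def)
  ultimately show ?thesis using card_edges[OF plane_F] by linarith
qed

lemma pentagons_coarse: "pentagons F = {P \<in> orbit (face_next F) ` coarse. card P = 5}"
  using flat by (force simp: pentagons_def faces_def coarse_def)

lemma coarse_nonempty: "coarse \<noteq> {}"
  using card_pentagons pentagons_coarse by auto

lemma finite_coarse: "finite coarse"
  using finite_D by (simp add: coarse_def)

text \<open>A consequence of the connectedness of \<open>F\<close>. It is stated for any closed
  \<open>K\<close>: all coarse darts give the covering by coarse triangles, and a connected
  component gives the connectedness of the deflation.\<close>

lemma cells_cover:
  assumes "K \<subseteq> coarse" "K \<noteq> {}" "\<And>m. m \<in> K \<Longrightarrow> cturn m \<in> K" "\<And>m. m \<in> K \<Longrightarrow> cflip m \<in> K"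
  shows "{grid m a b |m a b. m \<in> K \<and> a + b < k} \<union> {opp F (grid m a b) |m a b. m \<in> K \<and> a + b < k} = darts F"
    (is "?Y = _")
proof (rule plane_map_induct[OF plane_F])
  have Y: "turn d \<in> ?Y" "opp F d \<in> ?Y" if "d \<in> ?Y" for d
    by (rule cells_induct[OF assms(1) _ _ that], erule assms(3), erule assms(4))+
  show "?Y \<subseteq> darts F" using assms(1) coarse_D by auto
  obtain m where "m \<in> K" using assms(2) by blast
  moreover have "0 + 0 < k" using k_pos by simp
  ultimately have "grid m 0 0 \<in> ?Y" by blast
  then show "?Y \<noteq> {}" by blast
  show "opp F d \<in> ?Y" if "d \<in> ?Y" for d using Y(2)[OF that] .
  show "nxt F d \<in> ?Y" if "d \<in> ?Y" for d
  proof -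
    have "nxt F d = opp F (turn (opp F d))" by (simp add: turn_F)
    then show ?thesis using Y(2)[OF Y(1)[OF Y(2)[OF that]]] by simp
  qed
qed

text \<open>Residues recognise the corners: among the small darts in a triangle of \<open>m\<close>
  and their reverses, only \<open>m\<close> and \<open>cflip m\<close> have residue zero.\<close>

lemma coarse_connected:
  assumes "K \<subseteq> coarse" "K \<noteq> {}" "\<And>m. m \<in> K \<Longrightarrow> cturn m \<in> K" "\<And>m. m \<in> K \<Longrightarrow> cflip m \<in> K"
  shows "K = coarse"
proof
  show "coarse \<subseteq> K"
  proof
    fix d assume d: "d \<in> coarse"
    then have "d \<in> {grid m a b |m a b. m \<in> K \<and> a + b < k} \<union> {opp F (grid m a b) |m a b. m \<in> K \<and> a + b < k}"
      using cells_cover[OF assms] coarse_D by simp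
    then obtain m a b where m: "m \<in> K" "a + b < k" "d = grid m a b \<or> d = opp F (grid m a b)"
      by blast
    have mc: "m \<in> coarse" "grid m a b \<in> darts F" using m(1) assms(1) by (auto simp: coarse_def)
    have r: "\<alpha> (grid m a b) = int a" "\<beta> (grid m a b) = int b"
      using residue_grid_coarse[OF mc(1)] m(2) by simp_all
    from m(3) show "d \<in> K"
    proof
      assume "d = grid m a b"
      then have "a = 0" "b = 0" using d r by (simp_all add: coarse_def)
      then show ?thesis using \<open>d = grid m a b\<close> m(1) by simp
    next
      assume *: "d = opp F (grid m a b)"
      then have "int k dvd - int a - 1" "int k dvd - int b"
        using d r mc by (auto simp: coarse_def \<alpha>_flip \<beta>_flip mod_eq_0_iff_dvd)
      then have "int k dvd int (Suc a)" "int k dvd int b"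
        by (metis add_uminus_conv_diff dvd_minus_iff minus_add_distrib of_nat_Suc add.commute, simp)
      then have "k dvd Suc a" "k dvd b" by (simp_all only: of_nat_dvd_iff)
      then have "Suc a = k" "b = 0" using m(2) by (auto dest: dvd_imp_le)
      then have "a = k - 1" by simp
      then have "d = cflip m" using * \<open>b = 0\<close> by (simp add: cflip_def grid_def)
      then show ?thesis using assms(4) m(1) by simp
    qed
  qed
qed (rule assms(1))

text \<open>Extended by the identity because \<open>permutes\<close> requires it outside the
  carrier; the same holds for \<open>coarse_flip\<close>.\<close>

definition coarse_rot :: "'a \<Rightarrow> 'a" where
  "coarse_rot d = (if d \<in> coarse then face_next F d else d)"

definition coarse_flip :: "'a \<Rightarrow> 'a" where
  "coarse_flip d = (if d \<in> coarse then cflip d else d)"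

text \<open>The coarse triangulation is to be the dual of this map, so its rotation must come out as
  \<open>face_next\<close>; solving for \<open>nxt\<close> gives this formula.\<close>

definition deflation :: "'a cmap" where
  "deflation = \<lparr>darts = coarse, nxt = coarse_flip \<circ> inv coarse_rot, opp = coarse_flip\<rparr>"

lemma deflation_simps [simp]: "darts deflation = coarse" "nxt deflation = coarse_flip \<circ> inv coarse_rot"
  "opp deflation = coarse_flip"
  by (simp_all add: deflation_def)

lemma coarse_rot_permutes: "coarse_rot permutes coarse"
  by (rule permutesI_closed_inj[OF finite_coarse]) (auto simp: coarse_rot_def inj_on_def)

lemma coarse_flip_flip [simp]: "coarse_flip (coarse_flip d) = d"
  by (simp add: coarse_flip_def cflip_coarse cflip_cflip)

lemma coarse_flip_permutes: "coarse_flip permutes coarse"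
  by (rule permutesI_closed_inj[OF finite_coarse])
    (simp_all add: coarse_flip_def cflip_coarse inj_on_def, metis cflip_cflip)

lemma inv_coarse_rot: "d \<in> coarse \<Longrightarrow> inv coarse_rot d = rot' d"
  using permutes_inverses(2)[OF coarse_rot_permutes, of "rot' d"] by (simp add: coarse_rot_def)

lemma face_next_deflation: "face_next deflation = coarse_rot"
proof -
  have "inv (coarse_flip \<circ> inv coarse_rot) = coarse_rot \<circ> coarse_flip"
    by (rule inv_unique_comp) (auto simp: permutes_inverses[OF coarse_rot_permutes])
  then show ?thesis by (simp add: face_next_comp fun_eq_iff)
qed

text \<open>\<open>cflip\<close> conjugates \<open>cturn\<close> into \<open>nxt\<close>, which is
  why the vertices of the deflation are the coarse triangles and have three darts each.\<close>

lemma nxt_deflation: "d \<in> coarse \<Longrightarrow> nxt deflation (cflip d) = cflip (cturn d)"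
  by (simp add: inv_coarse_rot cflip_coarse coarse_flip_def cturn_def)

lemma nxt_deflation_permutes: "nxt deflation permutes coarse"
  using permutes_compose[OF permutes_inv[OF coarse_rot_permutes] coarse_flip_permutes] by simp

lemma deflation_cubic: "v \<in> verts deflation \<Longrightarrow> card v = 3"
proof -
  assume "v \<in> verts deflation"
  then obtain e where e: "e \<in> coarse" "v = orbit (nxt deflation) e" by (auto simp: verts_def)
  define d where "d = cflip e"
  have d: "d \<in> coarse" "e = cflip d" using e by (simp_all add: d_def cflip_coarse cflip_cflip)
  have "cflip (cturn d) \<noteq> cflip d" using cflip_cflip cturn_coarse cturn_neq d(1) by metis
  then have "nxt deflation (nxt deflation (nxt deflation e)) = e" "nxt deflation e \<noteq> e"
    using d by (simp_all only: nxt_deflation cturn_coarse cturn_cturn_cturn not_False_eq_True)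
  then show "card v = 3" using card_orbit_3[of "nxt deflation"] e(2) by metis
qed

lemma orbit_coarse_rot: "d \<in> coarse \<Longrightarrow> orbit coarse_rot d = orbit (face_next F) d"
  by (rule orbit_cong0[where A = coarse]) (auto simp: coarse_rot_def)

lemma faces_deflation: "faces deflation = orbit (face_next F) ` coarse"
  unfolding faces_def face_next_deflation by (simp add: orbit_coarse_rot cong: image_cong_simp)

lemma deflation_faces_subset: "faces deflation \<subseteq> faces F"
  unfolding faces_deflation by (auto simp: faces_def coarse_def)

lemma pentagons_deflation: "pentagons deflation = pentagons F"
  unfolding pentagons_coarse by (simp add: pentagons_def faces_deflation)

lemma deflation_connected:
  assumes "d \<in> coarse" "e \<in> coarse"
  shows "(d, e) \<in> ({(x, nxt deflation x) |x. True} \<union> {(x, opp deflation x) |x. True})\<^sup>*" (is "_ \<in> ?R\<^sup>*")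
proof -
  let ?K = "{e \<in> coarse. (d, e) \<in> ?R\<^sup>*}"
  have n: "nxt deflation e \<in> ?K" if "e \<in> ?K" for e
  proof (intro CollectI conjI)
    have de: "(d, e) \<in> ?R\<^sup>*" and "e \<in> coarse" using that by blast+
    show "(d, nxt deflation e) \<in> ?R\<^sup>*" by (rule rtrancl_into_rtrancl[OF de]) blast
    show "nxt deflation e \<in> coarse"
      using \<open>e \<in> coarse\<close> by (simp only: permutes_in_image[OF nxt_deflation_permutes])
  qed
  have o: "cflip e \<in> ?K" if "e \<in> ?K" for e
  proof (intro CollectI conjI)
    have de: "(d, e) \<in> ?R\<^sup>*" and e: "e \<in> coarse" using that by blast+
    have "(d, opp deflation e) \<in> ?R\<^sup>*" by (rule rtrancl_into_rtrancl[OF de]) blast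
    moreover have "opp deflation e = cflip e" using e by (simp add: coarse_flip_def)
    ultimately show "(d, cflip e) \<in> ?R\<^sup>*" by (simp only:)
    show "cflip e \<in> coarse" by (rule cflip_coarse[OF e])
  qed
  have "?K = coarse"
  proof (rule coarse_connected)
    show "cturn e \<in> ?K" if "e \<in> ?K" for e
    proof -
      have e: "e \<in> coarse" using that by simp
      have "cflip (nxt deflation (cflip e)) = cturn e"
        using nxt_deflation[OF e] cflip_cflip cturn_coarse[OF e] by metis
      then show ?thesis using o[OF n[OF o[OF that]]] by (simp only:)
    qed
    show "cflip e \<in> ?K" if "e \<in> ?K" for e by (rule o[OF that])
    have "d \<in> ?K" using assms(1) by blast
    then show "?K \<noteq> {}" by blast
  qed blast
  then show ?thesis using assms(2) by blast
qed

lemma plane_deflation: "plane_map deflation"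
proof -
  have "3 * card (verts deflation) = card coarse"
    unfolding verts_def deflation_simps(1)
    by (rule card_orbits_uniform[OF finite_coarse nxt_deflation_permutes])
      (use deflation_cubic in \<open>simp add: verts_def\<close>)
  moreover have "2 * card (edges deflation) = card coarse"
    unfolding edges_def deflation_simps
    by (rule card_orbits_uniform[OF finite_coarse coarse_flip_permutes], rule card_orbit_2)
      (simp_all add: coarse_flip_def cflip_coarse cflip_cflip cflip_neq)
  moreover have "6 * card (faces deflation) = card coarse + card (pentagons deflation)"
    unfolding faces_deflation pentagons_def orbit_coarse_rot[symmetric]
    using card_orbits_5_6[OF finite_coarse coarse_rot_permutes] card_orbit_face_next coarse_D orbit_coarse_rot
    by (simp cong: image_cong_simp)
  \<comment> \<open>The terms in \<open>card coarse\<close> cancel, since 1/3 - 1/2 + 1/6 = 0, and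
    the pentagons contribute 12/6.\<close>
  ultimately have "int (card (verts deflation)) - int (card (edges deflation)) + int (card (faces deflation)) = 2"
    unfolding pentagons_deflation card_pentagons by linarith
  then show ?thesis
    unfolding plane_map_def
    using finite_coarse coarse_nonempty nxt_deflation_permutes coarse_flip_permutes deflation_connected
    by (simp add: coarse_flip_def cflip_coarse cflip_cflip cflip_neq)
qed

lemma fullerene_deflation: "fullerene deflation"
proof -
  have f: "card f = 5 \<or> card f = 6" if "f \<in> faces deflation" for f
    using that deflation_faces_subset fullerene by (auto simp: fullerene_def)
  have "pentagons deflation \<noteq> {}" using card_pentagons pentagons_deflation by auto
  then interpret cubic_plane_map deflation
    by unfold_locales (use plane_deflation deflation_cubic f in auto)
  show ?thesis
    unfolding fullerene_def using plane_deflation simple deflation_cubic f by blast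
qed

end

section \<open>Eisenstein integers\<close>

definition eis :: "int \<Rightarrow> int \<Rightarrow> complex" where
  "eis a b = of_int a + of_int b * omega"

text \<open>Real coordinates in the lattice basis, in which cells and big triangles are given by
  inequalities without irrational coefficients.\<close>

definition pt :: "real \<Rightarrow> real \<Rightarrow> complex" where
  "pt s r = of_real s + of_real r * omega"

lemma omega_Re [simp]: "Re omega = 1 / 2" and omega_Im [simp]: "Im omega = sqrt 3 / 2"
  by (simp_all add: omega_def cos_60 sin_60)

lemma omega_square: "omega * omega = omega - 1"
  by (simp add: complex_eq_iff)

lemma omega_powers: "omega ^ 2 = omega - 1" "omega ^ 3 = - 1" "omega ^ 4 = - omega"
  "omega ^ 5 = 1 - omega" "omega ^ 6 = 1"
proof -
  show 2: "omega ^ 2 = omega - 1" by (simp add: power2_eq_square omega_square)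
  have "omega ^ 3 = omega ^ 2 * omega" by (simp add: power3_eq_cube power2_eq_square)
  then show 3: "omega ^ 3 = - 1" by (simp add: 2 omega_square algebra_simps)
  have "omega ^ 4 = omega ^ 3 * omega" "omega ^ 5 = omega ^ 3 * omega ^ 2" "omega ^ 6 = omega ^ 3 * omega ^ 3"
    by (simp_all flip: power_add power_Suc2)
  then show "omega ^ 4 = - omega" "omega ^ 5 = 1 - omega" "omega ^ 6 = 1"
    by (simp_all add: 2 3)
qed

lemma norm_omega [simp]: "norm omega = 1"
  by (simp add: omega_def)

lemma eis_pt: "eis a b = pt (of_int a) (of_int b)"
  by (simp add: eis_def pt_def)

lemma eisenstein_eis: "eisenstein = {eis a b |a b. True}"
  by (simp add: eisenstein_def eis_def)

lemma eis_in [simp]: "eis a b \<in> eisenstein"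
  by (auto simp: eisenstein_eis)

lemma eisensteinE: assumes "z \<in> eisenstein" obtains a b where "z = eis a b"
  using assms by (auto simp: eisenstein_eis)

lemma pt_simps: "Re (pt s r) = s + r / 2" "Im (pt s r) = r * (sqrt 3 / 2)"
  by (simp_all add: pt_def)

lemma pt_eq [simp]: "pt s r = pt s' r' \<longleftrightarrow> s = s' \<and> r = r'"
  by (auto simp: complex_eq_iff pt_simps)

lemma eis_eq [simp]: "eis a b = eis a' b' \<longleftrightarrow> a = a' \<and> b = b'"
  by (simp add: eis_pt)

lemma pt_cases: obtains s r where "z = pt s r"
proof
  show "z = pt (Re z - Im z / sqrt 3) (Im z * 2 / sqrt 3)"
    by (simp add: complex_eq_iff pt_simps field_simps)
qed

lemma pt_arith: "pt s r + pt s' r' = pt (s + s') (r + r')" "pt s r - pt s' r' = pt (s - s') (r - r')"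
  "- pt s r = pt (- s) (- r)" "pt s r * pt s' r' = pt (s * s' - r * r') (s * r' + r * s' + r * r')"
proof -
  show "pt s r + pt s' r' = pt (s + s') (r + r')" "pt s r - pt s' r' = pt (s - s') (r - r')"
    "- pt s r = pt (- s) (- r)"
    by (simp_all add: pt_def algebra_simps)
  have "pt s r * pt s' r' =
      of_real (s * s') + of_real (s * r' + r * s') * omega + of_real (r * r') * (omega * omega)"
    by (simp add: pt_def algebra_simps)
  then show "pt s r * pt s' r' = pt (s * s' - r * r') (s * r' + r * s' + r * r')"
    unfolding omega_square by (simp add: pt_def algebra_simps)
qed

lemma eis_arith: "eis a b + eis a' b' = eis (a + a') (b + b')" "eis a b - eis a' b' = eis (a - a') (b - b')"
  "- eis a b = eis (- a) (- b)" "eis a b * eis a' b' = eis (a * a' - b * b') (a * b' + b * a' + b * b')"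
  by (simp_all add: eis_pt pt_arith)

lemma eis_const: "0 = eis 0 0" "1 = eis 1 0" "omega = eis 0 1" "of_nat n = eis (int n) 0"
  by (simp_all add: eis_def)

lemma pt_const: "0 = pt 0 0" "1 = pt 1 0" "omega = pt 0 1" "of_nat n = pt (real n) 0" "of_real x = pt x 0"
  by (simp_all add: pt_def)

lemma eisenstein_closed:
  assumes "x \<in> eisenstein" "y \<in> eisenstein"
  shows "x + y \<in> eisenstein" "x - y \<in> eisenstein" "- x \<in> eisenstein" "x * y \<in> eisenstein"
  using assms by (auto elim!: eisensteinE simp: eis_arith)

lemma eisenstein_const: "0 \<in> eisenstein" "1 \<in> eisenstein" "omega \<in> eisenstein" "of_nat n \<in> eisenstein"
  by (simp_all only: eis_const eis_in)

lemma eisenstein_power: "x \<in> eisenstein \<Longrightarrow> x ^ n \<in> eisenstein"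
  by (induction n) (simp_all add: eisenstein_closed eisenstein_const)

lemma coxeter_vec_pt: "coxeter_vec c = pt (real (fst c)) (real (snd c))"
  by (simp add: coxeter_vec_def pt_def)

lemma unit_eq_omega_power:
  fixes u :: complex
  assumes "u ^ 6 = 1" shows "\<exists>j<6. u = omega ^ j"
proof -
  have "(\<lambda>k. cis (2 * pi * real k / real 6)) ` {..<6} = {z. z ^ 6 = 1}"
    using Complex.bij_betw_roots_unity[of 6, THEN bij_betw_imp_surj_on] by (simp only: zero_less_numeral)
  then have "u \<in> (\<lambda>k. cis (2 * pi * real k / real 6)) ` {..<6}"
    using assms by (simp only: mem_Collect_eq)
  then obtain j where "j < 6" "u = cis (2 * pi * real j / 6)" by auto
  moreover have "omega ^ j = cis (2 * pi * real j / 6)"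
    unfolding omega_def Complex.DeMoivre by (simp add: field_simps)
  ultimately show ?thesis by auto
qed

lemma unit_cases:
  fixes u :: complex
  assumes "u ^ 6 = 1"
  obtains "u = 1" | "u = omega" | "u = omega ^ 2" | "u = - 1" | "u = omega ^ 4" | "u = omega ^ 5"
proof -
  obtain j where "j < 6" "u = omega ^ j" using unit_eq_omega_power[OF assms] by blast
  moreover from \<open>j < 6\<close> have "j = 0 \<or> j = 1 \<or> j = 2 \<or> j = 3 \<or> j = 4 \<or> j = 5" by linarith
  ultimately show ?thesis using that omega_powers(2) by auto
qed

lemma unit_eisenstein: "u ^ 6 = 1 \<Longrightarrow> u \<in> eisenstein"
  using unit_eq_omega_power eisenstein_power eisenstein_const by metis

lemma unit_norm: "norm u = 1" if "u ^ 6 = 1" for u :: complex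
  using unit_eq_omega_power[OF that] by (auto simp: norm_power)

lemma unit_inverse: "u ^ 6 = 1 \<Longrightarrow> (1 / u) ^ 6 = 1" for u :: complex
  by (simp add: power_divide)

lemma eisenstein_divide_unit: "z \<in> eisenstein \<Longrightarrow> u ^ 6 = 1 \<Longrightarrow> z / u \<in> eisenstein"
  using eisenstein_closed(4)[of z "1 / u"] unit_eisenstein[OF unit_inverse, of u] by simp

text \<open>The ideal generated by \<open>k\<close>. Being stable under units, it does not notice in
  which of the six frames a vector is written.\<close>

definition scaled_eisenstein :: "nat \<Rightarrow> complex set" where
  "scaled_eisenstein k = {of_nat k * e |e. e \<in> eisenstein}"

lemma scaled_eisenstein_closed:
  assumes "x \<in> scaled_eisenstein k" "y \<in> scaled_eisenstein k"
  shows "x + y \<in> scaled_eisenstein k" "x - y \<in> scaled_eisenstein k" "- x \<in> scaled_eisenstein k"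
proof -
  obtain e f where *: "e \<in> eisenstein" "f \<in> eisenstein" "x = of_nat k * e" "y = of_nat k * f"
    using assms by (auto simp: scaled_eisenstein_def)
  then have "x + y = of_nat k * (e + f)" "x - y = of_nat k * (e - f)" "- x = of_nat k * (- e)"
    by (simp_all add: algebra_simps)
  then show "x + y \<in> scaled_eisenstein k" "x - y \<in> scaled_eisenstein k" "- x \<in> scaled_eisenstein k"
    unfolding scaled_eisenstein_def using eisenstein_closed *(1,2) by blast+
qed

lemma scaled_eisenstein_0: "0 \<in> scaled_eisenstein k"
  unfolding scaled_eisenstein_def using eisenstein_const(1) by force

lemma scaled_eisenstein_mult:
  assumes "x \<in> scaled_eisenstein k" "y \<in> eisenstein"
  shows "x * y \<in> scaled_eisenstein k"
proof -
  obtain e where "e \<in> eisenstein" "x = of_nat k * e"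
    using assms by (auto simp: scaled_eisenstein_def)
  then show ?thesis
    unfolding scaled_eisenstein_def using eisenstein_closed(4)[OF \<open>e \<in> _\<close> assms(2)] by (auto simp: mult.assoc)
qed

lemma scaled_eisenstein_divide_unit:
  "x \<in> scaled_eisenstein k \<Longrightarrow> u ^ 6 = 1 \<Longrightarrow> x / u \<in> scaled_eisenstein k"
  using scaled_eisenstein_mult[of x k "1 / u"] unit_eisenstein[OF unit_inverse, of u] by simp

lemma eis_scaled_iff: "eis a b \<in> scaled_eisenstein k \<longleftrightarrow> int k dvd a \<and> int k dvd b"
proof
  assume "eis a b \<in> scaled_eisenstein k"
  then obtain c d where "eis a b = eis (int k) 0 * eis c d"
    by (auto simp: scaled_eisenstein_def eis_const(4) elim!: eisensteinE)
  then show "int k dvd a \<and> int k dvd b" by (simp add: eis_arith)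
next
  assume "int k dvd a \<and> int k dvd b"
  then obtain c d where "a = int k * c" "b = int k * d" by (auto elim!: dvdE)
  then have "eis a b = of_nat k * eis c d" by (simp add: eis_arith eis_const(4))
  then show "eis a b \<in> scaled_eisenstein k" unfolding scaled_eisenstein_def by auto
qed

lemma finite_eisenstein_bounded: "finite {p \<in> eisenstein. norm p \<le> R}"
proof -
  \<comment> \<open>A crude bound: from \<open>sqrt 3 >= 1\<close> alone, both coordinates are at
    most \<open>2 * R\<close> in absolute value.\<close>
  define n where "n = \<lceil>2 * R\<rceil>"
  have "{p \<in> eisenstein. norm p \<le> R} \<subseteq> (\<lambda>(a, b). eis a b) ` ({-n..n} \<times> {-n..n})"
  proof clarify
    fix p assume "p \<in> eisenstein" "norm p \<le> R"
    then obtain a b where p: "p = eis a b" by (elim eisensteinE)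
    have 1: "\<bar>real_of_int b * (sqrt 3 / 2)\<bar> \<le> R" "\<bar>real_of_int a + real_of_int b / 2\<bar> \<le> R"
      using abs_Im_le_cmod[of p] abs_Re_le_cmod[of p] \<open>norm p \<le> R\<close> p
      by (simp_all add: eis_pt pt_simps)
    have "\<bar>real_of_int b\<bar> * 1 \<le> \<bar>real_of_int b\<bar> * sqrt 3" by (rule mult_left_mono) auto
    then have b: "\<bar>real_of_int b\<bar> \<le> 2 * R" using 1(1) by (simp add: abs_mult)
    then have a: "\<bar>real_of_int a\<bar> \<le> 2 * R" using 1(2) by linarith
    have "a \<in> {-n..n}" "b \<in> {-n..n}" using a b unfolding n_def by auto linarith+
    then show "p \<in> (\<lambda>(a, b). eis a b) ` ({-n..n} \<times> {-n..n})" using p by auto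
  qed
  then show ?thesis by (rule finite_subset) simp
qed

section \<open>Triangles in the complex plane\<close>

text \<open>Twice the signed area of the triangle \<open>0\<close>, \<open>p\<close>,
  \<open>q\<close>; quotients of such areas are barycentric coordinates.\<close>

definition cross :: "complex \<Rightarrow> complex \<Rightarrow> real" where
  "cross p q = Im (cnj p * q)"

lemma cross_eq: "cross p q = Re p * Im q - Im p * Re q"
  by (simp add: cross_def)

lemma cross_simps: "cross p (q + r) = cross p q + cross p r" "cross (p + r) q = cross p q + cross r q"
  "cross p (q - r) = cross p q - cross p r" "cross (p - r) q = cross p q - cross r q"
  "cross (- p) q = - cross p q" "cross p (- q) = - cross p q" "cross p p = 0" "cross 0 q = 0" "cross p 0 = 0"
  "cross (of_real s * p) q = s * cross p q" "cross p (of_real s * q) = s * cross p q"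
  by (simp_all add: cross_eq algebra_simps)

lemma cross_swap: "cross q p = - cross p q"
  by (simp add: cross_eq)

lemma cross_rotate: "norm u = 1 \<Longrightarrow> cross (p / u) (q / u) = cross p q"
proof -
  assume u: "norm u = 1"
  have "cnj (p / u) * (q / u) = cnj p * q / (u * cnj u)" by simp
  also have "u * cnj u = 1" using u by (simp add: complex_norm_square[symmetric])
  finally show ?thesis by (simp add: cross_def)
qed

lemma cross_pt: "cross (pt s r) (pt s' r') = (s * r' - r * s') * (sqrt 3 / 2)"
  by (simp add: cross_eq pt_simps field_simps)

text \<open>Cramer's rule for \<open>z\<close> in terms of \<open>t\<close> and \<open>a\<close>,
  cleared of the denominator.\<close>

lemma cross_decompose: "of_real (cross t a) * z = of_real (cross z a) * t + of_real (cross t z) * a"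
  by (simp add: complex_eq_iff cross_eq algebra_simps)

lemma triangle_hull:
  assumes "cross t a > 0"
  shows "z \<in> convex hull {0, t, a} \<longleftrightarrow>
    0 \<le> cross t z \<and> 0 \<le> cross z a \<and> cross t z + cross z a \<le> cross t a"
proof
  assume "z \<in> convex hull {0, t, a}"
  then obtain u v w where *: "0 \<le> u" "0 \<le> v" "0 \<le> w" "u + v + w = 1"
    "z = of_real v * t + of_real w * a"
    by (auto simp: convex_hull_3 scaleR_conv_of_real)
  then have "cross t z = w * cross t a" "cross z a = v * cross t a" by (simp_all add: cross_simps)
  moreover have "(v + w) * cross t a \<le> 1 * cross t a"
    by (rule mult_right_mono) (use * assms in simp_all)
  ultimately show "0 \<le> cross t z \<and> 0 \<le> cross z a \<and> cross t z + cross z a \<le> cross t a"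
    using * assms by (simp add: algebra_simps)
next
  assume *: "0 \<le> cross t z \<and> 0 \<le> cross z a \<and> cross t z + cross z a \<le> cross t a"
  define v w where "v = cross z a / cross t a" and "w = cross t z / cross t a"
  have "z = of_real v * t + of_real w * a"
    using cross_decompose[of t a z] assms by (simp add: v_def w_def field_simps)
  moreover have "0 \<le> v" "0 \<le> w" "v + w \<le> 1"
    using * assms by (simp_all add: v_def w_def add_divide_distrib[symmetric])
  ultimately have vw: "z = of_real v * t + of_real w * a" "0 \<le> v" "0 \<le> w" "v + w \<le> 1"
    by simp_all
  show "z \<in> convex hull {0, t, a}"
  proof -
    have "z = (1 - v - w) *\<^sub>R 0 + v *\<^sub>R t + w *\<^sub>R a \<and> 0 \<le> 1 - v - w \<and> 0 \<le> v \<and> 0 \<le> w \<and>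
        (1 - v - w) + v + w = 1"
      using vw by (simp add: scaleR_conv_of_real)
    then show ?thesis unfolding convex_hull_3 by blast
  qed
qed

lemma triangle_interior:
  assumes "cross t a > 0"
  shows "z \<in> interior (convex hull {0, t, a}) \<longleftrightarrow>
    0 < cross t z \<and> 0 < cross z a \<and> cross t z + cross z a < cross t a"
proof -
  have "\<not> collinear {0, t, a}"
    using assms by (auto simp: collinear_lemma scaleR_conv_of_real cross_simps)
  then have int: "z \<in> interior (convex hull {0, t, a}) \<longleftrightarrow>
    (\<exists>x y w. 0 < x \<and> 0 < y \<and> 0 < w \<and> x + y + w = 1 \<and> of_real y * t + of_real w * a = z)"
    by (simp add: interior_convex_hull_3_minimal scaleR_conv_of_real)
  show ?thesis
  proof
    assume "z \<in> interior (convex hull {0, t, a})"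
    then obtain u v w where *: "0 < u" "0 < v" "0 < w" "u + v + w = 1"
      "z = of_real v * t + of_real w * a"
      unfolding int by auto
    then have "cross t z = w * cross t a" "cross z a = v * cross t a" by (simp_all add: cross_simps)
    moreover have "(v + w) * cross t a < 1 * cross t a"
      by (rule mult_strict_right_mono) (use * assms in simp_all)
    ultimately show "0 < cross t z \<and> 0 < cross z a \<and> cross t z + cross z a < cross t a"
      using * assms by (simp add: algebra_simps)
  next
    assume *: "0 < cross t z \<and> 0 < cross z a \<and> cross t z + cross z a < cross t a"
    define v w where "v = cross z a / cross t a" and "w = cross t z / cross t a"
    have "z = of_real v * t + of_real w * a"
      using cross_decompose[of t a z] assms by (simp add: v_def w_def field_simps)
    moreover have "0 < v" "0 < w" "v + w < 1"
      using * assms by (simp_all add: v_def w_def add_divide_distrib[symmetric])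
    ultimately have "0 < 1 - v - w \<and> 0 < v \<and> 0 < w \<and> (1 - v - w) + v + w = 1 \<and>
        of_real v * t + of_real w * a = z"
      by simp
    then show "z \<in> interior (convex hull {0, t, a})"
      unfolding int by blast
  qed
qed

lemma triangle_side:
  assumes "cross t a > 0"
  shows "z \<in> open_segment 0 t \<longleftrightarrow> cross t z = 0 \<and> 0 < cross z a \<and> cross z a < cross t a"
proof
  assume "z \<in> open_segment 0 t"
  then obtain v where "0 < v" "v < 1" "z = of_real v * t"
    by (auto simp: in_segment scaleR_conv_of_real)
  then show "cross t z = 0 \<and> 0 < cross z a \<and> cross z a < cross t a"
    using assms by (simp add: cross_simps)
next
  assume *: "cross t z = 0 \<and> 0 < cross z a \<and> cross z a < cross t a"
  define v where "v = cross z a / cross t a"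
  have "z = of_real v * t"
    using cross_decompose[of t a z] assms * by (simp add: v_def field_simps)
  moreover have "0 < v" "v < 1" using * assms by (simp_all add: v_def)
  moreover have "t \<noteq> 0" using assms by (auto simp: cross_simps)
  ultimately show "z \<in> open_segment 0 t"
    by (auto simp: in_segment scaleR_conv_of_real)
qed

lemma unit_cell_pt: "pt s r \<in> unit_cell \<longleftrightarrow> 0 < s \<and> 0 < r \<and> s + r < 1"
proof -
  have "pt s r \<in> unit_cell \<longleftrightarrow> 0 < cross (pt 1 0) (pt s r) \<and> 0 < cross (pt s r) (pt 0 1) \<and>
      cross (pt 1 0) (pt s r) + cross (pt s r) (pt 0 1) < cross (pt 1 0) (pt 0 1)"
    unfolding unit_cell_def pt_const(1-3)[symmetric]
    by (rule triangle_interior) (simp add: cross_eq)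
  also have "\<dots> \<longleftrightarrow> 0 < s \<and> 0 < r \<and> s + r < 1"
  proof -
    define c where "c = sqrt 3 / 2"
    have "c > 0" by (simp add: c_def)
    moreover have "cross (pt 1 0) (pt s r) = r * c" "cross (pt s r) (pt 0 1) = s * c"
      "cross (pt 1 0) (pt 0 1) = 1 * c"
      unfolding cross_pt c_def by simp_all
    ultimately show ?thesis
      by (simp only: distrib_right[symmetric] zero_less_mult_iff mult_less_cancel_right) auto
  qed
  finally show ?thesis .
qed

lemma unit_cell_convex: "convex unit_cell" and unit_cell_open: "open unit_cell"
  and unit_cell_bounded: "bounded unit_cell"
  by (simp_all add: unit_cell_def bounded_interior finite_imp_bounded_convex_hull)

lemma place_eq: "place x w = fst x + snd x * w"
  by (simp add: place_def case_prod_unfold)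

lemma cell_iff: "z \<in> cell x \<longleftrightarrow> (\<exists>w\<in>unit_cell. z = place x w)"
  by (auto simp: cell_def)

lemma lattice_darts_iff: "x \<in> lattice_darts \<longleftrightarrow> fst x \<in> eisenstein \<and> snd x ^ 6 = 1"
  by (cases x) (simp add: lattice_darts_def)

lemma lface_next_eq: "lface_next x = (fst x + snd x, omega ^ 2 * snd x)"
  and lopp_eq: "lopp x = (fst x + snd x, - snd x)"
  and move_eq: "move g x = (fst g + snd g * fst x, snd g * snd x)"
  by (simp_all add: lface_next_def lopp_def move_def place_def case_prod_unfold)

lemma place_lface_next: "place (lface_next x) w = place x (1 + omega ^ 2 * w)"
  by (simp add: place_eq lface_next_eq algebra_simps)

lemma place_lopp: "place (lopp x) w = place x (1 - w)"
  by (simp add: place_eq lopp_eq algebra_simps)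

lemma place_move: "place (move g x) w = place g (place x w)"
  by (simp add: place_eq move_eq algebra_simps)

lemma unit_cell_turn: "1 + omega ^ 2 * w \<in> unit_cell \<longleftrightarrow> w \<in> unit_cell"
proof -
  obtain s r where w: "w = pt s r" by (rule pt_cases)
  have "1 + omega ^ 2 * w = pt (1 - s - r) s"
    unfolding omega_powers(1) w by (simp add: pt_arith pt_const)
  then show ?thesis unfolding w by (auto simp: unit_cell_pt)
qed

lemma lattice_darts_closed:
  assumes "x \<in> lattice_darts"
  shows "lface_next x \<in> lattice_darts" "lopp x \<in> lattice_darts"
proof -
  have "(omega ^ 2) ^ 6 = (omega ^ 6) ^ 2" by (simp flip: power_mult)
  then have "(omega ^ 2) ^ 6 = 1" by (simp add: omega_powers(5))
  then show "lface_next x \<in> lattice_darts" "lopp x \<in> lattice_darts"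
    using assms
    by (simp_all add: lattice_darts_iff lface_next_eq lopp_eq eisenstein_closed unit_eisenstein
        power_mult_distrib)
qed

lemma cell_lface_next: "cell (lface_next x) = cell x"
proof (rule set_eqI)
  fix z
  have "\<exists>v\<in>unit_cell. w = 1 + omega ^ 2 * v" if "w \<in> unit_cell" for w
  proof -
    have "omega \<noteq> 0" by (metis norm_omega norm_zero zero_neq_one)
    then have "w = 1 + omega ^ 2 * ((w - 1) / omega ^ 2)" by simp
    then show ?thesis using that unit_cell_turn by metis
  qed
  then show "z \<in> cell (lface_next x) \<longleftrightarrow> z \<in> cell x"
    unfolding cell_iff place_lface_next using unit_cell_turn by metis
qed

section \<open>Residues of the unfolded darts\<close>

text \<open>Carries an open condition from a point of an edge to a point of the open cell, where the
  assumptions on unfoldings can be applied.\<close>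

lemma unit_cell_near:
  assumes "open N" "of_real s \<in> N" "0 < s" "s < 1"
  obtains w where "w \<in> unit_cell" "w \<in> N"
proof -
  obtain e where e: "e > 0" "ball (of_real s) e \<subseteq> N" using assms(1,2) by (meson open_contains_ball)
  define r where "r = min (e / 2) ((1 - s) / 2)"
  have "r \<le> e / 2" "r \<le> (1 - s) / 2"
    unfolding r_def by (rule min.cobounded1, rule min.cobounded2)
  moreover have "0 < r" using e assms by (simp add: r_def)
  ultimately have "r < e" "r < 1 - s" by simp_all
  note r = \<open>0 < r\<close> this
  have "dist (of_real s) (pt s r) = r"
    using r(1) by (simp add: pt_def dist_norm norm_mult)
  then have "pt s r \<in> N" using e r by (intro subsetD[OF e(2)]) simp
  moreover have "pt s r \<in> unit_cell" using r assms by (simp add: unit_cell_pt)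
  ultimately show ?thesis using that by blast
qed

lemma cell_disjoint: "cell x \<inter> A = {} \<longleftrightarrow> (\<forall>w\<in>unit_cell. place x w \<notin> A)"
  by (auto simp: cell_def)

lemma continuous_place: "continuous_on S (place x)"
  unfolding place_eq[abs_def] by (intro continuous_intros)

lemma continuous_cross:
  assumes "continuous_on S f" "continuous_on S g" shows "continuous_on S (\<lambda>z. cross (f z) (g z))"
  unfolding cross_def using assms by (intro continuous_intros)

text \<open>Corners of facets are lattice points, so this keeps them out of the open cells; the next
  lemma does the same for the midpoints of edges.\<close>

lemma unit_cell_not_eisenstein:
  assumes "w \<in> unit_cell" "x \<in> lattice_darts" shows "place x w \<notin> eisenstein"
proof
  assume *: "place x w \<in> eisenstein"
  have "(place x w - fst x) / snd x \<in> eisenstein"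
    using * assms(2) by (intro eisenstein_divide_unit eisenstein_closed) (auto simp: lattice_darts_iff)
  moreover have "snd x \<noteq> 0" using assms(2) by (auto simp: lattice_darts_iff)
  ultimately have "w \<in> eisenstein" by (simp add: place_eq)
  then obtain a b where "w = eis a b" by (elim eisensteinE)
  then have "0 < a" "0 < b" "real_of_int (a + b) < real_of_int 1"
    using assms(1) by (simp_all add: eis_pt unit_cell_pt)
  then have "a + b < 1" by (simp only: of_int_less_iff)
  then show False using \<open>0 < a\<close> \<open>0 < b\<close> by linarith
qed

lemma midpoint_not_eisenstein:
  assumes "x \<in> lattice_darts" shows "place x (1/2) \<notin> eisenstein"
proof
  assume *: "place x (1/2) \<in> eisenstein"
  have "(place x (1/2) - fst x) / snd x \<in> eisenstein"
    using * assms by (intro eisenstein_divide_unit eisenstein_closed) (auto simp: lattice_darts_iff)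
  moreover have "snd x \<noteq> 0" using assms by (auto simp: lattice_darts_iff)
  ultimately have "1 / 2 \<in> eisenstein" by (simp add: place_eq)
  then obtain a b where "1 / 2 = eis a b" by (elim eisensteinE)
  then have "pt (1/2) 0 = eis a b" by (simp add: pt_def)
  then have "real_of_int (2 * a) = real_of_int 1" by (simp add: eis_pt)
  then have "2 * a = 1" by (simp only: of_int_eq_iff)
  then show False by presburger
qed

definition residue :: "ldart \<Rightarrow> complex" where
  "residue x = fst x / snd x"

locale scaled_straight_triangulation = straight_triangulation T M cox apex dev tip facet
  for T :: "'a cmap" and M :: "'b cmap" and cox apex dev tip facet +
  fixes k :: nat
  assumes k_pos: "k > 0"
    and cox_dvd: "\<And>m. m \<in> darts M \<Longrightarrow> k dvd fst (cox m) \<and> k dvd snd (cox m)"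
begin

definition closed_facet :: "'b \<Rightarrow> complex set" where
  "closed_facet m = convex hull {0, tip m, apex m}"

definition res_eq :: "complex \<Rightarrow> complex \<Rightarrow> bool" (infix "\<simeq>" 50) where
  "x \<simeq> y \<longleftrightarrow> x - y \<in> scaled_eisenstein k"

lemma res_eq_refl [simp]: "x \<simeq> x"
  by (simp add: res_eq_def scaled_eisenstein_0)

lemma res_eq_sym: "x \<simeq> y \<Longrightarrow> y \<simeq> x"
  using scaled_eisenstein_closed(3)[of "x - y" k "x - y"] by (simp add: res_eq_def)

lemma res_eq_trans: "x \<simeq> y \<Longrightarrow> y \<simeq> z \<Longrightarrow> x \<simeq> z"
  using scaled_eisenstein_closed(1)[of "x - y" k "y - z"] by (simp add: res_eq_def)

lemma tip_scaled: "m \<in> darts M \<Longrightarrow> tip m \<in> scaled_eisenstein k"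
  using cox_dvd[of m] eis_scaled_iff[of "int (fst (cox m))" "int (snd (cox m))" k]
  by (simp add: tip_def coxeter_vec_pt eis_pt)

lemma scaled_in_eisenstein: "z \<in> scaled_eisenstein k \<Longrightarrow> z \<in> eisenstein"
  by (auto simp: scaled_eisenstein_def intro: eisenstein_closed eisenstein_const)

text \<open>Up to a constant factor, the barycentric coordinates of \<open>z\<close> in the facet of \<open>m\<close>.  They vanish on
  the sides \<open>m\<close>, \<open>face_next M (face_next M m)\<close> and \<open>face_next M m\<close>, respectively.\<close>

definition bary :: "'b \<Rightarrow> complex \<Rightarrow> real" where
  "bary m z = cross (tip m) z"

definition bary' :: "'b \<Rightarrow> complex \<Rightarrow> real" where
  "bary' m z = cross z (apex m)"

definition bary'' :: "'b \<Rightarrow> complex \<Rightarrow> real" where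
  "bary'' m z = cross (tip m) (apex m) - bary m z - bary' m z"

lemmas bary_defs = bary_def bary'_def bary''_def

lemma cross_tip_apex: "m \<in> darts M \<Longrightarrow> 0 < cross (tip m) (apex m)"
  using apex_left by (simp add: cross_def)

lemma facet_iff: "m \<in> darts M \<Longrightarrow> z \<in> facet m \<longleftrightarrow> 0 < bary m z \<and> 0 < bary' m z \<and> 0 < bary'' m z"
  unfolding facet_def triangle_interior[OF cross_tip_apex] bary_defs by auto

lemma closed_facet_iff:
  "m \<in> darts M \<Longrightarrow> z \<in> closed_facet m \<longleftrightarrow> 0 \<le> bary m z \<and> 0 \<le> bary' m z \<and> 0 \<le> bary'' m z"
  unfolding closed_facet_def triangle_hull[OF cross_tip_apex] bary_defs by auto

lemma open_side_iff:
  "m \<in> darts M \<Longrightarrow> z \<in> open_segment 0 (tip m) \<longleftrightarrow> bary m z = 0 \<and> 0 < bary' m z \<and> 0 < bary'' m z"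
  unfolding triangle_side[OF cross_tip_apex] bary_defs by auto

lemma continuous_bary: "continuous_on S (bary m)" "continuous_on S (bary' m)" "continuous_on S (bary'' m)"
  unfolding bary_defs[abs_def] by (intro continuous_intros continuous_cross)+

lemma open_positive:
  assumes "continuous_on UNIV f" shows "open {z. 0 < (f (place x z) :: real)}"
proof -
  have "continuous_on UNIV (\<lambda>z. f (place x z))"
    by (rule continuous_on_compose2[OF assms continuous_place]) auto
  then show ?thesis by (intro open_Collect_less continuous_on_const)
qed

lemma closed_facet_closure: "m \<in> darts M \<Longrightarrow> closed_facet m = closure (facet m)"
proof -
  assume m: "m \<in> darts M"
  define g where "g = of_real (1/3) * tip m + of_real (1/3) * apex m"
  have "0 < bary m g" "0 < bary' m g" "0 < bary'' m g"
    using cross_tip_apex[OF m] by (simp_all only: g_def bary_defs cross_simps)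
  then have "facet m \<noteq> {}" using facet_iff[OF m] by blast
  then have "closure (facet m) = closure (closed_facet m)"
    unfolding facet_def closed_facet_def by (intro convex_closure_interior convex_convex_hull) auto
  moreover have "closed (closed_facet m)"
    unfolding closed_facet_def by (intro compact_imp_closed finite_imp_compact_convex_hull) auto
  ultimately show ?thesis by simp
qed

lemma open_facet: "open (facet m)"
  by (simp add: facet_def)

text \<open>\<open>no_overlap\<close> concerns open facets, whereas \<open>covering\<close> yields
  closed ones. A closed facet is the closure of its interior, and \<open>place x\<close> is an
  isometry, so a point can be moved inside while an open condition \<open>N\<close> is kept.\<close>

lemma facet_near:
  assumes "m \<in> darts M" "x \<in> lattice_darts" "place x w \<in> closed_facet m" "open N" "w \<in> N"
  obtains w' where "w' \<in> N" "place x w' \<in> facet m"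
proof -
  obtain e where e: "e > 0" "ball w e \<subseteq> N" using assms(4,5) by (meson open_contains_ball)
  obtain y where y: "y \<in> facet m" "dist y (place x w) < e"
    using assms(1,3) e(1) by (auto simp: closed_facet_closure closure_approachable)
  have u: "norm (snd x) = 1" using assms(2) by (auto simp: lattice_darts_iff unit_norm)
  then have "snd x \<noteq> 0" by auto
  define w' where "w' = (y - fst x) / snd x"
  have p: "place x w' = y" using \<open>snd x \<noteq> 0\<close> by (simp add: w'_def place_eq)
  have "place x w' - place x w = snd x * (w' - w)" by (simp add: place_eq algebra_simps)
  then have "dist (place x w') (place x w) = dist w' w"
    using u by (simp add: dist_norm norm_mult)
  then have "w' \<in> ball w e" using y p by (simp add: dist_commute)
  then show ?thesis using that[of w'] e y p by auto
qed

lemma face_next_M: "m \<in> darts M \<Longrightarrow> face_next M m \<in> darts M"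
  and opp_M: "m \<in> darts M \<Longrightarrow> opp M m \<in> darts M"
proof -
  have "nxt M permutes darts M" and o: "opp M permutes darts M"
    using plane by (simp_all add: plane_map_def)
  then have "inv (nxt M) permutes darts M" by (intro permutes_inv)
  then show "m \<in> darts M \<Longrightarrow> face_next M m \<in> darts M" "m \<in> darts M \<Longrightarrow> opp M m \<in> darts M"
    using o by (simp_all add: face_next_def permutes_in_image)
qed

text \<open>The inverse of the motion \<open>(tip m, u)\<close>. It shifts the residue by a unit
  multiple of \<open>tip m\<close> and permutes the barycentric coordinates cyclically, so that any
  side of a facet can be brought into the position from \<open>0\<close> to
  \<open>tip\<close>.\<close>

lemma turn_facet:
  assumes m: "m \<in> darts M" and x: "x \<in> lattice_darts" and meet: "cell x \<inter> facet m \<noteq> {}"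
  obtains y where "y \<in> lattice_darts" "dev (face_next M m) y = dev m x" "residue y \<simeq> residue x"
    "\<And>w. bary (face_next M m) (place y w) = bary'' m (place x w)"
    "\<And>w. bary' (face_next M m) (place y w) = bary m (place x w)"
    "\<And>w. bary'' (face_next M m) (place y w) = bary' m (place x w)"
proof -
  let ?m = "face_next M m" let ?t = "tip m" let ?a = "apex m"
  obtain u where u: "u ^ 6 = 1" and t: "place (?t, u) (tip ?m) = ?a" and a: "place (?t, u) (apex ?m) = 0"
    and dv: "\<And>y. y \<in> lattice_darts \<Longrightarrow> cell y \<inter> facet ?m \<noteq> {} \<Longrightarrow> dev m (move (?t, u) y) = dev ?m y"
    using facet_turn[OF m] by blast
  have u0: "u \<noteq> 0" and n: "norm u = 1" using u unit_norm by auto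
  define y where "y = ((fst x - ?t) / u, snd x / u)"
  have xe: "fst x \<in> eisenstein" "snd x ^ 6 = 1" using x by (simp_all add: lattice_darts_iff)
  have y: "y \<in> lattice_darts"
    unfolding y_def lattice_darts_iff fst_conv snd_conv
    using xe u tip_scaled[OF m, THEN scaled_in_eisenstein]
    by (auto simp: power_divide intro!: eisenstein_divide_unit eisenstein_closed)
  have mv: "move (?t, u) y = x" using u0 by (simp add: y_def move_eq)
  have tip': "tip ?m = (?a - ?t) / u" and apex': "apex ?m = (- ?t) / u"
    using t a u0 by (simp_all add: place_eq field_simps eq_neg_iff_add_eq_0 add.commute)
  have pl: "place y w = (place x w - ?t) / u" for w
    using u0 by (simp add: y_def place_eq field_simps)
  have 1: "bary ?m (place y w) = bary'' m (place x w)" for w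
    unfolding bary_defs tip' pl cross_rotate[OF n]
    using cross_swap[of "?a"] by (simp add: cross_simps)
  have 2: "bary' ?m (place y w) = bary m (place x w)" for w
    unfolding bary_defs apex' pl cross_rotate[OF n]
    using cross_swap[of "?t" "place x w"] by (simp add: cross_simps)
  have "cross (tip ?m) (apex ?m) = cross ?t ?a"
    unfolding tip' apex' cross_rotate[OF n] using cross_swap[of ?a ?t] by (simp add: cross_simps)
  then have 3: "bary'' ?m (place y w) = bary' m (place x w)" for w
    unfolding bary''_def[of ?m] 1 2 by (simp add: bary''_def)
  have "cell y \<inter> facet ?m \<noteq> {}"
  proof -
    obtain w where "w \<in> unit_cell" "place x w \<in> facet m" using meet by (auto simp: cell_disjoint)
    then have "place y w \<in> facet ?m"
      using 1 2 3 by (simp add: facet_iff[OF m] facet_iff[OF face_next_M[OF m]])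
    then show ?thesis using \<open>w \<in> unit_cell\<close> by (auto simp: cell_disjoint)
  qed
  then have "dev ?m y = dev m x" using dv[OF y] mv by simp
  moreover have "residue y \<simeq> residue x"
  proof -
    have "residue y = residue x - ?t / snd x"
    proof -
      have "snd x \<noteq> 0" using xe(2) by auto
      then show ?thesis using u0 by (simp add: residue_def y_def field_simps)
    qed
    then show ?thesis
      using scaled_eisenstein_divide_unit[OF tip_scaled[OF m] xe(2)] scaled_eisenstein_closed(3)
      by (simp add: res_eq_def)
  qed
  ultimately show ?thesis using that y 1 2 3 by blast
qed

lemma turn_facet_iff:
  assumes "m \<in> darts M"
    "\<And>w. bary (face_next M m) (place y w) = bary'' m (place x w)"
    "\<And>w. bary' (face_next M m) (place y w) = bary m (place x w)"
    "\<And>w. bary'' (face_next M m) (place y w) = bary' m (place x w)"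
  shows "place y w \<in> facet (face_next M m) \<longleftrightarrow> place x w \<in> facet m"
  using assms by (auto simp: facet_iff face_next_M)

lemma same_facet:
  assumes "m' \<in> orbit (face_next M) m" "m \<in> darts M" "x \<in> lattice_darts" "cell x \<inter> facet m \<noteq> {}"
  shows "m' \<in> darts M \<and> (\<exists>y\<in>lattice_darts. dev m' y = dev m x \<and> residue y \<simeq> residue x \<and>
    (\<forall>w. place y w \<in> facet m' \<longleftrightarrow> place x w \<in> facet m))"
  using assms(1)
proof (induction)
  case base
  obtain y where y: "y \<in> lattice_darts" "dev (face_next M m) y = dev m x" "residue y \<simeq> residue x"
    "\<And>w. bary (face_next M m) (place y w) = bary'' m (place x w)"
    "\<And>w. bary' (face_next M m) (place y w) = bary m (place x w)"
    "\<And>w. bary'' (face_next M m) (place y w) = bary' m (place x w)"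
    using turn_facet[OF assms(2-4)] by blast
  then show ?case using turn_facet_iff[OF assms(2) y(4-6)] face_next_M[OF assms(2)] by blast
next
  case (step m')
  then obtain x' where x': "m' \<in> darts M" "x' \<in> lattice_darts" "dev m' x' = dev m x"
    "residue x' \<simeq> residue x" "\<And>w. place x' w \<in> facet m' \<longleftrightarrow> place x w \<in> facet m"
    by blast
  have "cell x' \<inter> facet m' \<noteq> {}" using assms(4) x'(5) by (auto simp: cell_disjoint)
  then obtain y where y: "y \<in> lattice_darts" "dev (face_next M m') y = dev m' x'" "residue y \<simeq> residue x'"
    "\<And>w. bary (face_next M m') (place y w) = bary'' m' (place x' w)"
    "\<And>w. bary' (face_next M m') (place y w) = bary m' (place x' w)"
    "\<And>w. bary'' (face_next M m') (place y w) = bary' m' (place x' w)"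
    using turn_facet[OF x'(1,2)] by blast
  then show ?case
    using turn_facet_iff[OF x'(1) y(4-6)] face_next_M[OF x'(1)] x' res_eq_trans by metis
qed

text \<open>By \<open>no_overlap\<close> the dart \<open>m'\<close> bounds the same facet as
  \<open>m\<close>. Turning \<open>x\<close> into the frame of \<open>m'\<close> gives a second view
  from \<open>m'\<close> of the same point, and \<open>no_overlap\<close> for \<open>m'\<close> with
  itself identifies this view with \<open>x'\<close>.\<close>

lemma overlap_residue:
  assumes "m \<in> darts M" "m' \<in> darts M" "x \<in> lattice_darts" "x' \<in> lattice_darts" "w \<in> unit_cell"
    "place x w \<in> facet m" "place x' w \<in> facet m'" "dev m x = dev m' x'"
  shows "residue x' \<simeq> residue x"
proof -
  have o: "m' \<in> orbit (face_next M) m" using no_overlap[OF assms] by simp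
  have "cell x \<inter> facet m \<noteq> {}" using assms(5,6) by (auto simp: cell_disjoint)
  then obtain y where y: "y \<in> lattice_darts" "dev m' y = dev m x" "residue y \<simeq> residue x"
    "place y w \<in> facet m' \<longleftrightarrow> place x w \<in> facet m"
    using same_facet[OF o assms(1,3)] by blast
  have "x' = y"
    using no_overlap[OF assms(2,2) y(1) assms(4,5)] y assms by simp
  then show ?thesis using y by simp
qed

lemma cross_edge:
  assumes m: "m \<in> darts M" and x: "x \<in> lattice_darts" and w: "w \<in> unit_cell"
    and "place x w \<in> open_segment 0 (tip m)"
  obtains y where "y \<in> lattice_darts" "dev (opp M m) y = dev m x" "residue y \<simeq> residue x"
    "\<And>w. place y w = tip m - place x w"
proof -
  define y where "y = move (tip m, - 1) x"
  have xe: "fst x \<in> eisenstein" "snd x ^ 6 = 1" using x by (simp_all add: lattice_darts_iff)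
  show ?thesis
  proof
    show "y \<in> lattice_darts"
      using xe tip_scaled[OF m, THEN scaled_in_eisenstein]
      by (simp add: y_def lattice_darts_iff move_eq eisenstein_closed)
    show "dev (opp M m) y = dev m x"
      unfolding y_def by (rule glue_cross[OF m x]) (use assms in \<open>auto simp: cell_disjoint\<close>)
    show "place y w = tip m - place x w" for w
      by (simp add: y_def place_move place_eq[of "(tip m, - 1)"])
    have "residue y = residue x - tip m / snd x"
      by (simp add: y_def residue_def move_eq diff_divide_distrib)
    then show "residue y \<simeq> residue x"
      using scaled_eisenstein_divide_unit[OF tip_scaled[OF m] xe(2)] scaled_eisenstein_closed(3)
      by (simp add: res_eq_def)
  qed
qed

lemma tip_opp: "m \<in> darts M \<Longrightarrow> tip (opp M m) = tip m"
  by (simp add: tip_def cox_opp)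

lemma apex_eisenstein: assumes "m \<in> darts M" shows "apex m \<in> eisenstein"
proof -
  obtain u where "u ^ 6 = 1" "place (tip m, u) (tip (face_next M m)) = apex m"
    using facet_turn[OF assms] by blast
  then have "apex m = tip m + u * tip (face_next M m)" by (simp add: place_eq)
  then show ?thesis
    using tip_scaled[OF assms] tip_scaled[OF face_next_M[OF assms]] \<open>u ^ 6 = 1\<close>
    by (simp add: eisenstein_closed scaled_in_eisenstein unit_eisenstein)
qed

text \<open>Two vanishing barycentric coordinates leave only a corner of the facet, and all three
  corners are Eisenstein integers.\<close>

lemma bary_corner:
  assumes "m \<in> darts M" "z \<notin> eisenstein"
  shows "\<not> (bary m z = 0 \<and> bary' m z = 0)" "\<not> (bary m z = 0 \<and> bary'' m z = 0)"
    "\<not> (bary' m z = 0 \<and> bary'' m z = 0)"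
proof -
  let ?d = "cross (tip m) (apex m)"
  have d: "?d > 0" by (rule cross_tip_apex[OF assms(1)])
  have te: "tip m \<in> eisenstein" "apex m \<in> eisenstein" "0 \<in> eisenstein"
    using tip_scaled[OF assms(1)] scaled_in_eisenstein apex_eisenstein[OF assms(1)] eisenstein_const by auto
  have z: "z = of_real (bary' m z / ?d) * tip m + of_real (bary m z / ?d) * apex m"
    using cross_decompose[of "tip m" "apex m" z] d by (simp add: bary_def bary'_def field_simps)
  show "\<not> (bary m z = 0 \<and> bary' m z = 0)"
    using z te assms(2) by (metis add_0 div_0 mult_zero_left of_real_0)
  show "\<not> (bary m z = 0 \<and> bary'' m z = 0)"
  proof
    assume *: "bary m z = 0 \<and> bary'' m z = 0"
    then have "bary' m z / ?d = 1" using d by (simp add: bary''_def)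
    then show False using z te assms(2) * by (metis add_0_right div_0 mult_zero_left of_real_0 of_real_1 mult_1)
  qed
  show "\<not> (bary' m z = 0 \<and> bary'' m z = 0)"
  proof
    assume *: "bary' m z = 0 \<and> bary'' m z = 0"
    then have "bary m z / ?d = 1" using d by (simp add: bary''_def)
    then show False using z te assms(2) * by (metis add_0 div_0 mult_zero_left of_real_0 of_real_1 mult_1)
  qed
qed

text \<open>A boundary point that is not a corner has exactly one vanishing barycentric coordinate,
  and at most two turns make it the one that belongs to the side \<open>m'\<close>.\<close>

lemma to_open_side:
  assumes m: "m \<in> darts M" and x: "x \<in> lattice_darts" and meet: "cell x \<inter> facet m \<noteq> {}"
    and z: "place x w \<in> closed_facet m" "place x w \<notin> facet m" "place x w \<notin> eisenstein"
  obtains m' y where "m' \<in> darts M" "y \<in> lattice_darts" "dev m' y = dev m x" "residue y \<simeq> residue x"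
    "cell y \<inter> facet m' \<noteq> {}" "place y w \<in> open_segment 0 (tip m')"
proof -
  have nn: "0 \<le> bary m (place x w)" "0 \<le> bary' m (place x w)" "0 \<le> bary'' m (place x w)"
    using z(1) by (simp_all add: closed_facet_iff[OF m])
  note nc = bary_corner[OF m z(3)]
  have "\<not> (0 < bary m (place x w) \<and> 0 < bary' m (place x w) \<and> 0 < bary'' m (place x w))"
    using z(2) facet_iff[OF m] by blast
  then consider "bary m (place x w) = 0" "0 < bary' m (place x w)" "0 < bary'' m (place x w)"
    | "bary'' m (place x w) = 0" "0 < bary m (place x w)" "0 < bary' m (place x w)"
    | "bary' m (place x w) = 0" "0 < bary'' m (place x w)" "0 < bary m (place x w)"
    using nn nc by linarith
  then show ?thesis
  proof cases
    case 1
    then have "place x w \<in> open_segment 0 (tip m)" by (simp add: open_side_iff[OF m])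
    then show ?thesis using that[OF m x refl res_eq_refl meet] by simp
  next
    case 2
    obtain y where y: "y \<in> lattice_darts" "dev (face_next M m) y = dev m x" "residue y \<simeq> residue x"
      "\<And>w. bary (face_next M m) (place y w) = bary'' m (place x w)"
      "\<And>w. bary' (face_next M m) (place y w) = bary m (place x w)"
      "\<And>w. bary'' (face_next M m) (place y w) = bary' m (place x w)"
      using turn_facet[OF m x meet] by blast
    have "cell y \<inter> facet (face_next M m) \<noteq> {}"
      using meet turn_facet_iff[OF m y(4-6)] by (auto simp: cell_disjoint)
    moreover have "place y w \<in> open_segment 0 (tip (face_next M m))"
      using 2 y(4-6) by (simp add: open_side_iff[OF face_next_M[OF m]])
    ultimately show ?thesis using that[OF face_next_M[OF m] y(1-3)] by simp
  next
    case 3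
    let ?m = "face_next M m"
    have m1: "?m \<in> darts M" by (rule face_next_M[OF m])
    obtain x1 where y: "x1 \<in> lattice_darts" "dev (face_next M m) x1 = dev m x" "residue x1 \<simeq> residue x"
      "\<And>w. bary (face_next M m) (place x1 w) = bary'' m (place x w)"
      "\<And>w. bary' (face_next M m) (place x1 w) = bary m (place x w)"
      "\<And>w. bary'' (face_next M m) (place x1 w) = bary' m (place x w)"
      using turn_facet[OF m x meet] by blast
    have meet1: "cell x1 \<inter> facet ?m \<noteq> {}"
      using meet turn_facet_iff[OF m y(4-6)] by (auto simp: cell_disjoint)
    obtain x2 where y2: "x2 \<in> lattice_darts" "dev (face_next M ?m) x2 = dev ?m x1" "residue x2 \<simeq> residue x1"
      "\<And>w. bary (face_next M ?m) (place x2 w) = bary'' ?m (place x1 w)"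
      "\<And>w. bary' (face_next M ?m) (place x2 w) = bary ?m (place x1 w)"
      "\<And>w. bary'' (face_next M ?m) (place x2 w) = bary' ?m (place x1 w)"
      using turn_facet[OF m1 y(1) meet1] by blast
    have "cell x2 \<inter> facet (face_next M ?m) \<noteq> {}"
      using meet1 turn_facet_iff[OF m1 y2(4-6)] by (auto simp: cell_disjoint)
    moreover have "place x2 w \<in> open_segment 0 (tip (face_next M ?m))"
      using 3 y(4-6) y2(4-6) by (simp add: open_side_iff[OF face_next_M[OF m1]])
    moreover have "residue x2 \<simeq> residue x" using y(3) y2(3) res_eq_trans by blast
    ultimately show ?thesis using that[OF face_next_M[OF m1] y2(1)] y(2) y2(2) by simp
  qed
qed

section \<open>Independence of the residue from the facet\<close>

definition sees :: "'a \<Rightarrow> complex \<Rightarrow> 'b \<Rightarrow> ldart \<Rightarrow> bool" where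
  "sees d w m x \<longleftrightarrow> m \<in> darts M \<and> x \<in> lattice_darts \<and> dev m x = d \<and> place x w \<in> closed_facet m"

lemma sees_exists: "d \<in> darts T \<Longrightarrow> w \<in> unit_cell \<Longrightarrow> \<exists>m x. sees d w m x"
  using covering[of d w] unfolding sees_def closed_facet_def by blast

lemma sees_meets:
  assumes "sees d w m x" "w \<in> unit_cell"
  shows "cell x \<inter> facet m \<noteq> {}"
proof -
  obtain w' where "w' \<in> unit_cell" "place x w' \<in> facet m"
    using facet_near[OF _ _ _ unit_cell_open assms(2)] assms(1) unfolding sees_def by blast
  then show ?thesis by (auto simp: cell_disjoint)
qed

text \<open>Inside an open facet that facet alone decides. On a side, the facets of \<open>n\<close>
  and \<open>opp M n\<close> together fill a neighbourhood, and crossing the side preserves the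
  residue. Any other view of a nearby point is compared with one of these after a small shift into
  the open facets.\<close>

lemma local_residue:
  assumes "w \<in> unit_cell" "sees d w m x"
  obtains N where "open N" "w \<in> N" "N \<subseteq> unit_cell"
    "\<forall>w'\<in>N. \<forall>m' x'. sees d w' m' x' \<longrightarrow> residue x' \<simeq> residue x"
proof (cases "place x w \<in> facet m")
  case True
  have mx: "m \<in> darts M" "x \<in> lattice_darts" "dev m x = d" using assms(2) by (simp_all add: sees_def)
  define N where "N = place x -` facet m \<inter> unit_cell"
  have "open N" unfolding N_def
    by (intro open_Int unit_cell_open open_vimage open_facet continuous_place)
  moreover have "residue x' \<simeq> residue x" if w': "w' \<in> N" and s': "sees d w' m' x'" for w' m' x'
  proof -
    have m': "m' \<in> darts M" "x' \<in> lattice_darts" "dev m' x' = d" "place x' w' \<in> closed_facet m'"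
      using s' by (simp_all add: sees_def)
    obtain v where "v \<in> N" "place x' v \<in> facet m'"
      using facet_near[OF m'(1,2,4) \<open>open N\<close> w'] by blast
    then show ?thesis
      using overlap_residue[OF mx(1) m'(1) mx(2) m'(2), of v] mx(3) m'(3) by (simp add: N_def)
  qed
  moreover have "w \<in> N" "N \<subseteq> unit_cell" using assms(1) True by (auto simp: N_def)
  ultimately show ?thesis by (intro that[of N]) blast+
next
  case False
  have mx: "m \<in> darts M" "x \<in> lattice_darts" "dev m x = d" "place x w \<in> closed_facet m"
    using assms(2) by (simp_all add: sees_def)
  obtain n y where n: "n \<in> darts M" "y \<in> lattice_darts" "dev n y = dev m x" "residue y \<simeq> residue x"
    "place y w \<in> open_segment 0 (tip n)"
    using to_open_side[OF mx(1,2) sees_meets[OF assms(2,1)] mx(4) False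
        unit_cell_not_eisenstein[OF assms(1) mx(2)]] by blast
  obtain z where z: "z \<in> lattice_darts" "dev (opp M n) z = dev n y" "residue z \<simeq> residue y"
    "\<And>w. place z w = tip n - place y w"
    using cross_edge[OF n(1,2) assms(1) n(5)] by blast
  let ?n = "opp M n"
  have n': "?n \<in> darts M" by (rule opp_M[OF n(1)])
  have opp_bary: "bary ?n (place z v) = - bary n (place y v)" for v
    by (simp add: bary_def z(4) tip_opp[OF n(1)] cross_simps)
  \<comment> \<open>The two functions \<open>bary n\<close> and \<open>bary ?n\<close> are opposite,
    so each point of \<open>N\<close> off the line of the side lies in one of the two open
    facets.\<close>
  define N where "N = unit_cell \<inter> {v. 0 < bary' n (place y v)} \<inter> {v. 0 < bary'' n (place y v)} \<inter>
    {v. 0 < bary' ?n (place z v)} \<inter> {v. 0 < bary'' ?n (place z v)}"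
  have "open N" unfolding N_def
    by (intro open_Int unit_cell_open open_positive continuous_bary)
  have side: "place z w \<in> open_segment 0 (tip ?n)"
  proof -
    obtain u where "0 < u" "u < 1" "place y w = u *\<^sub>R tip n" "tip n \<noteq> 0"
      using n(5) by (auto simp: in_segment)
    then have "0 < 1 - u" "1 - u < 1" "place z w = (1 - u) *\<^sub>R tip n" "tip n \<noteq> 0"
      by (simp_all add: z(4) algebra_simps)
    then show ?thesis unfolding tip_opp[OF n(1)] in_segment by auto
  qed
  have "w \<in> N"
    using assms(1) n(5) side by (simp add: N_def open_side_iff[OF n(1)] open_side_iff[OF n'])
  moreover have "residue x' \<simeq> residue x" if w': "w' \<in> N" and s': "sees d w' m' x'" for w' m' x'
  proof -
    have m': "m' \<in> darts M" "x' \<in> lattice_darts" "dev m' x' = d" "place x' w' \<in> closed_facet m'"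
      using s' by (simp_all add: sees_def)
    define V where "V = N \<inter> place x' -` facet m'"
    have "open V" unfolding V_def
      by (intro open_Int \<open>open N\<close> open_vimage open_facet continuous_place)
    obtain v where v: "v \<in> V"
      using facet_near[OF m'(1,2,4) \<open>open N\<close> w'] by (auto simp: V_def)
    have "\<exists>v\<in>V. bary n (place y v) \<noteq> 0"
    proof (cases "bary n (place y v) = 0")
      case True
      have "tip n \<noteq> 0" using cross_tip_apex[OF n(1)] by (auto simp: cross_simps)
      have sy: "norm (snd y) = 1" using n(2) by (simp add: lattice_darts_iff unit_norm)
      obtain e where e: "e > 0" "ball v e \<subseteq> V" using \<open>open V\<close> v by (meson open_contains_ball)
      \<comment> \<open>The unit normal of the side, divided by \<open>snd y\<close> to express it
        in the coordinates of the cell: half the radius of the ball leaves the line without leaving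
        \<open>V\<close>.\<close>
      define c where "c = of_real (e / 2) * (\<i> * sgn (tip n) / snd y)"
      have "norm c = e / 2"
        using e(1) sy \<open>tip n \<noteq> 0\<close> by (simp add: c_def norm_mult norm_divide norm_sgn)
      then have "v + c \<in> V" using e by (intro subsetD[OF e(2)]) (simp add: dist_norm)
      moreover have "place y (v + c) = place y v + of_real (e / 2) * (\<i> * sgn (tip n))"
        using sy by (auto simp: place_eq c_def distrib_left)
      moreover have "cross (tip n) (\<i> * sgn (tip n)) = norm (tip n)"
      proof -
        have "\<i> * sgn (tip n) = of_real (1 / norm (tip n)) * (\<i> * tip n)"
          by (simp add: sgn_eq)
        moreover have "cross (tip n) (\<i> * tip n) = (norm (tip n))\<^sup>2"
          unfolding cross_eq cmod_power2 by (simp add: power2_eq_square)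
        ultimately show ?thesis using \<open>tip n \<noteq> 0\<close> by (simp only: cross_simps) (simp add: power2_eq_square)
      qed
      ultimately have "bary n (place y (v + c)) = bary n (place y v) + e / 2 * norm (tip n)"
        by (simp only: bary_def cross_simps(1,11))
      moreover have "e / 2 * norm (tip n) > 0" using e(1) \<open>tip n \<noteq> 0\<close> by simp
      ultimately have "bary n (place y (v + c)) \<noteq> 0" using True by linarith
      then show ?thesis using \<open>v + c \<in> V\<close> by blast
    qed (use v in blast)
    then obtain v where v: "v \<in> V" "bary n (place y v) \<noteq> 0" by blast
    have v': "place x' v \<in> facet m'" "v \<in> unit_cell" "0 < bary' n (place y v)" "0 < bary'' n (place y v)"
      "0 < bary' ?n (place z v)" "0 < bary'' ?n (place z v)"
      using v(1) by (simp_all add: V_def N_def)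
    consider "place y v \<in> facet n" | "place z v \<in> facet ?n"
      using v(2) v' opp_bary[of v] facet_iff[OF n(1)] facet_iff[OF n'] by force
    then show ?thesis
    proof cases
      case 1
      then have "residue x' \<simeq> residue y"
        using overlap_residue[OF n(1) m'(1) n(2) m'(2) v'(2)] v'(1) m'(3) n(3) mx(3) by simp
      then show ?thesis using n(4) res_eq_trans by blast
    next
      case 2
      then have "residue x' \<simeq> residue z"
        using overlap_residue[OF n' m'(1) z(1) m'(2) v'(2)] v'(1) m'(3) n(3) mx(3) z(2) by simp
      then show ?thesis using n(4) z(3) res_eq_trans by blast
    qed
  qed
  moreover have "N \<subseteq> unit_cell" by (auto simp: N_def)
  ultimately show ?thesis using \<open>open N\<close> by (intro that[of N]) blast+
qed

text \<open>The residue class is locally constant on the cell, and the cell is connected.\<close>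

lemma residue_unique:
  assumes d: "d \<in> darts T" and "w \<in> unit_cell" "w' \<in> unit_cell" "sees d w m x" "sees d w' m' x'"
  shows "residue x' \<simeq> residue x"
proof -
  \<comment> \<open>All representatives are collected, so that congruence of residues becomes
    equality of values.\<close>
  define f where "f v = {r. \<exists>m x. sees d v m x \<and> residue x \<simeq> r}" for v
  have "f w = f w'"
  proof (rule connected_local_const[where A = unit_cell and f = f])
    show "connected unit_cell" by (rule convex_connected[OF unit_cell_convex])
    show "\<forall>a\<in>unit_cell. \<forall>\<^sub>F b in at a within unit_cell. f a = f b"
    proof
      fix v assume v: "v \<in> unit_cell"
      obtain n y where n: "sees d v n y" using sees_exists[OF d v] by blast
      obtain N where N: "open N" "v \<in> N" "N \<subseteq> unit_cell"
        "\<forall>w'\<in>N. \<forall>m' x'. sees d w' m' x' \<longrightarrow> residue x' \<simeq> residue y"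
        by (rule local_residue[OF v n])
      have "f b = {r. residue y \<simeq> r}" if "b \<in> N" for b
      proof -
        have "b \<in> unit_cell" using that N(3) by blast
        then show ?thesis
          unfolding f_def using N(4) that sees_exists[OF d, of b] res_eq_trans res_eq_sym by blast
      qed
      then have "f v = f b" if "b \<in> N" for b using that N(2) by blast
      then show "\<forall>\<^sub>F b in at v within unit_cell. f v = f b"
        using N(1,2) unfolding eventually_at_topological by blast
    qed
  qed (use assms in auto)
  moreover have "residue x' \<in> f w'" using assms(5) res_eq_refl unfolding f_def by blast
  ultimately have "residue x' \<in> f w" by simp
  then have "\<exists>n y. sees d w n y \<and> residue y \<simeq> residue x'" by (simp only: f_def mem_Collect_eq)
  then obtain n y where y: "sees d w n y" "residue y \<simeq> residue x'" by blast
  obtain N where "open N" "w \<in> N" "N \<subseteq> unit_cell"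
    and N: "\<forall>w'\<in>N. \<forall>m' x'. sees d w' m' x' \<longrightarrow> residue x' \<simeq> residue x"
    by (rule local_residue[OF assms(2,4)])
  have "residue y \<simeq> residue x" using N \<open>w \<in> N\<close> y(1) by blast
  then show ?thesis using y(2) res_eq_trans res_eq_sym by blast
qed

lemma residue_well_defined:
  assumes "m \<in> darts M" "m' \<in> darts M" "x \<in> lattice_darts" "x' \<in> lattice_darts"
    "cell x \<inter> facet m \<noteq> {}" "cell x' \<inter> facet m' \<noteq> {}" "dev m x = dev m' x'"
  shows "residue x' \<simeq> residue x"
proof -
  have sub: "facet m \<subseteq> closed_facet m" for m
    by (simp add: facet_def closed_facet_def interior_subset)
  obtain w w' where w: "w \<in> unit_cell" "place x w \<in> facet m" "w' \<in> unit_cell" "place x' w' \<in> facet m'"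
    using assms(5,6) by (auto simp: cell_disjoint)
  show ?thesis
  proof (rule residue_unique[OF _ w(1,3)])
    show "dev m x \<in> darts T" by (rule dev_darts[OF assms(1,3,5)])
    show "sees (dev m x) w m x" "sees (dev m x) w' m' x'"
      using assms w sub by (auto simp: sees_def)
  qed
qed

end

lemma dist_place: "x \<in> lattice_darts \<Longrightarrow> dist (place x v) (place x w) = dist v w"
proof -
  assume "x \<in> lattice_darts"
  then have "norm (snd x) = 1" by (simp add: lattice_darts_iff unit_norm)
  moreover have "place x v - place x w = snd x * (v - w)" by (simp add: place_eq algebra_simps)
  ultimately show ?thesis by (simp add: dist_norm norm_mult)
qed

lemma finite_units: "finite {u :: complex. u ^ 6 = 1}"
  by (rule finite_subset[of _ "(\<lambda>j. omega ^ j) ` {..<6}"]) (use unit_eq_omega_power in auto)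

lemma residue_lface_next: "x \<in> lattice_darts \<Longrightarrow> residue (lface_next x) = - omega * (residue x + 1)"
proof -
  assume x: "x \<in> lattice_darts"
  then have "snd x \<noteq> 0" by (auto simp: lattice_darts_iff)
  then have "residue (lface_next x) = (residue x + 1) / omega ^ 2"
    by (simp add: residue_def lface_next_eq add_divide_distrib)
  moreover have "omega ^ 2 * (- omega) = 1"
    using omega_powers(2) by (simp add: power3_eq_cube power2_eq_square)
  then have "1 / omega ^ 2 = - omega" by (metis div_by_0 nonzero_mult_div_cancel_left zero_neq_one mult_zero_left)
  ultimately show ?thesis by (metis mult.commute mult.right_neutral times_divide_eq_right)
qed

lemma residue_lopp: "x \<in> lattice_darts \<Longrightarrow> residue (lopp x) = - (residue x + 1)"
  by (auto simp: residue_def lopp_eq lattice_darts_iff add_divide_distrib)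

lemma residue_eisenstein: "x \<in> lattice_darts \<Longrightarrow> residue x \<in> eisenstein"
  by (simp add: residue_def lattice_darts_iff eisenstein_divide_unit)

section \<open>Residues across an edge of the dual\<close>

context scaled_straight_triangulation
begin

definition over :: "'a \<Rightarrow> 'b \<Rightarrow> ldart \<Rightarrow> bool" where
  "over d m x \<longleftrightarrow> m \<in> darts M \<and> x \<in> lattice_darts \<and> cell x \<inter> facet m \<noteq> {} \<and> dev m x = d"

lemma over_unique: "over d m x \<Longrightarrow> over d m' x' \<Longrightarrow> residue x' \<simeq> residue x"
  by (rule residue_well_defined[of m m' x x']) (simp_all add: over_def)

lemma sees_over: "sees d w m x \<Longrightarrow> w \<in> unit_cell \<Longrightarrow> over d m x"
  using sees_meets[of d w m x] by (auto simp: over_def sees_def)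

lemma over_face_next: assumes "over d m x" shows "over (face_next T d) m (lface_next x)"
proof -
  have o: "m \<in> darts M" "x \<in> lattice_darts" "cell x \<inter> facet m \<noteq> {}" "dev m x = d"
    using assms by (simp_all add: over_def)
  then show ?thesis
    using lattice_darts_closed(1)[OF o(2)] dev_face[OF o(1-3)] by (simp add: over_def cell_lface_next)
qed

text \<open>\<open>covering\<close> concerns open cells, so the midpoint of an edge is reached as a
  limit. Only finitely many pairs \<open>(m, x)\<close> see points of the cell, hence one pair sees
  points arbitrarily close to the midpoint, and its closed facet contains the limit.\<close>

lemma over_midpoint:
  assumes d: "d \<in> darts T"
  shows "\<exists>m x. over d m x \<and> place x (1/2) \<in> closed_facet m"
proof -
  have "\<exists>w m x. w \<in> unit_cell \<and> dist w (1/2) < 1 / real (Suc n) \<and> sees d w m x" for n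
  proof -
    obtain w where "w \<in> unit_cell" "w \<in> ball (1/2) (1 / real (Suc n))"
      by (rule unit_cell_near[of "ball (1/2) (1 / real (Suc n))" "1/2"]) auto
    then show ?thesis using sees_exists[OF d] by (metis dist_commute mem_ball)
  qed
  then obtain w m x where w: "\<And>n. w n \<in> unit_cell" "\<And>n. dist (w n) (1/2) < 1 / real (Suc n)"
    "\<And>n. sees d (w n) (m n) (x n)"
    by metis
  have "finite (range (\<lambda>n. (m n, x n)))"
  proof -
    have fM: "finite (darts M)" using plane by (simp add: plane_map_def)
    have "bounded (\<Union>m\<in>darts M. closed_facet m)"
      using fM by (auto simp: closed_facet_def intro!: finite_imp_bounded_convex_hull)
    then obtain B where B: "\<And>m z. m \<in> darts M \<Longrightarrow> z \<in> closed_facet m \<Longrightarrow> norm z \<le> B"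
      unfolding bounded_iff by blast
    obtain C where C: "\<And>z. z \<in> unit_cell \<Longrightarrow> norm z \<le> C"
      using unit_cell_bounded unfolding bounded_iff by blast
    \<comment> \<open>The origin of \<open>x n\<close> differs from a point of a facet by a vector
      as long as a point of the cell, hence the radius \<open>B + C\<close>.\<close>
    have "(m n, x n) \<in> darts M \<times> ({p \<in> eisenstein. norm p \<le> B + C} \<times> {u. u ^ 6 = 1})" for n
    proof -
      have s: "m n \<in> darts M" "x n \<in> lattice_darts" "place (x n) (w n) \<in> closed_facet (m n)"
        using w(3)[of n] by (simp_all add: sees_def)
      then have u: "norm (snd (x n)) = 1" by (simp add: lattice_darts_iff unit_norm)
      have "norm (fst (x n)) \<le> norm (place (x n) (w n)) + norm (snd (x n) * w n)"
        unfolding place_eq by (metis add_diff_cancel_right' norm_triangle_ineq4)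
      also have "\<dots> \<le> B + C" using B[OF s(1,3)] C[OF w(1)] u by (simp add: norm_mult add_mono)
      finally show ?thesis using s by (cases "x n") (simp add: lattice_darts_iff)
    qed
    then have "range (\<lambda>n. (m n, x n)) \<subseteq> darts M \<times> ({p \<in> eisenstein. norm p \<le> B + C} \<times> {u. u ^ 6 = 1})"
      by blast
    then show ?thesis
      by (rule finite_subset) (intro finite_cartesian_product fM finite_eisenstein_bounded finite_units)
  qed
  then obtain n0 where n0: "infinite {n. (m n, x n) = (m n0, x n0)}"
    using pigeonhole_infinite[of "UNIV :: nat set" "\<lambda>n. (m n, x n)"] by auto
  let ?m = "m n0" let ?x = "x n0"
  have s: "sees d (w n0) ?m ?x" by (rule w(3))
  then have x: "?x \<in> lattice_darts" by (simp add: sees_def)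
  have "place ?x (1/2) \<in> closed_facet ?m"
  proof (rule ccontr)
    assume "place ?x (1/2) \<notin> closed_facet ?m"
    moreover have "closed (closed_facet ?m)"
      unfolding closed_facet_def by (intro compact_imp_closed finite_imp_compact_convex_hull) auto
    ultimately obtain e where e: "e > 0" "ball (place ?x (1/2)) e \<subseteq> - closed_facet ?m"
      by (metis ComplI open_Compl open_contains_ball)
    obtain N where N: "1 / real (Suc N) < e" using e(1) nat_approx_posE by blast
    obtain n where n: "n > N" "(m n, x n) = (?m, ?x)"
      using n0 unfolding infinite_nat_iff_unbounded by blast
    have "dist (w n) (1/2) < 1 / real (Suc n)" by (rule w(2))
    also have "\<dots> < 1 / real (Suc N)" using n(1) by (simp add: frac_less2)
    finally have "dist (place ?x (w n)) (place ?x (1/2)) < e" using N dist_place[OF x] by simp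
    then have "place ?x (w n) \<notin> closed_facet ?m" using e(2) by (auto simp: dist_commute)
    then show False using w(3)[of n] n(2) by (simp add: sees_def)
  qed
  then show ?thesis using sees_over[OF s w(1)] by blast
qed

text \<open>The parameter \<open>s\<close> is kept free because an edge that crosses a facet side at
  its own midpoint enters the open facet only beside the midpoint.\<close>

lemma over_opp_inner:
  assumes "over d m x" "place x (of_real s) \<in> facet m" "0 < s" "s < 1"
  shows "over (opp T d) m (lopp x)"
proof -
  have o: "m \<in> darts M" "x \<in> lattice_darts" "cell x \<inter> facet m \<noteq> {}" "dev m x = d"
    using assms by (simp_all add: over_def)
  have "snd x \<noteq> 0" using o(2) by (auto simp: lattice_darts_iff)
  then have "place x (of_real s) \<in> side x"
    unfolding side_def in_segment
    by (auto simp: place_eq scaleR_conv_of_real algebra_simps intro!: exI[of _ s] assms(3,4))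
  then have "dev m (lopp x) = opp T d" using dev_opp[OF o(1,2)] assms(2) o(4) by blast
  moreover have "cell (lopp x) \<inter> facet m \<noteq> {}"
  proof -
    have "place (lopp x) (of_real (1 - s)) \<in> facet m"
      using assms(2) by (simp add: place_lopp)
    moreover have "open (place (lopp x) -` facet m)"
      by (intro open_vimage open_facet continuous_place)
    ultimately obtain w where "w \<in> unit_cell" "w \<in> place (lopp x) -` facet m"
      using unit_cell_near[of "place (lopp x) -` facet m" "1 - s"] assms(3,4) by auto
    then show ?thesis by (auto simp: cell_disjoint)
  qed
  ultimately show ?thesis using o lattice_darts_closed(2) by (simp add: over_def)
qed

lemma over_opp_crossing:
  assumes "over d m x" "place x (1/2) \<in> open_segment 0 (tip m)" "cross (tip m) (snd x) \<noteq> 0"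
  shows "over (opp T d) m (lopp x)"
proof -
  have m: "m \<in> darts M" using assms(1) by (simp add: over_def)
  define c where "c = cross (tip m) (snd x)"
  define N where "N = {w. 0 < bary' m (place x w)} \<inter> {w. 0 < bary'' m (place x w)}"
  have "open N" unfolding N_def by (intro open_Int open_positive continuous_bary)
  moreover have "1/2 \<in> N" using assms(2) by (simp add: N_def open_side_iff[OF m])
  ultimately obtain e where e: "e > 0" "ball (1/2) e \<subseteq> N" by (meson open_contains_ball)
  define r where "r = min (e / 2) (1 / 4)"
  have r: "0 < r" "r < e" "r < 1/2"
    using e(1) min.cobounded1[of "e/2" "1/4"] min.cobounded2[of "e/2" "1/4"] by (simp_all add: r_def)
  \<comment> \<open>The sign of \<open>c\<close> tells in which direction along the edge
    \<open>bary m\<close> becomes positive.\<close>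
  define s where "s = 1 / 2 + sgn c * r"
  have sg: "sgn c * c > 0" "\<bar>sgn c * r\<bar> = r"
    using assms(3) r by (simp_all add: c_def sgn_if abs_mult)
  have s: "0 < s" "s < 1" using sg(2) r unfolding s_def by linarith+
  have "of_real s - 1 / 2 = (of_real (sgn c * r) :: complex)" by (simp add: s_def)
  then have "dist (1/2 :: complex) (of_real s) = r"
    using sg(2) by (metis dist_commute dist_norm norm_of_real)
  then have "of_real s \<in> N" using e(2) r by auto
  moreover have "bary m (place x (of_real s)) = sgn c * c * r"
  proof -
    have "place x (of_real s) = place x (1/2) + of_real (sgn c * r) * snd x"
      by (simp add: place_eq s_def algebra_simps)
    moreover have "bary m (place x (1/2)) = 0" using assms(2) by (simp add: open_side_iff[OF m])
    ultimately show ?thesis by (simp only: bary_def cross_simps(1,11) c_def) simp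
  qed
  ultimately have "place x (of_real s) \<in> facet m"
    using sg r by (simp add: facet_iff[OF m] N_def)
  then show ?thesis by (rule over_opp_inner[OF assms(1) _ s])
qed

text \<open>A lattice edge along a side of a facet is horizontal in the unfolding of that facet, since the
  side has Coxeter coordinates with \<open>a > 0\<close> and \<open>b \<ge> 0\<close>.\<close>

lemma over_opp_along:
  assumes "over d m x" "place x (1/2) \<in> open_segment 0 (tip m)" "cross (tip m) (snd x) = 0"
  shows "\<exists>y. over (opp T d) (opp M m) y \<and> residue y \<simeq> - (residue x + 1)"
proof -
  have o: "m \<in> darts M" "x \<in> lattice_darts" "cell x \<inter> facet m \<noteq> {}" "dev m x = d"
    using assms by (simp_all add: over_def)
  obtain a b where cm: "cox m = (a, b)" by fastforce
  have a: "a > 0" using cox_pos[OF o(1)] cm by simp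
  have t: "tip m = pt (real a) (real b)" by (simp add: tip_def coxeter_vec_pt cm)
  have u6: "snd x ^ 6 = 1" and pE: "fst x \<in> eisenstein" using o(2) by (simp_all add: lattice_darts_iff)
  have u: "b = 0 \<and> (snd x = 1 \<or> snd x = - 1)"
  proof -
    have c: "real a * r = real b * s" if "snd x = pt s r" for s r
      using assms(3) unfolding t that cross_pt by simp
    have w: "omega = pt 0 1" "omega ^ 2 = pt (- 1) 1" "omega ^ 4 = pt 0 (- 1)" "omega ^ 5 = pt 1 (- 1)"
      "(1 :: complex) = pt 1 0" "(- 1 :: complex) = pt (- 1) 0"
      unfolding omega_powers by (simp_all add: pt_def)
    from u6 show ?thesis
    proof (cases rule: unit_cases)
      case 1 then show ?thesis using c[of 1 0] w by simp
    next
      case 2 then show ?thesis using c[of 0 1] w a by simp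
    next
      case 3 then show ?thesis using c[of "- 1" 1] w a by simp
    next
      case 4 then show ?thesis using c[of "- 1" 0] w by simp
    next
      case 5 then show ?thesis using c[of 0 "- 1"] w a by simp
    next
      case 6 then show ?thesis using c[of 1 "- 1"] w a by simp
    qed
  qed
  have ta: "tip m = of_nat a" using t u by (simp add: pt_def)
  obtain p q where p: "fst x = eis p q" using pE by (elim eisensteinE)
  obtain s where s: "0 < s" "s < 1" "place x (1/2) = of_real (s * real a)"
    using assms(2) by (auto simp: in_segment ta scaleR_conv_of_real)
  have "Im (place x (1/2)) = real_of_int q * (sqrt 3 / 2)"
    using u by (auto simp: place_eq p eis_pt pt_simps)
  then have q: "q = 0" using s(3) by simp
  have pp: "fst x = of_int p" using p q by (simp add: eis_def)
  have u1: "snd x = 1"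
  proof (rule ccontr)
    assume "snd x \<noteq> 1"
    then have "snd x = - 1" using u by simp
    \<comment> \<open>With direction \<open>- 1\<close> the cell to the left of \<open>x\<close>
      would lie below the side, where \<open>bary m\<close> is negative.\<close>
    obtain w where w: "w \<in> unit_cell" "place x w \<in> facet m" using o(3) by (auto simp: cell_disjoint)
    then have "0 < cross (of_nat a) (of_int p - w)"
      using facet_iff[OF o(1)] \<open>snd x = - 1\<close> by (simp add: bary_def ta place_eq pp)
    then have "0 < - (real a * Im w)" by (simp add: cross_eq)
    moreover obtain s r where "w = pt s r" by (rule pt_cases)
    moreover have "0 < real a * (r * (sqrt 3 / 2))" if "0 < r" for r
      using that a by simp
    ultimately show False using w(1) by (fastforce simp: unit_cell_pt pt_simps)
  qed
  have "Re (place x (1/2)) = real_of_int p + 1 / 2" by (simp add: place_eq pp u1)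
  then have ps: "real_of_int p + 1 / 2 = s * real a" using s(3) by simp
  moreover have "0 < s * real a" "s * real a < real a" using s a by simp_all
  ultimately have "real_of_int p + 1 / 2 > 0" "real_of_int p + 1 / 2 < real a" by simp_all
  \<comment> \<open>The ends of the side are integers and the midpoint of the edge is a
    half-integer, so the whole edge lies in the side.\<close>
  then have p0: "0 \<le> p" "p + 1 \<le> int a" by linarith+
  have "side x \<subseteq> open_segment 0 (tip m)"
  proof
    fix z assume "z \<in> side x"
    then obtain v where v: "0 < v" "v < 1" "z = of_real (real_of_int p + v)"
      by (auto simp: side_def in_segment pp u1 scaleR_conv_of_real algebra_simps)
    define l where "l = (real_of_int p + v) / real a"
    have "real_of_int p + v < real a" using v p0 by linarith
    then have "0 < l" "l < 1" "z = l *\<^sub>R tip m"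
      using v p0 a by (simp_all add: l_def ta scaleR_conv_of_real)
    then show "z \<in> open_segment 0 (tip m)"
      using a by (auto simp: in_segment ta)
  qed
  then have g: "dev (opp M m) (move (tip m, - 1) (lopp x)) = opp T d"
    using glue_along[OF o(1,2) _ o(3)] o(4) by simp
  define y where "y = move (tip m, - 1) (lopp x)"
  have y: "y = (of_int (int a - p - 1), 1)"
    by (simp add: y_def move_eq lopp_eq pp u1 ta)
  have yL: "y \<in> lattice_darts"
    using eis_in[of "int a - p - 1" 0] by (simp add: y lattice_darts_iff eis_def)
  have m': "opp M m \<in> darts M" by (rule opp_M[OF o(1)])
  have "cell y \<inter> facet (opp M m) \<noteq> {}"
  proof -
    have "place y (1/2) = of_nat a - place x (1/2)"
      by (simp add: y place_eq pp u1)
    also have "\<dots> = of_real ((1 - s) * real a)" by (simp add: s(3) algebra_simps)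
    finally have "place y (1/2) = (1 - s) *\<^sub>R tip (opp M m)"
      by (simp add: tip_opp[OF o(1)] ta scaleR_conv_of_real)
    then have "place y (1/2) \<in> open_segment 0 (tip (opp M m))"
      using s(1,2) a by (auto simp: in_segment tip_opp[OF o(1)] ta intro!: exI[of _ "1 - s"])
    then have pos: "0 < bary' (opp M m) (place y (1/2))" "0 < bary'' (opp M m) (place y (1/2))"
      by (simp_all add: open_side_iff[OF m'])
    define N where "N = {w. 0 < bary' (opp M m) (place y w)} \<inter> {w. 0 < bary'' (opp M m) (place y w)}"
    have "open N" unfolding N_def by (intro open_Int open_positive continuous_bary)
    moreover have "of_real (1/2) \<in> N" using pos by (simp add: N_def)
    ultimately obtain w where w: "w \<in> unit_cell" "w \<in> N" by (rule unit_cell_near) simp_all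
    obtain v r where vr: "w = pt v r" by (rule pt_cases)
    have "bary (opp M m) (place y w) = real a * Im w"
      by (simp add: bary_def tip_opp[OF o(1)] ta y place_eq cross_eq)
    moreover have "0 < Im w" using w(1) by (simp add: vr unit_cell_pt pt_simps)
    ultimately have "place y w \<in> facet (opp M m)"
      using w(2) a by (simp add: facet_iff[OF m'] N_def)
    then show ?thesis using w(1) by (auto simp: cell_disjoint)
  qed
  then have "over (opp T d) (opp M m) y" using g m' yL by (simp add: over_def y_def)
  moreover have "residue y = - (residue x + 1) + tip m"
    by (simp add: residue_def y pp u1 ta)
  then have "residue y \<simeq> - (residue x + 1)"
    using tip_scaled[OF o(1)] by (simp add: res_eq_def)
  ultimately show ?thesis by blast
qed

text \<open>The midpoint of the edge lies in an open facet, on a side that the edge crosses, or on a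
  side that the edge follows; it is never a corner.\<close>

lemma over_opp:
  assumes "d \<in> darts T"
  shows "\<exists>m x m' y. over d m x \<and> over (opp T d) m' y \<and> residue y \<simeq> - (residue x + 1)"
proof -
  obtain m x where x: "over d m x" "place x (1/2) \<in> closed_facet m"
    using over_midpoint[OF assms] by blast
  have o: "m \<in> darts M" "x \<in> lattice_darts" "cell x \<inter> facet m \<noteq> {}" "dev m x = d"
    using x by (simp_all add: over_def)
  show ?thesis
  proof (cases "place x (1/2) \<in> facet m")
    case True
    then have "over (opp T d) m (lopp x)"
      using over_opp_inner[OF x(1), of "1/2"] by simp
    then show ?thesis using x(1) residue_lopp[OF o(2)] res_eq_refl by metis
  next
    case False
    obtain n y where y: "n \<in> darts M" "y \<in> lattice_darts" "dev n y = dev m x" "residue y \<simeq> residue x"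
      "cell y \<inter> facet n \<noteq> {}" "place y (1/2) \<in> open_segment 0 (tip n)"
      by (rule to_open_side[OF o(1-3) x(2) False midpoint_not_eisenstein[OF o(2)]])
    have ov: "over d n y" using y o(4) by (simp add: over_def)
    show ?thesis
    proof (cases "cross (tip n) (snd y) = 0")
      case True
      then show ?thesis using over_opp_along[OF ov y(6)] ov by blast
    next
      case False
      then show ?thesis
        using over_opp_crossing[OF ov y(6)] ov residue_lopp[OF y(2)] res_eq_refl by metis
    qed
  qed
qed

end

section \<open>Residue coordinates and the coarse triangulation\<close>

context scaled_straight_triangulation
begin

lemma eis_res_eq: "eis a b \<simeq> eis a' b' \<longleftrightarrow> a mod int k = a' mod int k \<and> b mod int k = b' mod int k"
  by (simp add: res_eq_def eis_arith eis_scaled_iff mod_eq_dvd_iff)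

definition coordinates :: "('a \<Rightarrow> int) \<Rightarrow> ('a \<Rightarrow> int) \<Rightarrow> bool" where
  "coordinates \<alpha> \<beta> \<longleftrightarrow> (\<forall>d m x a b. over d m x \<longrightarrow> residue x \<simeq> eis a b \<longrightarrow>
    \<alpha> d = a mod int k \<and> \<beta> d = b mod int k)"

lemma coordinates_exist: "\<exists>\<alpha> \<beta>. coordinates \<alpha> \<beta>"
proof -
  define S where "S d = (SOME c. \<exists>m x. over d m x \<and> residue x \<simeq> eis (fst c) (snd c))" for d
  have "fst (S d) mod int k = a mod int k \<and> snd (S d) mod int k = b mod int k"
    if "over d m x" "residue x \<simeq> eis a b" for d m x a b
  proof -
    have "\<exists>c m x. over d m x \<and> residue x \<simeq> eis (fst c) (snd c)"
      using that by (metis fst_conv snd_conv)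
    then have "\<exists>m x. over d m x \<and> residue x \<simeq> eis (fst (S d)) (snd (S d))"
      unfolding S_def by (rule someI_ex)
    then obtain m' x' where "over d m' x'" "residue x' \<simeq> eis (fst (S d)) (snd (S d))" by blast
    then have "eis (fst (S d)) (snd (S d)) \<simeq> eis a b"
      using over_unique[OF that(1)] that(2) res_eq_trans res_eq_sym by metis
    then show ?thesis by (simp add: eis_res_eq)
  qed
  then have "coordinates (\<lambda>d. fst (S d) mod int k) (\<lambda>d. snd (S d) mod int k)"
    unfolding coordinates_def by blast
  then show ?thesis by blast
qed

lemma over_exists:
  assumes "d \<in> darts T" obtains m x a b where "over d m x" "residue x = eis a b"
proof -
  obtain m x where "over d m x" using over_midpoint[OF assms] by blast
  then have "residue x \<in> eisenstein" using residue_eisenstein by (simp add: over_def)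
  then show ?thesis using that \<open>over d m x\<close> by (elim eisensteinE) blast
qed

text \<open>A face step maps a residue \<open>r\<close> to \<open>- omega * (r + 1)\<close> and a
  reversal maps it to \<open>- (r + 1)\<close>; the equations are these maps in the basis
  \<open>1\<close>, \<open>omega\<close> modulo \<open>k\<close>.\<close>

lemma
  assumes co: "coordinates \<alpha> \<beta>" and d: "d \<in> darts T"
  shows coordinates_bounds: "\<alpha> d \<in> {0..<int k}" "\<beta> d \<in> {0..<int k}"
    and coordinates_face_next: "\<alpha> (face_next T d) = \<beta> d"
      "\<beta> (face_next T d) = (- \<alpha> d - \<beta> d - 1) mod int k"
    and coordinates_opp: "\<alpha> (opp T d) = (- \<alpha> d - 1) mod int k"
      "\<beta> (opp T d) = - \<beta> d mod int k"
proof -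
  have c: "\<alpha> d = a mod int k \<and> \<beta> d = b mod int k" if "over d m x" "residue x \<simeq> eis a b" for d m x a b
    using co that unfolding coordinates_def by blast
  obtain m x a b where o: "over d m x" "residue x = eis a b" by (rule over_exists[OF d])
  show "\<alpha> d \<in> {0..<int k}" "\<beta> d \<in> {0..<int k}"
  proof -
    from o have "\<alpha> d = a mod int k \<and> \<beta> d = b mod int k" using c res_eq_refl by metis
    then show "\<alpha> d \<in> {0..<int k}" "\<beta> d \<in> {0..<int k}" using k_pos by simp_all
  qed
  show "\<alpha> (face_next T d) = \<beta> d" "\<beta> (face_next T d) = (- \<alpha> d - \<beta> d - 1) mod int k"
  proof -
    from o have ab: "\<alpha> d = a mod int k" "\<beta> d = b mod int k" using c[of d m x a b] by simp_all
    have "residue (lface_next x) = eis 0 (- 1) * (eis a b + eis 1 0)"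
      using o residue_lface_next[of x] by (simp add: over_def eis_def)
    also have "\<dots> = eis b (- a - b - 1)" by (simp add: eis_arith)
    finally show "\<alpha> (face_next T d) = \<beta> d" "\<beta> (face_next T d) = (- \<alpha> d - \<beta> d - 1) mod int k"
      using c[OF over_face_next[OF o(1)], of b "- a - b - 1"] ab
      by (simp, metis mod_diff_left_eq mod_diff_right_eq mod_minus_eq res_eq_refl)
  qed
  show "\<alpha> (opp T d) = (- \<alpha> d - 1) mod int k" "\<beta> (opp T d) = - \<beta> d mod int k"
  proof -
    obtain m x m' y where o: "over d m x" "over (opp T d) m' y" "residue y \<simeq> - (residue x + 1)"
      using over_opp[OF d] by blast
    have "residue x \<in> eisenstein" using o(1) residue_eisenstein by (simp add: over_def)
    then obtain a b where ab: "residue x = eis a b" by (elim eisensteinE)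
    then have \<alpha>: "\<alpha> d = a mod int k" "\<beta> d = b mod int k" using c[OF o(1), of a b] by simp_all
    have "- (residue x + 1) = - (eis a b + eis 1 0)" by (simp add: ab eis_def)
    also have "\<dots> = eis (- a - 1) (- b)" by (simp add: eis_arith)
    finally have "residue y \<simeq> eis (- a - 1) (- b)" using o(3) by simp
    then show "\<alpha> (opp T d) = (- \<alpha> d - 1) mod int k" "\<beta> (opp T d) = - \<beta> d mod int k"
      using c[OF o(2), of "- a - 1" "- b"] \<alpha>
      by (simp_all add: mod_simps) (metis mod_diff_left_eq mod_minus_eq)
  qed
qed

text \<open>Since \<open>a > 0\<close> and \<open>b >= 0\<close>, the side leaves the origin in the
  sector from direction \<open>1\<close>, included, to direction \<open>omega\<close>, excluded. A
  point near the origin and slightly to the left of the side lies both in the facet and in the cell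
  of \<open>(0, 1)\<close>.\<close>

lemma over_origin:
  assumes m: "m \<in> darts M" shows "over (dev m (0, 1)) m (0, 1)"
proof -
  obtain a b where cm: "cox m = (a, b)" by fastforce
  have a: "a > 0" using cox_pos[OF m] cm by simp
  have t: "tip m = pt (real a) (real b)" by (simp add: tip_def coxeter_vec_pt cm)
  define \<Delta> where "\<Delta> = cross (tip m) (apex m)"
  have \<Delta>: "\<Delta> > 0" using cross_tip_apex[OF m] by (simp add: \<Delta>_def)
  \<comment> \<open>The summand \<open>1\<close> keeps \<open>C\<close> positive and makes the tilt
    by \<open>\<delta>\<close> strictly too small to cross the side through the origin that leads to
    \<open>apex m\<close>.\<close>
  define C where "C = \<bar>cross omega (apex m)\<bar> + 1"
  define \<delta> where "\<delta> = \<Delta> / C"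
  have "C > 0" by (simp add: C_def add_nonneg_pos)
  then have \<delta>: "\<delta> > 0" "\<delta> * C = \<Delta>" using \<Delta> by (simp_all add: \<delta>_def)
  have "\<delta> * \<bar>cross omega (apex m)\<bar> < \<delta> * C"
    by (rule mult_strict_left_mono) (use \<delta> in \<open>simp_all add: C_def\<close>)
  then have "\<bar>\<delta> * cross omega (apex m)\<bar> < \<Delta>" using \<delta> by (simp add: abs_mult)
  then have b': "\<Delta> + \<delta> * cross omega (apex m) > 0" by linarith
  have b: "\<delta> * cross (tip m) omega > 0"
    using \<delta>(1) a by (simp add: t pt_const cross_pt)
  define A where "A = \<delta> * cross (tip m) omega"
  define B where "B = \<Delta> + \<delta> * cross omega (apex m)"
  \<comment> \<open>The first bound stays in front of the far side of the facet, the second inside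
    the unit cell.\<close>
  define \<epsilon> where "\<epsilon> = min (\<Delta> / (2 * (A + B))) (1 / (2 * (real a + real b + \<delta>)))"
  have AB: "A > 0" "B > 0" using b b' by (simp_all add: A_def B_def)
  have \<epsilon>: "\<epsilon> > 0" using \<Delta> AB a \<delta> by (simp add: \<epsilon>_def)
  have half: "c / (2 * S) * S = c / 2" if "S \<noteq> 0" for c S :: real using that by simp
  have "\<epsilon> * (A + B) \<le> \<Delta> / (2 * (A + B)) * (A + B)"
    by (rule mult_right_mono) (use AB in \<open>simp_all add: \<epsilon>_def\<close>)
  also have "\<Delta> / (2 * (A + B)) * (A + B) = \<Delta> / 2"
    using AB by (intro half) simp
  finally have e1: "\<epsilon> * (A + B) < \<Delta>" using \<Delta> by simp
  have pos: "real a + real b + \<delta> > 0" using a \<delta> by simp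
  have "\<epsilon> * (real a + real b + \<delta>) \<le> 1 / (2 * (real a + real b + \<delta>)) * (real a + real b + \<delta>)"
    by (rule mult_right_mono) (use pos in \<open>simp_all add: \<epsilon>_def\<close>)
  also have "1 / (2 * (real a + real b + \<delta>)) * (real a + real b + \<delta>) = 1 / 2"
    using pos by (intro half) simp
  finally have e2: "\<epsilon> * (real a + real b + \<delta>) < 1" by simp
  define z where "z = of_real \<epsilon> * (tip m + of_real \<delta> * omega)"
  have "bary m z = \<epsilon> * A" "bary' m z = \<epsilon> * B"
    by (simp_all add: bary_def bary'_def z_def cross_simps A_def B_def \<Delta>_def)
  moreover from this have "bary'' m z = \<Delta> - \<epsilon> * (A + B)"
    by (simp add: bary''_def \<Delta>_def algebra_simps)
  ultimately have "z \<in> facet m" using \<epsilon> AB e1 by (simp add: facet_iff[OF m])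
  moreover have "z = pt (\<epsilon> * real a) (\<epsilon> * (real b + \<delta>))"
    by (simp add: z_def t pt_def algebra_simps)
  then have "z \<in> unit_cell"
    using \<epsilon> a \<delta>(1) e2 mult_pos_pos[of \<epsilon> "real b + \<delta>"] by (simp add: unit_cell_pt algebra_simps)
  ultimately have "cell (0, 1) \<inter> facet m \<noteq> {}"
    by (auto simp: cell_disjoint place_eq)
  moreover have "(0, 1) \<in> lattice_darts" by (simp add: lattice_darts_iff eisenstein_const)
  ultimately show ?thesis using m by (simp add: over_def)
qed

end

lemma fullerene_dual:
  assumes "fullerene F"
  shows "face_next (dual F) d = opp F (nxt F (opp F d))"
    "face_next F d = opp F (face_next (dual F) (face_next (dual F) d))"
    "inv (face_next F) (opp F d) = face_next (dual F) d"
    "(face_next (dual F) ^^ 3) d = d"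
    "d \<in> darts F \<Longrightarrow> face_next (dual F) d \<noteq> d"
    "d \<in> darts F \<Longrightarrow> face_next (dual F) d \<in> darts F"
proof -
  have p: "plane_map F" using assms by (simp add: fullerene_def)
  note f = plane_map_finite[OF p] plane_map_nxt[OF p]
  show fd: "face_next (dual F) d = opp F (nxt F (opp F d))" for d
    by (rule face_next_dual[OF p])
  show "inv (face_next F) (opp F d) = face_next (dual F) d"
    by (simp add: fd plane_map_inv_face_next[OF p])
  have c: "card (orbit (nxt F) d) = 3" if "d \<in> darts F" for d
    using assms that by (simp add: fullerene_def verts_def)
  have n3: "nxt F (nxt F (nxt F d)) = d" for d
  proof (cases "d \<in> darts F")
    case True
    then show ?thesis
      using funpow_card_orbit[OF permutes_in_orbit[OF f], of d] c by (simp add: numeral_3_eq_3)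
  qed (simp add: permutes_not_in[OF f(2)])
  show "(face_next (dual F) ^^ 3) d = d"
    by (simp add: numeral_3_eq_3 fd plane_map_opp_opp[OF p] n3)
  have "inv (nxt F) (opp F d) = nxt F (nxt F (opp F d))"
    using n3[of "opp F d"] permutes_inverses(2)[OF f(2)] by metis
  then show "face_next F d = opp F (face_next (dual F) (face_next (dual F) d))"
    by (simp add: face_next_def[of F] fd plane_map_opp_opp[OF p])
  show "d \<in> darts F \<Longrightarrow> face_next (dual F) d \<in> darts F"
    by (simp add: fd permutes_in_image[OF f(2)] permutes_in_image[OF plane_map_opp[OF p]])
  show "face_next (dual F) d \<noteq> d" if "d \<in> darts F"
  proof
    assume "face_next (dual F) d = d"
    then have "nxt F (opp F d) = opp F d" unfolding fd by (metis plane_map_opp_opp[OF p])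
    moreover have "opp F d \<in> darts F" using that by (simp add: permutes_in_image[OF plane_map_opp[OF p]])
    ultimately show False using c[of "opp F d"] orbit_eq_singleton_iff[of "nxt F" "opp F d"] by simp
  qed
qed

lemma master_polyhedron_coarse:
  assumes "fullerene F" "master_polyhedron F M cox" "k > 0"
    and "\<And>m. m \<in> darts M \<Longrightarrow> k dvd fst (cox m) \<and> k dvd snd (cox m)"
  obtains \<alpha> \<beta> where "coarse_fullerene F k \<alpha> \<beta>"
proof -
  obtain apex dev g where st: "straight_triangulation (dual F) M cox apex dev"
    and g: "bij_betw g (verts M) (pentagons F)"
      "\<And>m. m \<in> darts M \<Longrightarrow> g (orbit (nxt M) m) = orbit (nxt (dual F)) (dev m (0, 1))"
    using assms(2) unfolding master_polyhedron_def by blast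
  interpret scaled_straight_triangulation "dual F" M cox apex dev
    "\<lambda>m. coxeter_vec (cox m)" "\<lambda>m. interior (convex hull {0, coxeter_vec (cox m), apex m})" k
    using st assms(3,4) by (simp add: scaled_straight_triangulation_def scaled_straight_triangulation_axioms_def)
  have p: "plane_map F" using assms(1) by (simp add: fullerene_def)
  note D = plane_map_finite[OF p] plane_map_face_next[OF p] plane_map_opp[OF p]
  note fd = fullerene_dual[OF assms(1)]
  obtain \<alpha> \<beta> :: "'a \<Rightarrow> int" where co: "coordinates \<alpha> \<beta>" using coordinates_exist by blast
  have bounds: "\<alpha> d \<in> {0..<int k} \<and> \<beta> d \<in> {0..<int k}"
    and tn: "\<alpha> (face_next (dual F) d) = \<beta> d \<and>
      \<beta> (face_next (dual F) d) = (- \<alpha> d - \<beta> d - 1) mod int k"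
    and fl: "\<alpha> (opp F d) = (- \<alpha> d - 1) mod int k \<and> \<beta> (opp F d) = - \<beta> d mod int k"
    if "d \<in> darts F" for d
    using coordinates_bounds[OF co] coordinates_face_next[OF co] coordinates_opp[OF co] that
    by simp_all
  \<comment> \<open>A rotation is two face steps of the dual followed by a reversal, so its rule is
    composed from the two known ones.\<close>
  have rot: "\<alpha> (face_next F d) = (\<alpha> d + \<beta> d) mod int k \<and> \<beta> (face_next F d) = - \<alpha> d mod int k"
    if d: "d \<in> darts F" for d
  proof -
    let ?t = "face_next (dual F)"
    have D1: "?t d \<in> darts F" "?t (?t d) \<in> darts F" using fd(6) d by blast+
    have am: "\<alpha> d mod int k = \<alpha> d" using bounds d by simp
    have "\<beta> (?t (?t d)) = (- \<alpha> (?t d) - \<beta> (?t d) - 1) mod int k" using tn D1 by simp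
    also have "\<dots> = (- \<beta> d - (- \<alpha> d - \<beta> d - 1) mod int k - 1) mod int k" using tn d by simp
    also have "\<dots> = (- \<beta> d - (- \<alpha> d - \<beta> d - 1) - 1) mod int k"
      by (metis mod_diff_left_eq mod_diff_right_eq)
    also have "\<dots> = \<alpha> d" using am by simp
    finally have b2: "\<beta> (?t (?t d)) = \<alpha> d" .
    have a2: "\<alpha> (?t (?t d)) = (- \<alpha> d - \<beta> d - 1) mod int k" using tn D1 d by simp
    have "\<alpha> (face_next F d) = (- ((- \<alpha> d - \<beta> d - 1) mod int k) - 1) mod int k"
      unfolding fd(2)[of d] using fl D1(2) a2 by simp
    also have "\<dots> = (- (- \<alpha> d - \<beta> d - 1) - 1) mod int k"
      by (metis mod_diff_left_eq mod_minus_eq)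
    also have "\<dots> = (\<alpha> d + \<beta> d) mod int k" by (simp add: algebra_simps)
    finally show ?thesis
      unfolding fd(2)[of d] using fl D1(2) b2 by simp
  qed
  have flat: "card (orbit (face_next F) d) = 6" if d: "d \<in> darts F" "\<alpha> d \<noteq> 0 \<or> \<beta> d \<noteq> 0" for d
  proof (rule ccontr)
    assume "card (orbit (face_next F) d) \<noteq> 6"
    then have "orbit (face_next F) d \<in> pentagons F"
      using assms(1) d(1) by (auto simp: fullerene_def pentagons_def faces_def)
    then obtain v where v: "v \<in> verts M" "g v = orbit (face_next F) d"
      using bij_betw_imp_surj_on[OF g(1)] by (metis imageE)
    then obtain m where m: "m \<in> darts M" "v = orbit (nxt M) m" by (auto simp: verts_def)
    define d0 where "d0 = dev m (0, 1)"
    have "orbit (face_next F) d = orbit (face_next F) d0" using g(2)[OF m(1)] m v by (simp add: d0_def)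
    then have "d \<in> orbit (face_next F) d0" by (simp add: orbit_eq_iff[OF D(1,2)])
    moreover have o: "over d0 m (0, 1)" using over_origin[OF m(1)] by (simp add: d0_def)
    have "d0 \<in> darts F" using dev_darts[OF m(1), of "(0, 1)"] o by (simp add: over_def)
    moreover have "\<alpha> d0 = 0 \<and> \<beta> d0 = 0"
      using co[unfolded coordinates_def, rule_format, OF o, of 0 0] res_eq_refl[of 0]
      by (simp add: residue_def eis_def)
    \<comment> \<open>The rotation rule fixes the residue zero, which therefore spreads from
      \<open>d0\<close> around the whole pentagon.\<close>
    ultimately have "d \<in> darts F \<and> \<alpha> d = 0 \<and> \<beta> d = 0"
    proof (induction)
      case base
      then show ?case using rot permutes_in_image[OF D(2)] by simp
    next
      case (step e)
      then show ?case using rot[of e] permutes_in_image[OF D(2)] by simp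
    qed
    then show False using d by simp
  qed
  have "coarse_fullerene F k \<alpha> \<beta>"
  proof
    show "finite (darts F)" "face_next F permutes darts F" "opp F permutes darts F"
      by (rule D)+
    show "opp F (opp F d) = d" for d by (rule plane_map_opp_opp[OF p])
    show "opp F d \<noteq> d" if "d \<in> darts F" for d by (rule plane_map_opp_neq[OF p that])
    show "(inv (face_next F) \<circ> opp F \<circ> inv (face_next F) \<circ> opp F \<circ> inv (face_next F) \<circ> opp F) d = d" for d
      using fd(4)[of d] by (simp add: fd(3) numeral_3_eq_3)
    show "inv (face_next F) (opp F d) \<noteq> d" if "d \<in> darts F" for d
      unfolding fd(3) by (rule fd(5)[OF that])
    show "\<alpha> d \<in> {0..<int k}" "\<beta> d \<in> {0..<int k}" if "d \<in> darts F" for d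
      using bounds that by simp_all
    show "\<alpha> (face_next F d) = (\<alpha> d + \<beta> d) mod int k" "\<beta> (face_next F d) = - \<alpha> d mod int k"
      if "d \<in> darts F" for d using rot that by simp_all
    show "\<alpha> (opp F d) = (- \<alpha> d - 1) mod int k" "\<beta> (opp F d) = - \<beta> d mod int k"
      if "d \<in> darts F" for d using fl[of d] that by simp_all
  qed (use assms(1,3) flat in auto)
  then show ?thesis by (rule that)
qed

section \<open>Unfolding the coarse triangles\<close>

lemma unit_coordinates:
  "1 = eis 1 0" "omega = eis 0 1" "omega ^ 2 = eis (- 1) 1" "- 1 = eis (- 1) 0"
  "omega ^ 4 = eis 0 (- 1)" "omega ^ 5 = eis 1 (- 1)"
  unfolding omega_powers by (simp_all add: eis_def)

lemma lattice_dart_coordinates: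
  assumes "x \<in> lattice_darts"
  obtains a b c e where "x = (eis a b, eis c e)"
    "(c, e) \<in> {(1, 0), (0, 1), (-1, 1), (-1, 0), (0, -1), (1, -1)}"
proof -
  have x: "fst x \<in> eisenstein" "snd x ^ 6 = 1" using assms by (simp_all add: lattice_darts_iff)
  obtain a b where "fst x = eis a b" using x(1) by (elim eisensteinE)
  moreover have "\<exists>c e. snd x = eis c e \<and> (c, e) \<in> {(1, 0), (0, 1), (-1, 1), (-1, 0), (0, -1), (1, -1)}"
    using x(2)
  proof (cases rule: unit_cases)
    case 1
    then have "snd x = eis 1 0" by (simp only: unit_coordinates(1))
    then show ?thesis by auto
  next
    case 2
    then have "snd x = eis 0 1" by (simp only: unit_coordinates(2))
    then show ?thesis by auto
  next
    case 3
    then have "snd x = eis (- 1) 1" by (simp only: unit_coordinates(3))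
    then show ?thesis by auto
  next
    case 4
    then have "snd x = eis (- 1) 0" by (simp only: unit_coordinates(4))
    then show ?thesis by auto
  next
    case 5
    then have "snd x = eis 0 (- 1)" by (simp only: unit_coordinates(5))
    then show ?thesis by auto
  next
    case 6
    then have "snd x = eis 1 (- 1)" by (simp only: unit_coordinates(6))
    then show ?thesis by auto
  qed
  ultimately show ?thesis using that by (metis prod.collapse)
qed

lemma lface_next_eis: "lface_next (eis a b, eis c e) = (eis (a + c) (b + e), eis (- c - e) c)"
  by (simp add: lface_next_eq unit_coordinates(3) eis_arith)

lemma lopp_eis: "lopp (eis a b, eis c e) = (eis (a + c) (b + e), eis (- c) (- e))"
  by (simp add: lopp_eq eis_arith)

lemma move_eis: "move (eis a b, eis c e) (eis a' b', eis c' e') =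
    (eis a b + eis c e * eis a' b', eis c e * eis c' e')"
  by (simp add: move_eq)

lemma move_lface_next: "move g (lface_next x) = lface_next (move g x)"
  by (simp add: move_eq lface_next_eq algebra_simps)

lemma lface_next_3:
  assumes "x \<in> lattice_darts" shows "lface_next (lface_next (lface_next x)) = x"
proof -
  obtain a b c e where "x = (eis a b, eis c e)" by (rule lattice_dart_coordinates[OF assms])
  then show ?thesis by (simp add: lface_next_eis)
qed

text \<open>Every lattice triangle has one horizontal side, directed along \<open>1\<close> if the
  triangle points up and along \<open>- 1\<close> if it points down.\<close>

lemma lattice_dart_rotation:
  assumes "x \<in> lattice_darts"
  obtains i a b where "i < 3" "x = (lface_next ^^ i) (eis a b, eis 1 0)"
  | i a b where "i < 3" "x = (lface_next ^^ i) (eis a b, eis (- 1) 0)"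
proof -
  obtain a b c e where x: "x = (eis a b, eis c e)"
    and c: "(c, e) \<in> {(1, 0), (0, 1), (-1, 1), (-1, 0), (0, -1), (1, -1)}"
    by (rule lattice_dart_coordinates[OF assms])
  from c consider "c = 1" "e = 0" | "c = 0" "e = 1" | "c = -1" "e = 1" | "c = -1" "e = 0"
    | "c = 0" "e = -1" | "c = 1" "e = -1" by auto
  then show ?thesis
  proof cases
    case 1 then show ?thesis using that(1)[of 0 a b] x by simp
  next
    case 2 then show ?thesis using that(2)[of 2 a "b + 1"] x by (simp add: numeral_2_eq_2 lface_next_eis)
  next
    case 3 then show ?thesis using that(1)[of 1 "a - 1" b] x by (simp add: lface_next_eis)
  next
    case 4 then show ?thesis using that(2)[of 0 a b] x by simp
  next
    case 5 then show ?thesis using that(1)[of 2 a "b - 1"] x by (simp add: numeral_2_eq_2 lface_next_eis)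
  next
    case 6 then show ?thesis using that(2)[of 1 "a + 1" b] x by (simp add: lface_next_eis)
  qed
qed

lemma cell_lface_next_funpow: "cell ((lface_next ^^ i) x) = cell x"
  by (induction i) (simp_all add: cell_lface_next)

definition big_triangle :: "nat \<Rightarrow> complex set" where
  "big_triangle k = interior (convex hull {0, coxeter_vec (k, 0), omega * coxeter_vec (k, 0)})"

lemma pt_big_triangle:
  assumes "k > 0"
  shows "pt s r \<in> big_triangle k \<longleftrightarrow> 0 < s \<and> 0 < r \<and> s + r < real k"
proof -
  have t: "coxeter_vec (k, 0) = pt (real k) 0" "omega * coxeter_vec (k, 0) = pt 0 (real k)"
    by (simp_all add: coxeter_vec_pt pt_def)
  define c where "c = real k * (sqrt 3 / 2)"
  have "c > 0" using assms by (simp add: c_def)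
  have cr: "cross (pt (real k) 0) (pt s r) = r * c" "cross (pt s r) (pt 0 (real k)) = s * c"
    "cross (pt (real k) 0) (pt 0 (real k)) = real k * c"
    unfolding cross_pt c_def by simp_all
  have "pt s r \<in> big_triangle k \<longleftrightarrow> 0 < r * c \<and> 0 < s * c \<and> r * c + s * c < real k * c"
    unfolding big_triangle_def t(2)
    unfolding t(1) cr[symmetric]
    by (rule triangle_interior) (use assms \<open>c > 0\<close> cr in simp)
  also have "\<dots> \<longleftrightarrow> 0 < s \<and> 0 < r \<and> s + r < real k"
    using \<open>c > 0\<close> by (simp only: distrib_right[symmetric] zero_less_mult_iff mult_less_cancel_right) auto
  finally show ?thesis .
qed

lemma place_pt: "place (eis a b, eis 1 0) (pt s r) = pt (of_int a + s) (of_int b + r)"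
  "place (eis a b, eis (- 1) 0) (pt s r) = pt (of_int a - s) (of_int b - r)"
  by (simp_all add: place_eq eis_pt pt_arith)

text \<open>The sides of the big triangle lie on lattice lines, so a cell that meets it lies inside;
  integrality turns the real inequalities into conditions on the corner.\<close>

lemma up_cell_meets:
  assumes "k > 0"
  shows "cell (eis a b, eis 1 0) \<inter> big_triangle k \<noteq> {} \<longleftrightarrow> 0 \<le> a \<and> 0 \<le> b \<and> a + b < int k"
    and "w \<in> unit_cell \<Longrightarrow> 0 \<le> a \<and> 0 \<le> b \<and> a + b < int k \<Longrightarrow> place (eis a b, eis 1 0) w \<in> big_triangle k"
proof -
  show p: "place (eis a b, eis 1 0) w \<in> big_triangle k" if "w \<in> unit_cell" "0 \<le> a \<and> 0 \<le> b \<and> a + b < int k" for w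
  proof -
    obtain s r where w: "w = pt s r" by (rule pt_cases)
    have "real_of_int (a + b) + 1 \<le> real k" using that(2) by linarith
    then show ?thesis
      using that unfolding w by (simp add: place_pt pt_big_triangle[OF assms] unit_cell_pt)
  qed
  show "cell (eis a b, eis 1 0) \<inter> big_triangle k \<noteq> {} \<longleftrightarrow> 0 \<le> a \<and> 0 \<le> b \<and> a + b < int k"
  proof
    assume "cell (eis a b, eis 1 0) \<inter> big_triangle k \<noteq> {}"
    then obtain w where w: "w \<in> unit_cell" "place (eis a b, eis 1 0) w \<in> big_triangle k"
      by (auto simp: cell_disjoint)
    obtain s r where "w = pt s r" by (rule pt_cases)
    then have "0 < s" "0 < r" "s + r < 1" "0 < real_of_int a + s" "0 < real_of_int b + r"
      "real_of_int a + s + (real_of_int b + r) < real k"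
      using w by (simp_all add: place_pt pt_big_triangle[OF assms] unit_cell_pt)
    then show "0 \<le> a \<and> 0 \<le> b \<and> a + b < int k" by linarith
  next
    assume "0 \<le> a \<and> 0 \<le> b \<and> a + b < int k"
    moreover have "pt (1/4) (1/4) \<in> unit_cell" by (simp add: unit_cell_pt)
    ultimately show "cell (eis a b, eis 1 0) \<inter> big_triangle k \<noteq> {}"
      using p by (auto simp: cell_disjoint)
  qed
qed

lemma down_cell_meets:
  assumes "k > 0"
  shows "cell (eis a b, eis (- 1) 0) \<inter> big_triangle k \<noteq> {} \<longleftrightarrow> 1 \<le> a \<and> 1 \<le> b \<and> a + b \<le> int k"
    and "w \<in> unit_cell \<Longrightarrow> 1 \<le> a \<and> 1 \<le> b \<and> a + b \<le> int k \<Longrightarrow> place (eis a b, eis (- 1) 0) w \<in> big_triangle k"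
proof -
  show p: "place (eis a b, eis (- 1) 0) w \<in> big_triangle k" if "w \<in> unit_cell" "1 \<le> a \<and> 1 \<le> b \<and> a + b \<le> int k" for w
  proof -
    obtain s r where w: "w = pt s r" by (rule pt_cases)
    have "real_of_int (a + b) \<le> real k" "real_of_int a \<ge> 1" "real_of_int b \<ge> 1"
      using that(2) by linarith+
    then show ?thesis
      using that unfolding w by (simp add: place_pt pt_big_triangle[OF assms] unit_cell_pt)
  qed
  show "cell (eis a b, eis (- 1) 0) \<inter> big_triangle k \<noteq> {} \<longleftrightarrow> 1 \<le> a \<and> 1 \<le> b \<and> a + b \<le> int k"
  proof
    assume "cell (eis a b, eis (- 1) 0) \<inter> big_triangle k \<noteq> {}"
    then obtain w where w: "w \<in> unit_cell" "place (eis a b, eis (- 1) 0) w \<in> big_triangle k"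
      by (auto simp: cell_disjoint)
    obtain s r where "w = pt s r" by (rule pt_cases)
    then have "0 < s" "0 < r" "s + r < 1" "0 < real_of_int a - s" "0 < real_of_int b - r"
      "real_of_int a - s + (real_of_int b - r) < real k"
      using w by (simp_all add: place_pt pt_big_triangle[OF assms] unit_cell_pt)
    then show "1 \<le> a \<and> 1 \<le> b \<and> a + b \<le> int k" by linarith
  next
    assume "1 \<le> a \<and> 1 \<le> b \<and> a + b \<le> int k"
    moreover have "pt (1/4) (1/4) \<in> unit_cell" by (simp add: unit_cell_pt)
    ultimately show "cell (eis a b, eis (- 1) 0) \<inter> big_triangle k \<noteq> {}"
      using p by (auto simp: cell_disjoint)
  qed
qed

definition coords :: "complex \<Rightarrow> int \<times> int" where
  "coords z = (THE c. z = eis (fst c) (snd c))"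

lemma coords_eis [simp]: "coords (eis a b) = (a, b)"
  unfolding coords_def by (rule the_equality) auto

text \<open>A lattice triangle inside the big triangle is recorded by its orientation \<open>t\<close> and by the
  corner \<open>a + b\<omega>\<close> of the upward triangle that is equal or adjacent to it along the
  side opposite to this corner.\<close>

definition base_dart :: "bool \<Rightarrow> nat \<Rightarrow> nat \<Rightarrow> ldart" where
  "base_dart t a b = (if t then (eis (int a) (int b), eis 1 0)
    else (eis (int a + 1) (int b + 1), eis (- 1) 0))"

definition base_ok :: "nat \<Rightarrow> bool \<Rightarrow> nat \<Rightarrow> nat \<Rightarrow> bool" where
  "base_ok k t a b \<longleftrightarrow> (if t then a + b < k else Suc (a + b) < k)"

lemma base_dart_lattice: "base_dart t a b \<in> lattice_darts"
  using unit_coordinates by (simp add: base_dart_def lattice_darts_iff flip: unit_coordinates(1,4))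

lemma meets_base:
  assumes "k > 0" "x \<in> lattice_darts" "cell x \<inter> big_triangle k \<noteq> {}"
  obtains i t a b where "i < 3" "base_ok k t a b" "x = (lface_next ^^ i) (base_dart t a b)"
  using assms(2)
proof (cases rule: lattice_dart_rotation)
  case (1 i a b)
  then have "0 \<le> a \<and> 0 \<le> b \<and> a + b < int k"
    using assms(3) up_cell_meets(1)[OF assms(1)] by (simp add: cell_lface_next_funpow)
  then show ?thesis
    using that[of i True "nat a" "nat b"] 1 by (simp add: base_ok_def base_dart_def nat_less_iff) linarith
next
  case (2 i a b)
  then have "1 \<le> a \<and> 1 \<le> b \<and> a + b \<le> int k"
    using assms(3) down_cell_meets(1)[OF assms(1)] by (simp add: cell_lface_next_funpow)
  then show ?thesis
    using that[of i False "nat (a - 1)" "nat (b - 1)"] 2 by (simp add: base_ok_def base_dart_def) linarith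
qed

lemma funpow_mod_3:
  assumes "f (f (f x)) = x" shows "(f ^^ i) x = (f ^^ (i mod 3)) x"
  by (rule funpow_mod_eq[symmetric]) (simp add: assms numeral_3_eq_3)

section \<open>The developing map of a coarse triangle\<close>

context coarse_triangulation
begin

text \<open>One formula for each of the six directions. Darts of upward triangles are turned from
  the horizontal grid dart, those of downward triangles from the reverse of the grid dart along
  their upper side. Negative coordinates are truncated by \<open>nat\<close>, which happens only
  away from the big triangle, where values of \<open>dev\<close> are irrelevant.\<close>

definition develop :: "'a \<Rightarrow> ldart \<Rightarrow> 'a" where
  "develop m x = (case (coords (fst x), coords (snd x)) of ((a, b), c, e) \<Rightarrow>
    if (c, e) = (1, 0) then grid m (nat a) (nat b)
    else if (c, e) = (- 1, 1) then turn (grid m (nat (a - 1)) (nat b))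
    else if (c, e) = (0, - 1) then turn (turn (grid m (nat a) (nat (b - 1))))
    else if (c, e) = (- 1, 0) then flip (grid m (nat (a - 1)) (nat b))
    else if (c, e) = (1, - 1) then turn (flip (grid m (nat a) (nat b)))
    else turn (turn (flip (grid m (nat (a - 1)) (nat (b + 1))))))"

definition base_value :: "'a \<Rightarrow> bool \<Rightarrow> nat \<Rightarrow> nat \<Rightarrow> 'a" where
  "base_value m t a b = (if t then grid m a b else flip (grid m a (Suc b)))"

lemma base_value_D [simp]: "base_value m t a b \<in> D \<longleftrightarrow> m \<in> D"
  by (simp add: base_value_def)

lemma turn_funpow_D [simp]: "(turn ^^ i) d \<in> D \<longleftrightarrow> d \<in> D"
  by (induction i) simp_all

lemma develop_base: "develop m ((lface_next ^^ i) (base_dart t a b)) = (turn ^^ i) (base_value m t a b)"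
proof -
  define j where "j = i mod 3"
  have "j < 3" by (simp add: j_def)
  then have "j = 0 \<or> j = 1 \<or> j = 2" by linarith
  then have "develop m ((lface_next ^^ j) (base_dart t a b)) = (turn ^^ j) (base_value m t a b)"
    by (auto simp: base_dart_def base_value_def lface_next_eis develop_def numeral_2_eq_2 nat_add_distrib)
  then show ?thesis
    unfolding j_def
    by (simp flip: funpow_mod_3[where f = lface_next, OF lface_next_3[OF base_dart_lattice]]
        funpow_mod_3[where f = turn, OF turn_turn_turn])
qed

text \<open>Residues separate the small triangles. An upward one has residue \<open>(a, b)\<close>
  with sum below \<open>k\<close>; a downward one has \<open>(k - 1 - a, k - 1 - b)\<close>, with
  sum at least \<open>k\<close>. Once the positions agree, injectivity of the translations gives
  \<open>m = m'\<close>.\<close>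

lemma base_value_eq:
  assumes "m \<in> coarse" "m' \<in> coarse" "base_ok k t a b" "base_ok k t' a' b'"
    and "base_value m t a b = base_value m' t' a' b'"
  shows "m = m' \<and> t = t' \<and> a = a' \<and> b = b'"
proof -
  have same: "m = m' \<and> a = a' \<and> b = b'" if "m \<in> coarse" "m' \<in> coarse" "a + b < k" "a' + b' < k"
    "grid m a b = grid m' a' b'" for m m' a b a' b'
  proof -
    have "a = a'" "b = b'"
      using residue_grid_coarse[OF that(1), of a b] residue_grid_coarse[OF that(2), of a' b'] that by simp_all
    then show ?thesis using that(5) by simp
  qed
  have differ: "grid m a b \<noteq> flip (grid m' a' (Suc b'))"
    if "m \<in> coarse" "m' \<in> coarse" "a + b < k" "Suc (a' + b') < k" for m m' a b a' b'
  proof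
    assume eq: "grid m a b = flip (grid m' a' (Suc b'))"
    have neg: "- int n mod int k = int k - int n" if "0 < n" "n \<le> k" for n
      using that by (cases "n = k") (simp_all add: zmod_zminus1_eq_if)
    have "int a = (- int a' - 1) mod int k" "int b = - int (Suc b') mod int k"
      using residue_grid_coarse[OF that(1), of a b] residue_grid_coarse[OF that(2), of a' "Suc b'"] that eq
        \<alpha>_flip[of "grid m' a' (Suc b')"] \<beta>_flip[of "grid m' a' (Suc b')"] coarse_D[OF that(2)]
      by simp_all
    moreover have "- int a' - 1 = - int (Suc a')" by simp
    ultimately have "int a = int k - int (Suc a')" "int b = int k - int (Suc b')"
      using that(4) neg[of "Suc a'"] neg[of "Suc b'"] by simp_all
    then show False using that by linarith
  qed
  show ?thesis
  proof (cases t; cases t')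
    assume "t" "t'"
    then show ?thesis using same[OF assms(1,2)] assms(3-5) by (simp add: base_ok_def base_value_def)
  next
    assume "\<not> t" "\<not> t'"
    then show ?thesis using same[OF assms(1,2), of a "Suc b" a' "Suc b'"] assms(3-5)
      by (simp add: base_ok_def base_value_def)
  next
    assume "t" "\<not> t'"
    then show ?thesis using differ[OF assms(1,2)] assms(3-5) by (simp add: base_ok_def base_value_def)
  next
    assume "\<not> t" "t'"
    then show ?thesis using differ[OF assms(2,1), of a' b' a b] assms(3-5) by (simp add: base_ok_def base_value_def)
  qed
qed

text \<open>\<open>c\<close> is the third barycentric coordinate. The downward triangles form an
  array with one row less, hence \<open>k - 2\<close> in place of \<open>k - 1\<close>.\<close>

lemma turn_base:
  assumes "m \<in> coarse" "base_ok k t a b"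
  defines "c \<equiv> (if t then k - 1 - a - b else k - 2 - a - b)"
  shows "base_ok k t b c" "turn (base_value m t a b) = base_value (cturn m) t b c"
proof -
  show "base_ok k t b c" using assms(2) by (auto simp: base_ok_def c_def)
  show "turn (base_value m t a b) = base_value (cturn m) t b c"
  proof (cases t)
    case True
    then show ?thesis
      using assms(2) grid_cturn[OF assms(1), of b c a] by (simp add: base_ok_def base_value_def c_def)
  next
    case False
    then have "turn (flip (grid m a (Suc b))) = flip (turn (grid m a b))"
      using assms(2) by (intro flip_turn_grid assms(1)) (simp add: base_ok_def)
    moreover have "turn (grid m a b) = grid (cturn m) b (Suc c)"
      using False assms(2) grid_cturn[OF assms(1), of b "Suc c" a] by (simp add: base_ok_def c_def)
    ultimately show ?thesis using False by (simp add: base_value_def)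
  qed
qed

lemma cturn_funpow_coarse: "m \<in> coarse \<Longrightarrow> (cturn ^^ i) m \<in> coarse"
  by (induction i) (simp_all add: cturn_coarse)

lemma turn_base_funpow:
  assumes "m \<in> coarse" "base_ok k t a b"
  shows "\<exists>a' b'. base_ok k t a' b' \<and> (turn ^^ i) (base_value m t a b) = base_value ((cturn ^^ i) m) t a' b'"
proof (induction i)
  case (Suc i)
  then obtain a' b' where ab: "base_ok k t a' b'"
    "(turn ^^ i) (base_value m t a b) = base_value ((cturn ^^ i) m) t a' b'"
    by blast
  note tb = turn_base[OF cturn_funpow_coarse[OF assms(1), of i] ab(1)]
  have "(turn ^^ Suc i) (base_value m t a b) =
      base_value ((cturn ^^ Suc i) m) t b' (if t then k - 1 - a' - b' else k - 2 - a' - b')"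
    using ab(2) tb(2) by simp
  then show ?case using tb(1) by blast
qed (use assms in auto)

text \<open>Both darts are turned from base darts, and comparing these identifies powers of
  \<open>cturn\<close> at \<open>m\<close> and \<open>m'\<close>. If \<open>m' = m\<close>, the
  exponents agree because no coarse triangle coincides with a rotated copy of itself.\<close>

lemma develop_eq:
  assumes m: "m \<in> coarse" "m' \<in> coarse" and x: "x \<in> lattice_darts" "x' \<in> lattice_darts"
    and meet: "cell x \<inter> big_triangle k \<noteq> {}" "cell x' \<inter> big_triangle k \<noteq> {}"
    and eq: "develop m x = develop m' x'"
  shows "m' \<in> orbit cturn m" "m' = m \<Longrightarrow> x' = x"
proof -
  obtain i t a b where i: "i < 3" "base_ok k t a b" "x = (lface_next ^^ i) (base_dart t a b)"
    by (rule meets_base[OF k_pos x(1) meet(1)])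
  obtain j t' a' b' where j: "j < 3" "base_ok k t' a' b'" "x' = (lface_next ^^ j) (base_dart t' a' b')"
    by (rule meets_base[OF k_pos x(2) meet(2)])
  have eq': "(turn ^^ i) (base_value m t a b) = (turn ^^ j) (base_value m' t' a' b')"
    using eq by (simp add: i j develop_base)
  have mm: "(cturn ^^ i) m = (cturn ^^ j) m'"
    using turn_base_funpow[OF m(1) i(2), of i] turn_base_funpow[OF m(2) j(2), of j] eq'
      base_value_eq[OF cturn_funpow_coarse[OF m(1)] cturn_funpow_coarse[OF m(2)]] by metis
  have c3: "(cturn ^^ 3) m = m" if "m \<in> coarse" for m
    using cturn_cturn_cturn[OF that] by (simp add: numeral_3_eq_3)
  have "m' = (cturn ^^ (3 - j + j)) m'" using c3[OF m(2)] j(1) by simp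
  also have "\<dots> = (cturn ^^ (3 - j + i)) m" unfolding funpow_add comp_def mm[symmetric] ..
  finally show "m' \<in> orbit cturn m"
    unfolding orbit_altdef using j(1) by force
  show "x' = x" if "m' = m"
  proof -
    have ne: "cturn m \<noteq> m" "cturn (cturn m) \<noteq> m" "cturn (cturn m) \<noteq> cturn m"
      using cturn_neq[OF m(1)] cturn_neq[OF cturn_coarse[OF m(1)]] cturn_cturn_cturn[OF m(1)] by metis+
    have "i = 0 \<or> i = 1 \<or> i = 2" "j = 0 \<or> j = 1 \<or> j = 2" using i(1) j(1) by linarith+
    then have "i = j" using mm that ne ne[symmetric] by (auto simp: numeral_2_eq_2)
    have "inj (turn ^^ i)" by (rule inj_fn) (simp add: inj_def)
    then have "base_value m t a b = base_value m' t' a' b'"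
      using eq' \<open>i = j\<close> by (simp add: inj_eq)
    then show ?thesis using base_value_eq[OF m i(2) j(2)] i(3) j(3) \<open>i = j\<close> by simp
  qed
qed

text \<open>The identity goes around the end vertex of \<open>grid m a b\<close>, where four
  rotations are replaced by two inverse ones; \<open>Suc a < k\<close> makes this vertex
  flat.\<close>

lemma flip_turn_turn_grid:
  assumes "m \<in> coarse" "Suc a < k"
  shows "turn (turn (flip (grid m a (Suc b)))) = flip (turn (turn (grid m (Suc a) b)))"
proof -
  let ?z = "grid m a b"
  have "turn (turn (flip (up ?z))) = rot' (flip (rot' (up ?z)))"
    by (simp add: turn_turn flip_rot_flip)
  also have "\<dots> = rot' (rot' (flip ?z))" by (simp add: up_alt)
  also have "\<dots> = flip (turn (turn (ahead ?z)))"
    using flat_end_rot'(1)[OF flat_end_grid[OF assms], of b] by (simp add: turn_turn ahead_def)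
  finally show ?thesis using grid_Suc_right[OF assms(1), of a b] assms(2) by (simp add: grid_Suc)
qed

lemma side_big_triangle:
  assumes "side (eis a b, eis c e) \<inter> big_triangle k \<noteq> {}"
  obtains v where "0 < v" "v < 1" "0 < of_int a + v * of_int c" "0 < of_int b + v * of_int e"
    "of_int a + v * of_int c + (of_int b + v * of_int e) < real k"
proof -
  obtain z where z: "z \<in> side (eis a b, eis c e)" "z \<in> big_triangle k" using assms by blast
  then obtain v where v: "0 < v" "v < 1" "z = (1 - v) *\<^sub>R eis a b + v *\<^sub>R (eis a b + eis c e)"
    by (auto simp: side_def in_segment)
  then have "z = pt (of_int a + v * of_int c) (of_int b + v * of_int e)"
    by (simp add: eis_pt pt_def scaleR_conv_of_real algebra_simps)
  then have "pt (of_int a + v * of_int c) (of_int b + v * of_int e) \<in> big_triangle k"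
    using z(2) by simp
  then show ?thesis using that[of v] v(1,2) unfolding pt_big_triangle[OF k_pos] by blast
qed

lemma side_lopp: "side (lopp x) = side x"
  by (simp add: side_def lopp_eq open_segment_commute)

text \<open>Reversal exchanges the directions of upward and downward triangles, so one dart of each
  edge suffices. The three remaining directions correspond to the definition,
  \<open>flip_turn_grid\<close> and \<open>flip_turn_turn_grid\<close>.\<close>

lemma develop_opp:
  assumes m: "m \<in> coarse" and x: "x \<in> lattice_darts" and meet: "side x \<inter> big_triangle k \<noteq> {}"
  shows "develop m (lopp x) = flip (develop m x)"
proof -
  have main: "develop m (lopp (eis a b, eis c e)) = flip (develop m (eis a b, eis c e))"
    if sd: "side (eis a b, eis c e) \<inter> big_triangle k \<noteq> {}"
      and ce: "(c, e) \<in> {(1, 0), (-1, 1), (0, -1)}" for a b c e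
  proof -
    obtain v where v: "0 < v" "v < 1" "0 < of_int a + v * of_int c" "0 < of_int b + v * of_int e"
      "of_int a + v * of_int c + (of_int b + v * of_int e) < real k"
      by (rule side_big_triangle[OF sd])
    from ce consider "c = 1" "e = 0" | "c = -1" "e = 1" | "c = 0" "e = -1" by auto
    then show ?thesis
    proof cases
      case 1
      then show ?thesis by (simp add: lopp_eis develop_def)
    next
      case 2
      have "0 < real_of_int a - v" "0 < real_of_int b + v" "real_of_int a + real_of_int b < real k"
        using v(3-5) 2 by simp_all
      then have ab: "1 \<le> a \<and> 0 \<le> b \<and> a + b < int k" using v(1,2) by linarith
      then have "turn (flip (grid m (nat (a - 1)) (Suc (nat b)))) = flip (turn (grid m (nat (a - 1)) (nat b)))"
        by (intro flip_turn_grid[OF m]) linarith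
      moreover have "nat (b + 1) = Suc (nat b)" using ab by linarith
      ultimately show ?thesis using 2 by (simp add: lopp_eis develop_def)
    next
      case 3
      have "0 < real_of_int a" "0 < real_of_int b - v" "real_of_int a + real_of_int b - v < real k"
        using v(3-5) 3 by simp_all
      then have a: "1 \<le> a \<and> 1 \<le> b \<and> a + b \<le> int k" using v(1,2) by linarith
      then have "turn (turn (flip (grid m (nat (a - 1)) (Suc (nat (b - 1)))))) =
          flip (turn (turn (grid m (Suc (nat (a - 1))) (nat (b - 1)))))"
        by (intro flip_turn_turn_grid[OF m]) linarith
      moreover have "Suc (nat (a - 1)) = nat a" "Suc (nat (b - 1)) = nat b" using a by linarith+
      ultimately show ?thesis using 3 by (simp add: lopp_eis develop_def)
    qed
  qed
  obtain a b c e where xe: "x = (eis a b, eis c e)"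
    and c: "(c, e) \<in> {(1, 0), (0, 1), (-1, 1), (-1, 0), (0, -1), (1, -1)}"
    by (rule lattice_dart_coordinates[OF x])
  show ?thesis
  proof (cases "(c, e) \<in> {(1, 0), (-1, 1), (0, -1)}")
    case True
    then show ?thesis using main meet xe by simp
  next
    case False
    then have "(- c, - e) \<in> {(1, 0), (-1, 1), (0, -1)}" using c by auto
    moreover have lx: "lopp x = (eis (a + c) (b + e), eis (- c) (- e))" by (simp add: xe lopp_eis)
    moreover have "side (lopp x) \<inter> big_triangle k \<noteq> {}" using meet by (simp add: side_lopp)
    ultimately have "develop m (lopp (lopp x)) = flip (develop m (lopp x))"
      using main[of "a + c" "b + e" "- c" "- e"] by simp
    moreover have "lopp (lopp x) = x" by (simp add: lopp_eq)
    ultimately show ?thesis by simp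
  qed
qed

text \<open>The motion is the rotation of the big triangle by 120 degrees about its centre, which on
  base darts is the cyclic permutation of barycentric coordinates followed by one face step.\<close>

lemma develop_cturn:
  assumes "m \<in> coarse" "x \<in> lattice_darts" "cell x \<inter> big_triangle k \<noteq> {}"
  shows "develop m (move (coxeter_vec (k, 0), omega ^ 2) x) = develop (cturn m) x"
proof -
  obtain i t a b where x: "base_ok k t a b" "x = (lface_next ^^ i) (base_dart t a b)"
    by (rule meets_base[OF k_pos assms(2,3)])
  let ?g = "(coxeter_vec (k, 0), omega ^ 2)"
  define c where "c = (if t then k - 1 - a - b else k - 2 - a - b)"
  have g: "?g = (eis (int k) 0, eis (- 1) 1)"
    by (simp add: coxeter_vec_def eis_def unit_coordinates(3)[unfolded eis_def])
  have "move ?g (base_dart t a b) = lface_next (base_dart t c a)"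
    using x(1) unfolding g
    by (auto simp: base_ok_def base_dart_def c_def move_eis eis_arith lface_next_eis of_nat_diff)
  moreover have "move ?g ((lface_next ^^ i) y) = (lface_next ^^ i) (move ?g y)" for y
    by (induction i) (simp_all add: move_lface_next)
  ultimately have "move ?g x = (lface_next ^^ Suc i) (base_dart t c a)"
    by (simp add: x(2) funpow_swap1)
  then have "develop m (move ?g x) = (turn ^^ i) (turn (base_value m t c a))"
    using develop_base[of m "Suc i" t c a] by (simp add: funpow_swap1)
  also have "turn (base_value m t c a) = base_value (cturn m) t a b"
  proof -
    have ok: "base_ok k t c a" using x(1) by (auto simp: base_ok_def c_def)
    have "(if t then k - 1 - c - a else k - 2 - c - a) = b"
      using x(1) by (auto simp: base_ok_def c_def)
    then show ?thesis using turn_base(2)[OF assms(1) ok] by simp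
  qed
  finally show ?thesis by (simp add: x(2) develop_base)
qed

lemma develop_cflip:
  assumes m: "m \<in> coarse" and x: "x \<in> lattice_darts" and meet: "cell x \<inter> big_triangle k \<noteq> {}"
    and side: "side x \<subseteq> open_segment 0 (coxeter_vec (k, 0))"
  shows "develop (cflip m) (move (coxeter_vec (k, 0), - 1) (lopp x)) = flip (develop m x)"
proof -
  obtain a b c e where xe: "x = (eis a b, eis c e)"
    and c: "(c, e) \<in> {(1, 0), (0, 1), (-1, 1), (-1, 0), (0, -1), (1, -1)}"
    by (rule lattice_dart_coordinates[OF x])
  have cv: "coxeter_vec (k, 0) = pt (real k) 0" by (simp add: coxeter_vec_pt)
  have "real_of_int b + v * real_of_int e = 0" if v: "0 < v" "v < 1" for v
  proof -
    have "eis c e \<noteq> 0" using c by (auto simp: eis_const(1))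
    then have "(1 - v) *\<^sub>R eis a b + v *\<^sub>R (eis a b + eis c e) \<in> side x"
      using v by (auto simp: xe side_def in_segment)
    moreover have "(1 - v) *\<^sub>R eis a b + v *\<^sub>R (eis a b + eis c e) =
        pt (of_int a + v * of_int c) (of_int b + v * of_int e)"
      by (simp add: eis_pt pt_def scaleR_conv_of_real algebra_simps)
    ultimately have "pt (of_int a + v * of_int c) (of_int b + v * of_int e) \<in> open_segment 0 (pt (real k) 0)"
      using side cv by auto
    then obtain u where "pt (of_int a + v * of_int c) (of_int b + v * of_int e) = u *\<^sub>R pt (real k) 0"
      by (auto simp: in_segment)
    also have "\<dots> = pt (u * real k) 0" by (simp add: pt_def scaleR_conv_of_real)
    finally show ?thesis by simp
  qed
  \<comment> \<open>The height along the edge is affine, so its vanishing at two points gives both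
    coefficients.\<close>
  from this[of "1/2"] this[of "1/4"] have "e = 0" "b = 0" by simp_all
  then have "c = 1 \<or> c = -1" using c by auto
  moreover have "c \<noteq> -1"
    using meet down_cell_meets(1)[OF k_pos, of a b] by (auto simp: xe \<open>e = 0\<close> \<open>b = 0\<close>)
  ultimately have x1: "x = (eis a 0, eis 1 0)" by (simp add: xe \<open>e = 0\<close> \<open>b = 0\<close>)
  then have a: "0 \<le> a" "a < int k" using meet up_cell_meets(1)[OF k_pos, of a 0] by simp_all
  have g: "(coxeter_vec (k, 0), - 1) = (eis (int k) 0, eis (- 1) 0)"
    by (simp add: coxeter_vec_def eis_def)
  have "move (coxeter_vec (k, 0), - 1) (lopp x) = (eis (int k - a - 1) 0, eis 1 0)"
    unfolding g x1 by (simp add: lopp_eis move_eis eis_arith)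
  moreover have "grid (cflip m) (nat (int k - a - 1)) 0 = flip (grid m (nat a) 0)"
    by (rule grid_cflip[OF m]) (use a in linarith)
  ultimately show ?thesis by (simp add: develop_def x1)
qed

text \<open>The side runs along a lattice line, and an open cell lies strictly between two
  consecutive horizontal ones. Hence \<open>glue_cross\<close> never has a crossed triangle to
  consider here.\<close>

lemma cell_misses_side:
  assumes "x \<in> lattice_darts" shows "cell x \<inter> open_segment 0 (coxeter_vec (k, 0)) = {}"
proof -
  have n: "z \<noteq> of_real u" if zy: "z \<in> cell y" and y: "y = (eis a b, eis 1 0) \<or> y = (eis a b, eis (- 1) 0)" for z u y a b
  proof
    assume "z = of_real u"
    obtain w where w: "w \<in> unit_cell" "z = place y w" using zy by (auto simp: cell_iff)
    obtain s r where sr: "w = pt s r" by (rule pt_cases)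
    then have r: "0 < r" "r < 1" using w(1) by (simp_all add: unit_cell_pt)
    have "real_of_int b + r = 0 \<or> real_of_int b - r = 0"
      using y w(2) \<open>z = of_real u\<close> unfolding sr pt_const(5) by (auto simp: place_pt)
    then have "real_of_int (- 1) < real_of_int b \<and> real_of_int b < real_of_int 0 \<or>
        real_of_int 0 < real_of_int b \<and> real_of_int b < real_of_int 1"
      using r by (simp only: of_int_0 of_int_1 of_int_minus) linarith
    then show False unfolding of_int_less_iff by linarith
  qed
  have "\<exists>y a b. cell x = cell y \<and> (y = (eis a b, eis 1 0) \<or> y = (eis a b, eis (- 1) 0))"
    using assms
  proof (cases rule: lattice_dart_rotation)
    case (1 i a b)
    then have "cell x = cell (eis a b, eis 1 0)" by (simp only: cell_lface_next_funpow)
    then show ?thesis by blast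
  next
    case (2 i a b)
    then have "cell x = cell (eis a b, eis (- 1) 0)" by (simp only: cell_lface_next_funpow)
    then show ?thesis by blast
  qed
  then obtain y a b where "cell x = cell y" "y = (eis a b, eis 1 0) \<or> y = (eis a b, eis (- 1) 0)"
    by blast
  moreover have "\<exists>u. z = of_real u" if "z \<in> open_segment 0 (coxeter_vec (k, 0))" for z
    using that by (auto simp: in_segment coxeter_vec_def scaleR_conv_of_real intro: exI[of _ "u * real k" for u])
  ultimately show ?thesis using n by blast
qed

end

section \<open>Verification of the inflation\<close>

context coarse_fullerene
begin

lemma face_next_dual_F: "face_next (dual F) d = turn d"
  by (simp add: face_next_def[of "dual F"] turn_def)

lemma opp_deflation: "m \<in> coarse \<Longrightarrow> coarse_flip m = cflip m"
  by (simp add: coarse_flip_def)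

lemma face_next_dual_deflation: "m \<in> coarse \<Longrightarrow> face_next (dual deflation) m = cturn m"
  using nxt_deflation[of m] face_next_dual[OF plane_deflation, of m]
  by (simp only: deflation_simps(3) opp_deflation cflip_coarse cflip_cflip cturn_coarse)

lemma orbit_face_next_dual_deflation:
  "m \<in> coarse \<Longrightarrow> orbit (face_next (dual deflation)) m = orbit cturn m"
  by (rule orbit_cong0[where A = coarse])
    (auto simp: face_next_dual_deflation cturn_coarse simp del: dual_simps)

lemma inflation_deflation: "inflation k deflation F"
proof -
  let ?t = "coxeter_vec (k, 0)"
  have hull: "interior (convex hull {0, ?t, omega * ?t}) = big_triangle k"
    by (simp add: big_triangle_def)
  have tk: "?t = of_nat k" by (simp add: coxeter_vec_def)
  have "straight_triangulation (dual F) (dual deflation) (\<lambda>_. (k, 0)) (\<lambda>_. omega * ?t) develop"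
  proof (unfold_locales, unfold hull dual_simps deflation_simps)
    show "plane_map (dual deflation)" by (rule plane_map_dual[OF plane_deflation])
    show "card f = 3" if f: "f \<in> faces (dual deflation)" for f
    proof -
      obtain m where m: "m \<in> coarse" "f = orbit (face_next (dual deflation)) m"
        using f by (auto simp: faces_def)
      then have "f = orbit cturn m" by (simp only: orbit_face_next_dual_deflation)
      then show ?thesis
        using card_orbit_3[of cturn m] cturn_cturn_cturn cturn_neq m(1) by simp
    qed
    show "0 < fst (k, 0 :: nat)" using k_pos by simp
    show "0 < Im (cnj ?t * (omega * ?t))" using k_pos by (simp add: tk)
    show "develop m x \<in> darts F" if "m \<in> coarse" "x \<in> lattice_darts" "cell x \<inter> big_triangle k \<noteq> {}" for m x
      by (rule meets_base[OF k_pos that(2,3)]) (use that(1) in \<open>simp add: develop_base coarse_D\<close>)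
    show "develop m (lface_next x) = face_next (dual F) (develop m x)"
      if h: "m \<in> coarse" "x \<in> lattice_darts" "cell x \<inter> big_triangle k \<noteq> {}" for m x
    proof -
      obtain i t a b where "x = (lface_next ^^ i) (base_dart t a b)"
        by (rule meets_base[OF k_pos h(2,3)])
      then show ?thesis
        using develop_base[of m i t a b] develop_base[of m "Suc i" t a b]
        by (simp add: face_next_dual_F)
    qed
    show "develop m (lopp x) = opp F (develop m x)"
      if "m \<in> coarse" "x \<in> lattice_darts" "side x \<inter> big_triangle k \<noteq> {}" for m x
      by (rule develop_opp[OF that])
    show "\<exists>u. u ^ 6 = 1 \<and> place (?t, u) ?t = omega * ?t \<and> place (?t, u) (omega * ?t) = 0 \<and>
        (\<forall>x\<in>lattice_darts. cell x \<inter> big_triangle k \<noteq> {} \<longrightarrow>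
          develop m (move (?t, u) x) = develop (face_next (dual deflation) m) x)"
      if "m \<in> coarse" for m
    proof (intro exI conjI ballI impI)
      \<comment> \<open>The next side of an equilateral facet is turned by the exterior angle of 120
        degrees, hence the witness \<open>omega ^ 2\<close>.\<close>
      show "(omega ^ 2) ^ 6 = 1"
        using omega_powers(5) by (metis power_mult mult.commute power_one)
      have "omega * (omega * ?t) = (omega - 1) * ?t"
        by (simp only: mult.assoc[symmetric] omega_square)
      then show "place (?t, omega ^ 2) ?t = omega * ?t" "place (?t, omega ^ 2) (omega * ?t) = 0"
        unfolding place_eq omega_powers(1) by (simp_all add: algebra_simps)
      show "develop m (move (?t, omega ^ 2) x) = develop (face_next (dual deflation) m) x"
        if "x \<in> lattice_darts" "cell x \<inter> big_triangle k \<noteq> {}" for x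
        using develop_cturn[OF \<open>m \<in> coarse\<close> that] face_next_dual_deflation[OF \<open>m \<in> coarse\<close>] by simp
    qed
    show "develop (coarse_flip m) (move (?t, - 1) x) = develop m x"
      if "m \<in> coarse" "x \<in> lattice_darts" "cell x \<inter> open_segment 0 ?t \<noteq> {}" for m x
      using that cell_misses_side by blast
    show "develop (coarse_flip m) (move (?t, - 1) (lopp x)) = opp F (develop m x)"
      if "m \<in> coarse" "x \<in> lattice_darts" "side x \<subseteq> open_segment 0 ?t"
        "cell x \<inter> big_triangle k \<noteq> {}" for m x
      using develop_cflip[OF that(1,2,4,3)] opp_deflation[OF that(1)] by simp
    show "\<exists>m\<in>coarse. \<exists>x\<in>lattice_darts. develop m x = d \<and>
        place x w \<in> convex hull {0, ?t, omega * ?t}"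
      if d: "d \<in> darts F" and w: "w \<in> unit_cell" for d w
    proof -
      have "\<exists>m\<in>coarse. \<exists>t a b. base_ok k t a b \<and> d = base_value m t a b"
      proof -
        have "d \<in> {grid m a b |m a b. m \<in> coarse \<and> a + b < k} \<union>
            {opp F (grid m a b) |m a b. m \<in> coarse \<and> a + b < k}"
          using cells_cover[of coarse] coarse_nonempty cturn_coarse cflip_coarse d by simp
        then obtain m a b where m: "m \<in> coarse" "a + b < k" "d = grid m a b \<or> d = opp F (grid m a b)"
          by blast
        have up: "\<exists>m\<in>coarse. \<exists>t a b. base_ok k t a b \<and> grid n a' b' = base_value m t a b"
          if "n \<in> coarse" "a' + b' < k" for n a' b'
          using that by (intro bexI[of _ n] exI[of _ True] exI[of _ a'] exI[of _ b'])
            (simp_all add: base_ok_def base_value_def)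
        show ?thesis
        proof (cases "d = grid m a b")
          case True
          then show ?thesis using up[OF m(1,2)] by simp
        next
          case False
          then have d': "d = opp F (grid m a b)" using m(3) by blast
          show ?thesis
          proof (cases b)
            case 0
            \<comment> \<open>A reversed dart on the coarse edge belongs to the coarse triangle
              across that edge, where it is the base dart of an upward triangle.\<close>
            then have "d = grid (cflip m) (k - 1 - a) 0"
              using grid_cflip[OF m(1), of a "k - 1 - a"] m(2) d' by simp
            then show ?thesis using up[OF cflip_coarse[OF m(1)], of "k - 1 - a" 0] m(2) by simp
          next
            case (Suc c)
            then have "base_ok k False a c \<and> d = base_value m False a c"
              using m(2) d' by (simp add: base_ok_def base_value_def)
            then show ?thesis using m(1) by blast
          qed
        qed
      qed
      then obtain m t a b where m: "m \<in> coarse" "base_ok k t a b" "d = base_value m t a b" by blast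
      have "develop m (base_dart t a b) = d" using develop_base[of m 0 t a b] m(3) by simp
      moreover have "place (base_dart t a b) w \<in> big_triangle k"
        using m(2) up_cell_meets(2)[OF k_pos w, of "int a" "int b"]
          down_cell_meets(2)[OF k_pos w, of "int a + 1" "int b + 1"]
        by (auto simp: base_dart_def base_ok_def)
      then have "place (base_dart t a b) w \<in> convex hull {0, ?t, omega * ?t}"
        unfolding big_triangle_def using interior_subset by blast
      ultimately show ?thesis using m(1) base_dart_lattice by blast
    qed
    show "m' \<in> orbit (face_next (dual deflation)) m \<and> (m' = m \<longrightarrow> x' = x)"
      if "m \<in> coarse" "m' \<in> coarse" "x \<in> lattice_darts" "x' \<in> lattice_darts" "w \<in> unit_cell"
        "place x w \<in> big_triangle k" "place x' w \<in> big_triangle k" "develop m x = develop m' x'"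
      for m m' x x' w
    proof -
      have "cell x \<inter> big_triangle k \<noteq> {}" "cell x' \<inter> big_triangle k \<noteq> {}"
        using that(5-7) by (auto simp: cell_disjoint)
      then show ?thesis
        using develop_eq[OF that(1-4) _ _ that(8)] orbit_face_next_dual_deflation[OF that(1)] by simp
    qed
  qed simp
  then show ?thesis unfolding goldberg_coxeter_def by blast
qed

end

theorem theorem1:
  fixes F :: "'a cmap" and M :: "'b cmap" and cox :: "'b \<Rightarrow> nat \<times> nat" and k :: nat
  assumes "fullerene F"
    and "master_polyhedron F M cox"
    and "k > 1"
    and "\<And>m. m \<in> darts M \<Longrightarrow> k dvd fst (cox m) \<and> k dvd snd (cox m)"
  shows "goldberg_coxeter_fullerene F \<and> (\<exists>G :: 'a cmap. fullerene G \<and> inflation k G F)"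
proof -
  have "k > 0" using assms(3) by simp
  then obtain \<alpha> \<beta> where "coarse_fullerene F k \<alpha> \<beta>"
    by (rule master_polyhedron_coarse[OF assms(1,2) _ assms(4)])
  then interpret c: coarse_fullerene F k \<alpha> \<beta> .
  have "fullerene c.deflation" "inflation k c.deflation F"
    by (rule c.fullerene_deflation, rule c.inflation_deflation)
  moreover have "k \<ge> 1" "(k, 0) \<noteq> (1, 0 :: nat)" using assms(3) by simp_all
  ultimately show ?thesis
    unfolding goldberg_coxeter_fullerene_def using assms(1) by blast
qed

end
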